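(* Let $\mathcal{S}=\{S_1,\dots,S_N\}$ be an iterated function system on $\mathbb{H}^n$ of contractive similarities $S_i=\tau_{q_i}\circ\delta_{r_i}$, with $q_i\in\mathbb{H}^n$ and $0<r_1\le\dots\le r_N<1$, that satisfies the open set condition. Let $K$ be its invariant set and suppose that $0<\mathcal{H}^m(K)<\infty$ for some $m\in\mathbb{N}\cap[1,2n+1]$. If $K\not\subset F$ for all $F\in\operatorname{tr}\mathcal{V}_{m-1}\cup\operatorname{tr}\mathcal{W}_m$, then the maximal $m$-Riesz transform $\mathcal{R}^*_m$ is not bounded in $L^2(\mathcal{H}^m\lfloor K)$. In particular, if $m\in\mathbb{N}\cap[1,2n+1]$, $r=2^{-(2n+2)/m}\in(0,\tfrac12)$, $K_r$ is the corresponding ($m$-dimensional) Cantor-like set described in the context, and $\mu=\mathcal{H}^m\lfloor K_r$ is the natural measure on it, then $\mathcal{R}^*_m$ is not bounded in $L^2(\mu)$.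
   Context: $n\ge1$ is an integer. The Heisenberg group $\mathbb{H}^n$ is $\mathbb{R}^{2n+1}$, with points $p=(p',p_{2n+1})$, $p'\in\mathbb{R}^{2n}$, and group law $p\cdot q=(p'+q',\,p_{2n+1}+q_{2n+1}+A(p,q))$, where $A(p,q)=-2\sum_{i=1}^n(p_iq_{i+n}-p_{i+n}q_i)$. Put $\|p\|=(|p'|^4+p_{2n+1}^2)^{1/4}$ and $d(p,q)=\|p^{-1}\cdot q\|$, a left-invariant metric; $B(p,r)$ is the closed $d$-ball and $\mathcal{H}^m$ the $m$-dimensional Hausdorff measure with respect to $d$; $\mathcal{H}^m\lfloor K$ is its restriction to $K$. $\tau_q(p)=q\cdot p$ and $\delta_r(p)=(rp',r^2p_{2n+1})$, $r>0$. Open set condition: there is a bounded nonempty open $O\subset\mathbb{H}^n$ with $\bigcup_iS_i(O)\subset O$ and $S_i(O)\cap S_j(O)=\emptyset$ for $i\ne j$. The invariant set $K$ is the unique nonempty compact set with $K=\bigcup_iS_i(K)$. Subgroups: for integers $1\le d\le2n$, $\mathcal{V}_d$ is the set of vertical subgroups $V_L=\{p\in\mathbb{H}^n:p'\in L\}$, where $L$ is a $(d-1)$-dimensional linear subspace of $\mathbb{R}^{2n}$, and $\operatorname{tr}\mathcal{V}_d=\{a\cdot V:a\in\mathbb{H}^n,V\in\mathcal{V}_d\}$. For $0\le d\le2n$, $\mathcal{W}_d$ is the set of horizontal subgroups of linear dimension $d$, i.e. sets $L\times\{0\}$ with $L$ a $d$-dimensional linear subspace of $\mathbb{R}^{2n}$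 such that $A(p,q)=0$ for all $p,q\in L\times\{0\}$; $\operatorname{tr}\mathcal{W}_d=\{a\cdot G:a\in\mathbb{H}^n,G\in\mathcal{W}_d\}$. By convention $\mathcal{V}_0=\emptyset$ and $\mathcal{W}_{2n+1}=\emptyset$. Riesz transforms: $R_{s,i}(p)=p_i/\|p\|^{s+1}$ for $i\le2n$ and $R_{s,2n+1}(p)=p_{2n+1}/\|p\|^{s+2}$. For a Radon measure $\mu$ and $f\in L^1(\mu)$, $\mathcal{R}^{\varepsilon}_{s,i}(f)(p)=\int_{\mathbb{H}^n\setminus B(p,\varepsilon)}R_{s,i}(p^{-1}\cdot q)f(q)\,d\mu(q)$ and $\mathcal{R}^*_{s,i}(f)(p)=\sup_{\varepsilon>0}|\mathcal{R}^{\varepsilon}_{s,i}(f)(p)|$. $\mathcal{R}^*_s=(\mathcal{R}^*_{s,i})_{i=1}^{2n+1}$ is bounded in $L^2(\mu)$ if for each $i=1,\dots,2n+1$ the operator $\mathcal{R}^*_{s,i}$ is bounded in $L^2(\mu)$. Cantor-like sets: for $r\in(0,\frac12)$ let $z_1,\dots,z_{2^{2n}}$ be the distinct points of $\{0,1-r\}^{2n}\subset\mathbb{R}^{2n}$. $K_r$ is the invariant set of the $2^{2n+2}$ similarities $\tau_{(z_j,k/4)}\circ\delta_r$, $j=1,\dots,2^{2n}$, $k=0,1,2,3$. *)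

theory Defs
  imports "HOL-Analysis.Analysis"
begin

section \<open>The Heisenberg group\<close>

text \<open>
  The dimension \<open>n \<ge> 1\<close> is \<open>CARD('n)\<close>. The horizontal part \<open>p'\<close> of a point lies in
  \<open>\<real>\<^sup>2\<^sup>n\<close>, indexed by \<open>'n + 'n\<close>: the coordinates \<open>p\<^sub>i\<close> and \<open>p\<^sub>i\<^sub>+\<^sub>n\<close> are
  \<open>hor p $ Inl i\<close> and \<open>hor p $ Inr i\<close>; \<open>vert p\<close> is the last coordinate. A separate type (rather
  than a product type) is used so that the metric, and with it all topological and metric library
  notions, is the one of the Heisenberg group.
\<close>

datatype (dead 'n::finite) heis = Heis (hor: "real ^ ('n + 'n)") (vert: real)

definition hform :: "real ^ ('n::finite + 'n) \<Rightarrow> real ^ ('n + 'n) \<Rightarrow> real" where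
  "hform x y = - 2 * (\<Sum>i\<in>UNIV. x $ Inl i * y $ Inr i - x $ Inr i * y $ Inl i)"

definition hmult :: "'n::finite heis \<Rightarrow> 'n heis \<Rightarrow> 'n heis"  (infixl \<open>\<odot>\<close> 70) where
  "p \<odot> q = Heis (hor p + hor q) (vert p + vert q + hform (hor p) (hor q))"

definition hinv :: "'n::finite heis \<Rightarrow> 'n heis" where
  "hinv p = Heis (- hor p) (- vert p)"

definition hnorm :: "'n::finite heis \<Rightarrow> real" where
  "hnorm p = root 4 (norm (hor p) ^ 4 + (vert p)\<^sup>2)"

definition htrans :: "'n::finite heis \<Rightarrow> 'n heis \<Rightarrow> 'n heis" where
  "htrans q p = q \<odot> p"

definition hdil :: "real \<Rightarrow> 'n::finite heis \<Rightarrow> 'n heis" where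
  "hdil r p = Heis (r *\<^sub>R hor p) (r\<^sup>2 * vert p)"

lemma heis_eq_iff: "p = q \<longleftrightarrow> hor p = hor q \<and> vert p = vert q"
  by (cases p; cases q) auto

lemma hform_simps:
  "hform (x + y) z = hform x z + hform y z"
  "hform z (x + y) = hform z x + hform z y"
  "hform (- x) z = - hform x z"
  "hform z (- x) = - hform z x"
  by (auto simp: hform_def algebra_simps sum.distrib sum_subtractf sum_negf)

lemma hform_self [simp]: "hform x x = 0"
  by (simp add: hform_def mult.commute)

lemma hform_skew: "hform y x = - hform x y"
  by (auto simp: hform_def algebra_simps sum.distrib sum_subtractf sum_negf)

lemma hmult_assoc: "(p \<odot> q) \<odot> r = p \<odot> (q \<odot> r)"
  by (simp add: hmult_def hform_simps algebra_simps)

lemma hmult_zero [simp]: "Heis 0 0 \<odot> p = p" "p \<odot> Heis 0 0 = p"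
  by (auto simp: hmult_def hform_def heis_eq_iff)

lemma hinv_hmult [simp]: "hinv p \<odot> p = Heis 0 0" "p \<odot> hinv p = Heis 0 0"
  by (auto simp: hmult_def hinv_def hform_simps)

lemma hinv_hinv [simp]: "hinv (hinv p) = p"
  by (simp add: hinv_def heis_eq_iff)

lemma hinv_mult: "hinv (p \<odot> q) = hinv q \<odot> hinv p"
  by (simp add: hinv_def hmult_def hform_simps hform_skew [of "hor p" "hor q"])

lemma hnorm_nonneg: "hnorm p \<ge> 0"
  by (simp add: hnorm_def)

lemma hnorm_pow4: "hnorm p ^ 4 = norm (hor p) ^ 4 + (vert p)\<^sup>2"
  by (simp add: hnorm_def)

lemma hnorm_eq_0_iff: "hnorm p = 0 \<longleftrightarrow> p = Heis 0 0"
proof -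
  have "hnorm p = 0 \<longleftrightarrow> norm (hor p) ^ 4 + (vert p)\<^sup>2 = 0"
    by (simp add: hnorm_def)
  also have "\<dots> \<longleftrightarrow> p = Heis 0 0"
    by (subst add_nonneg_eq_0_iff) (auto simp: heis_eq_iff)
  finally show ?thesis .
qed

lemma hnorm_hinv: "hnorm (hinv p) = hnorm p"
  by (simp add: hnorm_def hinv_def)

lemma norm_hor_le_hnorm: "norm (hor p) \<le> hnorm p"
proof -
  have "norm (hor p) ^ 4 \<le> hnorm p ^ 4"
    by (simp add: hnorm_pow4)
  then show ?thesis
    using power_mono_iff [of "norm (hor p)" "hnorm p" 4] by (simp add: hnorm_nonneg)
qed

lemma hform_Cauchy_Schwarz:
  fixes x y :: "real ^ ('n::finite + 'n)"
  shows "(x \<bullet> y)\<^sup>2 + (hform x y / 2)\<^sup>2 \<le> (norm x)\<^sup>2 * (norm y)\<^sup>2"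
proof -
  define J :: "real ^ ('n::finite + 'n)" where
    "J = (\<chi> k. case k of Inl i \<Rightarrow> - y $ Inr i | Inr i \<Rightarrow> y $ Inl i)"
  have UN: "(UNIV :: ('n + 'n) set) = Inl ` UNIV \<union> Inr ` UNIV"
    using UNIV_sum by blast
  have split: "(\<Sum>k\<in>UNIV. g k) = (\<Sum>i\<in>UNIV. g (Inl i)) + (\<Sum>i\<in>UNIV. g (Inr i))"
    for g :: "'n + 'n \<Rightarrow> real"
    unfolding UN by (subst sum.union_disjoint) (auto simp: sum.reindex inj_on_def)
  have xJ: "x \<bullet> J = hform x y / 2"
    by (simp add: J_def inner_vec_def split hform_def sum_subtractf sum_negf)
  have yJ: "y \<bullet> J = 0"
    by (simp add: J_def inner_vec_def split sum_negf mult.commute)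
  have JJ: "J \<bullet> J = y \<bullet> y"
    by (simp add: J_def inner_vec_def split)
  define a where "a = x \<bullet> y"
  define b where "b = x \<bullet> J"
  define v where "v = a *\<^sub>R y + b *\<^sub>R J"
  have xv: "x \<bullet> v = a\<^sup>2 + b\<^sup>2"
    by (simp add: v_def a_def b_def inner_add_right power2_eq_square)
  have vv: "v \<bullet> v = (a\<^sup>2 + b\<^sup>2) * (y \<bullet> y)"
    using yJ by (simp add: v_def inner_add_left inner_add_right JJ inner_commute [of J y]
        power2_eq_square algebra_simps)
  have "(a\<^sup>2 + b\<^sup>2)\<^sup>2 \<le> (x \<bullet> x) * (v \<bullet> v)"
    using Cauchy_Schwarz_ineq [of x v] by (simp add: xv)
  then have *: "(a\<^sup>2 + b\<^sup>2) * (a\<^sup>2 + b\<^sup>2) \<le> (a\<^sup>2 + b\<^sup>2) * ((x \<bullet> x) * (y \<bullet> y))"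
    by (simp add: vv power2_eq_square algebra_simps)
  have "a\<^sup>2 + b\<^sup>2 \<le> (x \<bullet> x) * (y \<bullet> y)"
  proof (cases "a\<^sup>2 + b\<^sup>2 = 0")
    case False
    then have "a\<^sup>2 + b\<^sup>2 > 0"
      by (metis add_nonneg_nonneg order_le_less zero_le_power2)
    with * show ?thesis by (simp add: mult_le_cancel_left_pos)
  qed simp
  then show ?thesis
    by (simp add: a_def b_def xJ power2_norm_eq_inner)
qed

lemma hnorm_triangle:
  fixes p q :: "'n::finite heis"
  shows "hnorm (p \<odot> q) \<le> hnorm p + hnorm q"
proof -
  define z :: "'n::finite heis \<Rightarrow> complex" where "z = (\<lambda>p. Complex ((norm (hor p))\<^sup>2) (vert p))"
  have cm: "cmod (z p) = (hnorm p)\<^sup>2" for p :: "'n heis"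
  proof -
    have "(cmod (z p))\<^sup>2 = hnorm p ^ 4"
      by (simp add: z_def cmod_power2 hnorm_pow4 flip: power_mult)
    also have "\<dots> = ((hnorm p)\<^sup>2)\<^sup>2"
      by (simp flip: power_mult)
    finally show ?thesis
      by (rule power2_eq_imp_eq) (auto simp: hnorm_nonneg)
  qed
  define w where "w = Complex (hor p \<bullet> hor q) (hform (hor p) (hor q) / 2)"
  have "(cmod w)\<^sup>2 \<le> (norm (hor p) * norm (hor q))\<^sup>2"
    using hform_Cauchy_Schwarz [of "hor p" "hor q"]
    by (simp add: w_def cmod_power2 power_mult_distrib)
  then have "cmod w \<le> norm (hor p) * norm (hor q)"
    by (rule power2_le_imp_le) simp
  also have "\<dots> \<le> hnorm p * hnorm q"
    by (intro mult_mono norm_hor_le_hnorm hnorm_nonneg) auto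
  finally have w: "cmod w \<le> hnorm p * hnorm q" .
  have eq: "z (p \<odot> q) = z p + z q + 2 * w"
    by (simp add: z_def w_def hmult_def complex_eq_iff power2_norm_eq_inner inner_add_left
        inner_add_right inner_commute)
  have "(hnorm (p \<odot> q))\<^sup>2 = cmod (z p + z q + 2 * w)"
    by (simp add: eq flip: cm)
  also have "\<dots> \<le> cmod (z p) + cmod (z q) + cmod (2 * w)"
    by (intro order.trans [OF norm_triangle_ineq] add_mono norm_triangle_ineq order.refl)
  also have "\<dots> \<le> (hnorm p)\<^sup>2 + (hnorm q)\<^sup>2 + 2 * (hnorm p * hnorm q)"
    using w by (simp add: cm norm_mult)
  also have "\<dots> = (hnorm p + hnorm q)\<^sup>2"
    by (simp add: power2_eq_square algebra_simps)
  finally show ?thesis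
    by (rule power2_le_imp_le) (simp add: hnorm_nonneg)
qed

instantiation heis :: (finite) metric_space
begin

definition dist_heis :: "'a heis \<Rightarrow> 'a heis \<Rightarrow> real" where
  "dist_heis p q = hnorm (hinv p \<odot> q)"

definition uniformity_heis :: "('a heis \<times> 'a heis) filter" where
  "uniformity_heis = (INF e\<in>{0<..}. principal {(x, y). dist x y < e})"

definition open_heis :: "'a heis set \<Rightarrow> bool" where
  "open_heis U \<longleftrightarrow> (\<forall>x\<in>U. eventually (\<lambda>(x', y). x' = x \<longrightarrow> y \<in> U) uniformity)"

instance
proof
  fix x y z :: "'a heis"
  show "dist x y = 0 \<longleftrightarrow> x = y"
  proof
    assume "dist x y = 0"
    then have "hinv x \<odot> y = Heis 0 0"
      by (simp add: dist_heis_def hnorm_eq_0_iff)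
    then have "x \<odot> (hinv x \<odot> y) = x"
      by simp
    then show "x = y"
      by (simp flip: hmult_assoc)
  qed (simp add: dist_heis_def hnorm_eq_0_iff)
  have sym: "dist z y = dist y z"
    unfolding dist_heis_def by (metis hinv_hinv hinv_mult hnorm_hinv)
  have "(hinv x \<odot> z) \<odot> (hinv z \<odot> y) = hinv x \<odot> (z \<odot> hinv z) \<odot> y"
    by (simp only: hmult_assoc)
  then have "hinv x \<odot> y = (hinv x \<odot> z) \<odot> (hinv z \<odot> y)"
    by simp
  then have "dist x y \<le> dist x z + dist z y"
    unfolding dist_heis_def by (metis hnorm_triangle)
  then show "dist x y \<le> dist x z + dist y z"
    by (simp add: sym)
qed (simp_all add: uniformity_heis_def open_heis_def)

end

section \<open>Hausdorff measure on a metric space\<close>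

text \<open>
  Countable additivity on the Borel sets is \<open>emeasure_hausdorff_measure\<close> below, so \<^const>\<open>measure_of\<close>
  does not fall back to the null measure. The covering sets are required to be bounded because \<^const>\<open>diameter\<close> is only meaningful for
  bounded sets. The weight of a set is its diameter to the power \<open>m\<close>, without a normalising
  factor.
\<close>

definition hausdorff_weight :: "nat \<Rightarrow> 'a::metric_space set \<Rightarrow> ennreal" where
  "hausdorff_weight m U = (if U = {} then 0 else ennreal (diameter U ^ m))"

definition hausdorff_covers :: "real \<Rightarrow> 'a::metric_space set \<Rightarrow> (nat \<Rightarrow> 'a set) set" where
  "hausdorff_covers \<delta> A = {U. A \<subseteq> (\<Union>i. U i) \<and> (\<forall>i. bounded (U i) \<and> diameter (U i) \<le> \<delta>)}"

definition hausdorff_premeasure :: "nat \<Rightarrow> real \<Rightarrow> 'a::metric_space set \<Rightarrow> ennreal" where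
  "hausdorff_premeasure m \<delta> A = (INF U\<in>hausdorff_covers \<delta> A. \<Sum>i. hausdorff_weight m (U i))"

definition hausdorff_outer :: "nat \<Rightarrow> 'a::metric_space set \<Rightarrow> ennreal" where
  "hausdorff_outer m A = (SUP \<delta>\<in>{0<..}. hausdorff_premeasure m \<delta> A)"

definition hausdorff_measure :: "nat \<Rightarrow> 'a::metric_space measure" where
  "hausdorff_measure m = measure_of UNIV (sets borel) (hausdorff_outer m)"

lemma hausdorff_weight_empty [simp]: "hausdorff_weight m {} = 0"
  by (simp add: hausdorff_weight_def)

lemma hausdorff_premeasure_le:
  assumes "U \<in> hausdorff_covers \<delta> A"
  shows "hausdorff_premeasure m \<delta> A \<le> (\<Sum>i. hausdorff_weight m (U i))"
  unfolding hausdorff_premeasure_def by (rule INF_lower[OF assms])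

lemma hausdorff_premeasure_empty: "0 < \<delta> \<Longrightarrow> hausdorff_premeasure m \<delta> {} = 0"
  using hausdorff_premeasure_le[of "\<lambda>_. {}" \<delta> "{}" m]
  by (simp add: hausdorff_covers_def)

lemma hausdorff_premeasure_mono:
  assumes "A \<subseteq> B" "\<delta> \<le> \<epsilon>"
  shows "hausdorff_premeasure m \<epsilon> A \<le> hausdorff_premeasure m \<delta> B"
  unfolding hausdorff_premeasure_def
  by (rule INF_superset_mono) (use assms in \<open>auto simp: hausdorff_covers_def intro: order.trans\<close>)

lemma hausdorff_premeasure_subadditive:
  "hausdorff_premeasure m \<delta> (\<Union>n. A n) \<le> (\<Sum>n. hausdorff_premeasure m \<delta> (A n))"
proof (rule ennreal_le_epsilon)
  let ?P = "hausdorff_premeasure m \<delta>" and ?w = "hausdorff_weight m"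
  fix e :: real assume e: "0 < e" and fin: "(\<Sum>n. ?P (A n)) < top"
  then have "?P (A n) < ?P (A n) + e * (1/2)^Suc n" for n
    by (auto simp add: less_top dest!: ennreal_suminf_lessD)
  then have "\<exists>U\<in>hausdorff_covers \<delta> (A n). (\<Sum>i. ?w (U i)) < ?P (A n) + e * (1/2)^Suc n" for n
    unfolding hausdorff_premeasure_def INF_less_iff by blast
  then obtain U where U: "\<And>n. U n \<in> hausdorff_covers \<delta> (A n)"
    and le: "\<And>n. (\<Sum>i. ?w (U n i)) \<le> ?P (A n) + e * (1/2)^Suc n"
    by (metis less_imp_le)
  define C where "C = case_prod U o prod_decode"
  have "C \<in> hausdorff_covers \<delta> (\<Union>n. A n)"
    using U by (auto simp: hausdorff_covers_def C_def subset_eq split: prod.splits)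
      (metis prod.case prod_encode_inverse)
  then have "?P (\<Union>n. A n) \<le> (\<Sum>i. ?w (C i))"
    by (rule hausdorff_premeasure_le)
  also have "\<dots> = (\<Sum>n. \<Sum>i. ?w (U n i))"
    unfolding C_def comp_def
    using suminf_ennreal_2dimen [of "\<lambda>n. \<Sum>i. ?w (U n i)" "\<lambda>x. ?w (case_prod U x)"] by simp
  also have "\<dots> \<le> (\<Sum>n. ?P (A n) + e * (1/2) ^ Suc n)"
    by (intro suminf_le allI le) auto
  also have "\<dots> = (\<Sum>n. ?P (A n)) + (\<Sum>n. ennreal e * ennreal ((1/2) ^ Suc n))"
    using \<open>0 < e\<close> by (subst suminf_add[symmetric])
      (auto simp del: ennreal_suminf_cmult simp add: ennreal_mult[symmetric])
  also have "\<dots> = (\<Sum>n. ?P (A n)) + e"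
    unfolding ennreal_suminf_cmult
    by (subst suminf_ennreal_eq[OF zero_le_power power_half_series]) auto
  finally show "?P (\<Union>n. A n) \<le> (\<Sum>n. ?P (A n)) + e" .
qed

lemma hausdorff_outer_mono: "A \<subseteq> B \<Longrightarrow> hausdorff_outer m A \<le> hausdorff_outer m B"
  unfolding hausdorff_outer_def by (intro SUP_mono' hausdorff_premeasure_mono) auto

lemma hausdorff_outer_empty: "hausdorff_outer m {} = 0"
  by (simp add: hausdorff_outer_def hausdorff_premeasure_empty)

lemma hausdorff_outer_subadditive: "hausdorff_outer m (\<Union>n. A n) \<le> (\<Sum>n. hausdorff_outer m (A n))"
  unfolding hausdorff_outer_def [of m "\<Union>n. A n"]
proof (rule SUP_least)
  fix \<delta> :: real assume "\<delta> \<in> {0<..}"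
  then have "hausdorff_premeasure m \<delta> (A n) \<le> hausdorff_outer m (A n)" for n
    unfolding hausdorff_outer_def by (rule SUP_upper)
  then show "hausdorff_premeasure m \<delta> (\<Union>n. A n) \<le> (\<Sum>n. hausdorff_outer m (A n))"
    by (intro order.trans [OF hausdorff_premeasure_subadditive] suminf_le) auto
qed

lemma outer_measure_space_hausdorff_outer: "outer_measure_space (Pow UNIV) (hausdorff_outer m)"
  by (auto simp: outer_measure_space_def positive_def increasing_def countably_subadditive_def
      hausdorff_outer_empty hausdorff_outer_mono hausdorff_outer_subadditive)

lemma hausdorff_outer_Un: "hausdorff_outer m (A \<union> B) \<le> hausdorff_outer m A + hausdorff_outer m B"
proof -
  have "(\<Union>i. (if i = 0 then A else if i = Suc 0 then B else {})) = A \<union> B"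
    by (auto split: if_splits)
  then have "hausdorff_outer m (A \<union> B) \<le>
      (\<Sum>i. hausdorff_outer m (if i = 0 then A else if i = Suc 0 then B else {}))"
    using hausdorff_outer_subadditive[of m "\<lambda>i. (if i = 0 then A else if i = Suc 0 then B else {})"]
    by simp
  also have "\<dots> = hausdorff_outer m A + hausdorff_outer m B"
    by (subst suminf_finite [of "{0, Suc 0}"]) (auto simp: hausdorff_outer_empty)
  finally show ?thesis .
qed

lemma hausdorff_outer_separated:
  assumes "0 < e" and sep: "\<And>x y. x \<in> A \<Longrightarrow> y \<in> B \<Longrightarrow> e \<le> dist x y"
  shows "hausdorff_outer m A + hausdorff_outer m B \<le> hausdorff_outer m (A \<union> B)"
proof -
  let ?P = "hausdorff_premeasure m" and ?w = "hausdorff_weight m"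
  have small: "?P \<delta> A + ?P \<delta> B \<le> ?P \<delta> (A \<union> B)" if \<delta>: "0 < \<delta>" "\<delta> < e" for \<delta>
    unfolding hausdorff_premeasure_def [of m \<delta> "A \<union> B"]
  proof (rule INF_greatest)
    fix U assume U: "U \<in> hausdorff_covers \<delta> (A \<union> B)"
    define V where "V = (\<lambda>D i. if U i \<inter> D = {} then {} else U i)"
    have V: "V D \<in> hausdorff_covers \<delta> D" if "D \<subseteq> A \<union> B" for D
      using U that \<delta> by (fastforce simp: hausdorff_covers_def V_def)
    have "?w (V A i) + ?w (V B i) \<le> ?w (U i)" for i
    proof -
      have "U i \<inter> A = {} \<or> U i \<inter> B = {}"
      proof (rule ccontr)
        assume "\<not> ?thesis"
        then obtain x y where xy: "x \<in> U i" "x \<in> A" "y \<in> U i" "y \<in> B"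
          by blast
        moreover have "bounded (U i)" "diameter (U i) \<le> \<delta>"
          using U by (auto simp: hausdorff_covers_def)
        ultimately show False
          using diameter_bounded_bound[of "U i" x y] sep[of x y] \<delta> by auto
      qed
      then show ?thesis by (auto simp: V_def)
    qed
    then have "(\<Sum>i. ?w (V A i)) + (\<Sum>i. ?w (V B i)) \<le> (\<Sum>i. ?w (U i))"
      by (subst suminf_add) (auto intro!: suminf_le)
    moreover have "?P \<delta> A + ?P \<delta> B \<le> (\<Sum>i. ?w (V A i)) + (\<Sum>i. ?w (V B i))"
      by (intro add_mono hausdorff_premeasure_le V) auto
    ultimately show "?P \<delta> A + ?P \<delta> B \<le> (\<Sum>i. ?w (U i))"
      by order
  qed
  have "hausdorff_outer m A + hausdorff_outer m B = (SUP \<delta>\<in>{0<..}. ?P \<delta> A + ?P \<delta> B)"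
    unfolding hausdorff_outer_def
  proof (rule SUP_add_directed_ennreal[symmetric])
    fix i j :: real assume "i \<in> {0<..}" "j \<in> {0<..}"
    then show "\<exists>k\<in>{0<..}. ?P i A + ?P j B \<le> ?P k A + ?P k B"
      by (intro bexI[of _ "min i j"] add_mono hausdorff_premeasure_mono) auto
  qed
  also have "\<dots> \<le> hausdorff_outer m (A \<union> B)"
  proof (rule SUP_least)
    fix \<delta> :: real assume \<delta>: "\<delta> \<in> {0<..}"
    define \<epsilon> where "\<epsilon> = min \<delta> (e/2)"
    have \<epsilon>: "0 < \<epsilon>" "\<epsilon> < e" "\<epsilon> \<le> \<delta>"
      using \<delta> \<open>0 < e\<close> by (auto simp: \<epsilon>_def)
    have "?P \<delta> A + ?P \<delta> B \<le> ?P \<epsilon> A + ?P \<epsilon> B"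
      by (intro add_mono hausdorff_premeasure_mono \<epsilon>) auto
    also have "\<dots> \<le> ?P \<epsilon> (A \<union> B)"
      by (rule small [OF \<epsilon>(1,2)])
    also have "\<dots> \<le> hausdorff_outer m (A \<union> B)"
      unfolding hausdorff_outer_def by (rule SUP_upper) (use \<epsilon> in auto)
    finally show "?P \<delta> A + ?P \<delta> B \<le> hausdorff_outer m (A \<union> B)" .
  qed
  finally show ?thesis .
qed

lemma hausdorff_outer_closed:
  fixes C :: "'a::metric_space set"
  assumes "closed C"
  shows "hausdorff_outer m (A \<inter> C) + hausdorff_outer m (A - C) \<le> hausdorff_outer m A"
proof (cases "C = {} \<or> hausdorff_outer m A = top")
  case True
  then show ?thesis by (auto simp: hausdorff_outer_empty)
next
  case False
  let ?H = "hausdorff_outer m" and ?d = "\<lambda>x. infdist x C"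
  have "C \<noteq> {}" and fin: "?H A < top"
    using False by (auto simp: less_top)
  define E where "E k = {x \<in> A. 1 / real (k + 1) \<le> ?d x}" for k :: nat
  define R where "R k = {x \<in> A. 1 / real (k + 2) \<le> ?d x \<and> ?d x < 1 / real (k + 1)}" for k :: nat
  have lip: "?d x \<le> ?d y + dist x y" for x y
    by (rule infdist_triangle)
  have E: "?H (A \<inter> C) + ?H (E k) \<le> ?H A" for k
  proof -
    have "?H (E k) + ?H (A \<inter> C) \<le> ?H (E k \<union> (A \<inter> C))"
    proof (rule hausdorff_outer_separated [of "1 / real (k + 1)"])
      show "1 / real (k + 1) \<le> dist x y" if "x \<in> E k" "y \<in> A \<inter> C" for x y
        using that lip[of x y] by (auto simp: E_def)
    qed simp
    also have "\<dots> \<le> ?H A"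
      by (rule hausdorff_outer_mono) (auto simp: E_def)
    finally show ?thesis by (simp add: add.commute)
  qed
  have partial: "(\<Sum>k<n. ?H (R (2 * k + c))) \<le> ?H (\<Union>k<n. R (2 * k + c))" for n c
  proof (induction n)
    case (Suc n)
    have sep: "?H (\<Union>k<n. R (2 * k + c)) + ?H (R (2 * n + c)) \<le>
        ?H ((\<Union>k<n. R (2 * k + c)) \<union> R (2 * n + c))"
    proof (cases "n = 0")
      case False
      show ?thesis
      proof (rule hausdorff_outer_separated)
        show "0 < 1 / real (2 * n + c) - 1 / real (2 * n + c + 1)"
          using False divide_strict_left_mono [of "real (2 * n + c)" "real (2 * n + c + 1)" 1]
          by simp
        fix x y assume "x \<in> (\<Union>k<n. R (2 * k + c))" and y: "y \<in> R (2 * n + c)"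
        then obtain k where k: "k < n" "x \<in> R (2 * k + c)" by blast
        have "1 / real (2 * n + c) \<le> 1 / real (2 * k + c + 2)"
          by (rule divide_left_mono) (use k in auto)
        also have "\<dots> \<le> ?d x"
          using k by (auto simp: R_def)
        finally show "1 / real (2 * n + c) - 1 / real (2 * n + c + 1) \<le> dist x y"
          using y lip[of x y] by (auto simp: R_def)
      qed
    qed (simp add: hausdorff_outer_empty)
    have Un: "(\<Union>k<Suc n. R (2 * k + c)) = (\<Union>k<n. R (2 * k + c)) \<union> R (2 * n + c)"
      by (simp add: lessThan_Suc Un_commute)
    have "(\<Sum>k<Suc n. ?H (R (2 * k + c))) \<le>
        ?H (\<Union>k<n. R (2 * k + c)) + ?H (R (2 * n + c))"
      unfolding sum.lessThan_Suc by (rule add_right_mono [OF Suc])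
    then show ?case
      unfolding Un by (rule order.trans [OF _ sep])
  qed (simp add: hausdorff_outer_empty)
  have half: "(\<Sum>k. ?H (R (2 * k + c))) \<le> ?H A" for c
  proof (rule suminf_le_const [OF summableI])
    fix n
    have "(\<Union>k<n. R (2 * k + c)) \<subseteq> A"
      unfolding R_def by blast
    then show "(\<Sum>k<n. ?H (R (2 * k + c))) \<le> ?H A"
      by (rule order.trans [OF partial hausdorff_outer_mono])
  qed
  have even: "(\<Sum>k<2 * n. ?H (R k)) \<le> ?H A + ?H A" for n
  proof -
    have "(\<Sum>k<2 * n. ?H (R k)) = (\<Sum>k<n. ?H (R (2 * k + 0))) + (\<Sum>k<n. ?H (R (2 * k + 1)))"
      (is "?s n = ?ev n + ?od n")
    proof (induction n)
      case (Suc n)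
      have "?s (Suc n) = ?s n + ?H (R (2 * n)) + ?H (R (2 * n + 1))"
        by simp
      moreover have "?ev (Suc n) = ?ev n + ?H (R (2 * n))" "?od (Suc n) = ?od n + ?H (R (2 * n + 1))"
        by simp_all
      ultimately show ?case
        unfolding Suc by (simp only: ac_simps)
    qed simp
    moreover have ev: "?ev n \<le> ?H A"
      by (rule order.trans [OF sum_le_suminf half [of 0]]) simp_all
    moreover have od: "?od n \<le> ?H A"
      by (rule order.trans [OF sum_le_suminf half [of 1]]) simp_all
    ultimately show ?thesis
      using add_mono [OF ev od] by simp
  qed
  have "(\<Sum>k. ?H (R k)) \<le> ?H A + ?H A"
  proof (rule suminf_le_const [OF summableI])
    fix n
    have "(\<Sum>k<n. ?H (R k)) \<le> (\<Sum>k<2 * n. ?H (R k))"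
      by (rule sum_mono2) simp_all
    then show "(\<Sum>k<n. ?H (R k)) \<le> ?H A + ?H A"
      by (rule order.trans [OF _ even])
  qed
  also have "\<dots> < top" using fin by simp
  finally have tot: "(\<Sum>k. ?H (R k)) < top" .
  define h where "h k = enn2real (?H (R k))" for k
  have "?H (R k) < top" for k
    using tot by (auto simp: less_top dest!: ennreal_suminf_lessD)
  then have h: "?H (R k) = ennreal (h k)" "0 \<le> h k" for k
    by (auto simp: h_def less_top)
  have "summable h"
    using tot unfolding h by (intro summable_suminf_not_top h) (simp add: less_top)
  have "?H (A \<inter> C) + ?H (A - C) \<le> ?H A + ennreal e" if e: "0 < e" for e
  proof -
    obtain k where "norm (\<Sum>i. h (i + k)) < e"
      using suminf_exist_split [OF e \<open>summable h\<close>] by blast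
    moreover have "(\<Sum>i. ?H (R (i + k))) = ennreal (\<Sum>i. h (i + k))"
      unfolding h by (rule suminf_ennreal2) (auto simp: h \<open>summable h\<close> summable_ignore_initial_segment)
    ultimately have tail: "(\<Sum>i. ?H (R (i + k))) \<le> ennreal e"
      by (auto intro: ennreal_leI)
    have "A - C \<subseteq> E k \<union> (\<Union>i. R (i + k))"
    proof
      fix x assume x: "x \<in> A - C"
      then have "?d x \<noteq> 0"
        using \<open>closed C\<close> \<open>C \<noteq> {}\<close> by (auto simp: in_closed_iff_infdist_zero)
      then have pos: "0 < ?d x"
        using infdist_nonneg[of x C] by linarith
      show "x \<in> E k \<union> (\<Union>i. R (i + k))"
      proof (cases "1 / real (k + 1) \<le> ?d x")
        case True
        then show ?thesis using x by (auto simp: E_def)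
      next
        case False
        let ?P = "\<lambda>j. 1 / real (j + 1) \<le> ?d x"
        obtain j0 where "inverse (real (Suc j0)) < ?d x"
          using reals_Archimedean [OF pos] by blast
        then have "?P j0" by (simp add: inverse_eq_divide)
        define j where "j = (LEAST j. ?P j)"
        have Pj: "?P j" unfolding j_def by (rule LeastI[of ?P, OF \<open>?P j0\<close>])
        have "k < j"
        proof (rule ccontr)
          assume "\<not> k < j"
          then have "1 / real (k + 1) \<le> 1 / real (j + 1)"
            by (intro divide_left_mono) auto
          with Pj False show False by linarith
        qed
        then obtain l where l: "j = Suc l" "k \<le> l"
          by (cases j) auto
        then have "\<not> ?P l"
          unfolding j_def by (metis lessI not_less_Least)
        then have "?d x < 1 / real (l + 1)"
          by linarith
        moreover have "1 / real (l + 2) \<le> ?d x"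
          using Pj l by simp
        ultimately have "x \<in> R ((l - k) + k)"
          using x l by (simp add: R_def)
        then show ?thesis by blast
      qed
    qed
    then have "?H (A - C) \<le> ?H (E k \<union> (\<Union>i. R (i + k)))"
      by (rule hausdorff_outer_mono)
    also have "\<dots> \<le> ?H (E k) + ?H (\<Union>i. R (i + k))"
      by (rule hausdorff_outer_Un)
    also have "\<dots> \<le> ?H (E k) + ennreal e"
      by (rule add_left_mono) (rule order.trans [OF hausdorff_outer_subadditive tail])
    finally have "?H (A \<inter> C) + ?H (A - C) \<le> ?H (A \<inter> C) + (?H (E k) + ennreal e)"
      by (rule add_left_mono)
    also have "\<dots> \<le> ?H A + ennreal e"
      unfolding add.assoc [symmetric] by (rule add_right_mono [OF E])
    finally show ?thesis .
  qed
  then show ?thesis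
    by (rule ennreal_le_epsilon)
qed

lemma hausdorff_borel_lambda_system:
  "sets borel \<subseteq> lambda_system UNIV (Pow UNIV) (hausdorff_outer m :: 'a::metric_space set \<Rightarrow> ennreal)"
proof -
  interpret P: sigma_algebra "UNIV :: 'a set" "Pow UNIV"
    by (rule sigma_algebra_Pow)
  let ?L = "lambda_system UNIV (Pow UNIV) (hausdorff_outer m :: 'a set \<Rightarrow> ennreal)"
  have "measure_space UNIV ?L (hausdorff_outer m)"
    by (rule P.caratheodory_lemma [OF outer_measure_space_hausdorff_outer])
  then have "sigma_algebra UNIV ?L"
    by (simp add: measure_space_def)
  moreover have "C \<in> ?L" if "closed C" for C
  proof -
    have "hausdorff_outer m A \<le> hausdorff_outer m (A \<inter> C) + hausdorff_outer m (A - C)" for A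
      using hausdorff_outer_Un[of m "A \<inter> C" "A - C"] by (simp add: Int_Diff_Un)
    then have "hausdorff_outer m (A \<inter> C) + hausdorff_outer m (A - C) = hausdorff_outer m A" for A
      by (rule antisym [OF hausdorff_outer_closed [OF that]])
    then show ?thesis
      unfolding P.lambda_system_eq by blast
  qed
  ultimately show ?thesis
    using sigma_algebra.sigma_sets_subset [of UNIV ?L "Collect closed"]
    unfolding borel_eq_closed by (simp add: subset_iff)
qed

lemma sets_hausdorff_measure [simp, measurable_cong]: "sets (hausdorff_measure m) = sets borel"
  unfolding hausdorff_measure_def by (metis sets.sets_measure_of_eq space_borel)

lemma space_hausdorff_measure [simp]: "space (hausdorff_measure m) = UNIV"
  unfolding hausdorff_measure_def by (simp add: space_measure_of_conv)

lemma emeasure_hausdorff_measure: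
  fixes A :: "'a::metric_space set"
  assumes "A \<in> sets borel"
  shows "emeasure (hausdorff_measure m) A = hausdorff_outer m A"
proof (rule emeasure_measure_of [OF hausdorff_measure_def])
  let ?L = "lambda_system UNIV (Pow UNIV) (hausdorff_outer m :: 'a set \<Rightarrow> ennreal)"
  interpret P: sigma_algebra "UNIV :: 'a set" "Pow UNIV"
    by (rule sigma_algebra_Pow)
  have ca: "countably_additive ?L (hausdorff_outer m)"
    using P.caratheodory_lemma [OF outer_measure_space_hausdorff_outer]
    by (simp add: measure_space_def)
  show "countably_additive (sets (hausdorff_measure m)) (hausdorff_outer m :: 'a set \<Rightarrow> ennreal)"
    unfolding sets_hausdorff_measure countably_additive_def
  proof (intro allI impI)
    fix F :: "nat \<Rightarrow> 'a set"
    assume F: "range F \<subseteq> sets borel" "disjoint_family F" "(\<Union>i. F i) \<in> sets borel"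
    show "(\<Sum>i. hausdorff_outer m (F i)) = hausdorff_outer m (\<Union>i. F i)"
    proof (rule ca [unfolded countably_additive_def, rule_format])
      show "range F \<subseteq> ?L"
        using F(1) hausdorff_borel_lambda_system by (rule order.trans)
      show "(\<Union>i. F i) \<in> ?L"
        using F(3) hausdorff_borel_lambda_system by (rule rev_subsetD)
    qed (rule F)
  qed
qed (use assms in \<open>auto simp: positive_def hausdorff_outer_empty\<close>)

section \<open>Iterated function systems\<close>

text \<open>
  For finitely many contractive similarities (and a nonempty index set) the invariant set exists
  and is unique.
\<close>

definition is_invariant_set :: "'i set \<Rightarrow> ('i \<Rightarrow> 'a \<Rightarrow> 'a) \<Rightarrow> 'a::topological_space set \<Rightarrow> bool" where
  "is_invariant_set I S K \<longleftrightarrow> K \<noteq> {} \<and> compact K \<and> K = (\<Union>i\<in>I. S i ` K)"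

definition invariant_set :: "'i set \<Rightarrow> ('i \<Rightarrow> 'a \<Rightarrow> 'a) \<Rightarrow> 'a::topological_space set" where
  "invariant_set I S = (THE K. is_invariant_set I S K)"

definition open_set_condition :: "'i set \<Rightarrow> ('i \<Rightarrow> 'a \<Rightarrow> 'a::metric_space) \<Rightarrow> bool" where
  "open_set_condition I S \<longleftrightarrow>
    (\<exists>U. bounded U \<and> U \<noteq> {} \<and> open U \<and> (\<Union>i\<in>I. S i ` U) \<subseteq> U \<and>
      (\<forall>i\<in>I. \<forall>j\<in>I. i \<noteq> j \<longrightarrow> S i ` U \<inter> S j ` U = {}))"

text \<open>
  The index \<open>(z, k)\<close> stands for the similarity with translation part \<open>(z, k/4)\<close>.
\<close>

definition cantor_index :: "real \<Rightarrow> ((real ^ ('n::finite + 'n)) \<times> nat) set" where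
  "cantor_index r = {z. \<forall>i. z $ i \<in> {0, 1 - r}} \<times> {0, 1, 2, 3}"

definition cantor_map :: "real \<Rightarrow> (real ^ ('n::finite + 'n)) \<times> nat \<Rightarrow> 'n heis \<Rightarrow> 'n heis" where
  "cantor_map r = (\<lambda>(z, k). htrans (Heis z (real k / 4)) \<circ> hdil r)"

definition cantor_set :: "real \<Rightarrow> 'n::finite heis set" where
  "cantor_set r = invariant_set (cantor_index r) (cantor_map r)"

section \<open>Vertical and horizontal subgroups\<close>

text \<open>The condition \<^term>\<open>dim L + 1 = d\<close> makes \<open>vertical_subgroups 0\<close> empty, and for
  \<open>d = 2n + 1\<close> the family \<open>horizontal_subgroups d\<close> is empty.\<close>

definition vertical_subgroups :: "nat \<Rightarrow> 'n::finite heis set set" where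
  "vertical_subgroups d =
    {{p. hor p \<in> L} | L :: (real ^ ('n + 'n)) set.
      1 \<le> d \<and> d \<le> 2 * CARD('n) \<and> subspace L \<and> dim L + 1 = d}"

definition horizontal_subgroups :: "nat \<Rightarrow> 'n::finite heis set set" where
  "horizontal_subgroups d =
    {{p. hor p \<in> L \<and> vert p = 0} | L :: (real ^ ('n + 'n)) set.
      d \<le> 2 * CARD('n) \<and> subspace L \<and> dim L = d \<and> (\<forall>x\<in>L. \<forall>y\<in>L. hform x y = 0)}"

definition translates :: "'n::finite heis set set \<Rightarrow> 'n heis set set" where
  "translates \<G> = {htrans a ` G | a G. G \<in> \<G>}"

section \<open>Riesz transforms\<close>

text \<open>The index \<open>Some i\<close> denotes a horizontal coordinate, \<open>None\<close> the vertical one.\<close>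

definition riesz_kernel :: "real \<Rightarrow> ('n::finite + 'n) option \<Rightarrow> 'n heis \<Rightarrow> real" where
  "riesz_kernel s k p =
    (case k of Some i \<Rightarrow> hor p $ i / hnorm p powr (s + 1)
             | None \<Rightarrow> vert p / hnorm p powr (s + 2))"

definition riesz_truncated ::
    "'n::finite heis measure \<Rightarrow> real \<Rightarrow> ('n + 'n) option \<Rightarrow> real \<Rightarrow> ('n heis \<Rightarrow> real) \<Rightarrow> 'n heis \<Rightarrow> real" where
  "riesz_truncated \<mu> s k \<epsilon> f p =
    (LINT q:- cball p \<epsilon>|\<mu>. riesz_kernel s k (hinv p \<odot> q) * f q)"

definition riesz_maximal ::
    "'n::finite heis measure \<Rightarrow> real \<Rightarrow> ('n + 'n) option \<Rightarrow> ('n heis \<Rightarrow> real) \<Rightarrow> 'n heis \<Rightarrow> ennreal" where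
  "riesz_maximal \<mu> s k f p = (SUP \<epsilon>\<in>{0<..}. ennreal \<bar>riesz_truncated \<mu> s k \<epsilon> f p\<bar>)"

text \<open>
  The operator acts on functions in \<open>L\<^sup>1(\<mu>)\<close>; boundedness in \<open>L\<^sup>2(\<mu>)\<close> is the usual estimate
  of the \<open>L\<^sup>2\<close> norms (in squared form) for those that also lie in \<open>L\<^sup>2(\<mu>)\<close>, which for finite
  \<open>\<mu>\<close> are all functions in \<open>L\<^sup>2(\<mu>)\<close>.
\<close>

definition bounded_in_L2 ::
    "'a measure \<Rightarrow> (('a \<Rightarrow> real) \<Rightarrow> 'a \<Rightarrow> ennreal) \<Rightarrow> bool" where
  "bounded_in_L2 \<mu> T \<longleftrightarrow>
    (\<exists>C::real. \<forall>f. integrable \<mu> f \<and> integrable \<mu> (\<lambda>x. (f x)\<^sup>2) \<longrightarrow>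
      (\<integral>\<^sup>+x. (T f x)\<^sup>2 \<partial>\<mu>) \<le> ennreal C * (\<integral>\<^sup>+x. ennreal ((f x)\<^sup>2) \<partial>\<mu>))"

definition riesz_bounded_in_L2 :: "'n::finite heis measure \<Rightarrow> real \<Rightarrow> bool" where
  "riesz_bounded_in_L2 \<mu> s \<longleftrightarrow> (\<forall>k. bounded_in_L2 \<mu> (riesz_maximal \<mu> s k))"

definition hausdorff_on :: "nat \<Rightarrow> 'a::metric_space set \<Rightarrow> 'a measure" where
  "hausdorff_on m K = density (hausdorff_measure m) (indicator K)"

end

theory Submission
  imports Defs "HOL-Library.Diagonal_Subsequence"
begin

text \<open>
  If the maximal transforms are bounded in \<open>L\<^sup>2\<close>, they are bounded by a constant on a set \<open>E \<subseteq> K\<close>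
  of positive measure, and a porosity argument gives scales at which \<open>K\<close> is approximated by \<open>E\<close>. The
  proof studies the local Hausdorff limits of such magnifications of \<open>K\<close>. Only the sets are passed to
  the limit, not the measures: if a limit set lies in a half-space \<open>f \<ge> 0\<close>, with \<open>f\<close> a horizontal
  linear form or \<open>\<plusminus>\<close> the vertical coordinate, then every scale at which it leaves \<open>f = 0\<close> adds a fixed
  positive amount to a truncated Riesz integral, so its blow-ups at the origin lie in \<open>f = 0\<close>.

  Choose a limit set \<open>X\<close> inside \<open>V\<^sub>L = {p. p' \<in> L}\<close> with \<open>dim L\<close> minimal. If \<open>X \<noteq> V\<^sub>L\<close>, let a Koranyi
  ball of \<open>V\<^sub>L\<close> in the complement of \<open>X\<close> touch \<open>X\<close>. At a contact point that is not a pole of the ball,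
  \<open>X\<close> blows up into a vertical half-space, hence into a smaller \<open>V\<^sub>L\<close>, against minimality. At a pole it
  blows up into \<open>\<plusminus>p\<^sub>2\<^sub>n\<^sub>+\<^sub>1 \<ge> 0\<close>, hence into \<open>L \<times> {0}\<close>; minimality then forces \<open>L\<close> to be isotropic and the
  limit set to be all of \<open>L \<times> {0}\<close>. Counting balls determines \<open>dim L\<close>, and self-similarity carries the
  approximating group back to scale one, where \<open>K\<close> lies in one of its translates.
\<close>

section \<open>Metric and topology of the Heisenberg group\<close>

text \<open>Bounds on the integrals hold only at centres in \<open>E\<close>, whereas the integrals
  see all of \<open>K\<close>. Tangent sets are therefore defined asymmetrically: views of
  \<open>K\<close> lie close to \<open>X\<close>, and each point of \<open>X\<close> is close to a
  viewed point of \<open>E\<close>. The class is then stable under recentring at points of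
  \<open>X\<close>, dilation and limits, so that a contradiction may be sought at any contact point.
  Each contact costs two blow-ups. A set outside a Koranyi ball need not be one-sided for a form
  \<open>f\<close>; one blow-up straightens the sphere and produces the sign, and only a further one
  can use the integrals to force \<open>f = 0\<close>. At a contact off the poles the resulting form
  does cut down \<open>L\<close>, because the twist \<open>hform\<close> is alternating and drops
  out in the direction of the centre of the ball. For the Cantor-like sets, the open set condition
  and the positive measure come from disjointness of the pieces, which in the vertical direction
  rests on \<open>r\<^sup>2 < 1 / 4\<close>.\<close>

abbreviation hzero :: "'n::finite heis" where
  "hzero \<equiv> Heis 0 0"

lemma hmult_sel [simp]:
  "hor (p \<odot> q) = hor p + hor q"
  "vert (p \<odot> q) = vert p + vert q + hform (hor p) (hor q)"
  by (simp_all add: hmult_def)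

lemma hinv_sel [simp]: "hor (hinv p) = - hor p" "vert (hinv p) = - vert p"
  by (simp_all add: hinv_def)

lemma hdil_sel [simp]: "hor (hdil r p) = r *\<^sub>R hor p" "vert (hdil r p) = r\<^sup>2 * vert p"
  by (simp_all add: hdil_def)

lemma hform_scale: "hform (a *\<^sub>R x) y = a * hform x y" "hform x (a *\<^sub>R y) = a * hform x y"
  by (simp_all add: hform_def sum_distrib_left algebra_simps)

lemma hform_zero [simp]: "hform 0 x = 0" "hform x 0 = 0"
  by (simp_all add: hform_def)

lemma hform_diff: "hform (x - y) z = hform x z - hform y z" "hform z (x - y) = hform z x - hform z y"
  by (auto simp: hform_def algebra_simps sum.distrib sum_subtractf)

lemma abs_hform_le: "\<bar>hform x y\<bar> \<le> 2 * norm x * norm y"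
proof -
  have "(hform x y / 2)\<^sup>2 \<le> (norm x * norm y)\<^sup>2"
    using hform_Cauchy_Schwarz[of x y] zero_le_power2[of "x \<bullet> y"]
    unfolding power_mult_distrib by linarith
  then have "\<bar>hform x y / 2\<bar> \<le> norm x * norm y"
    by (metis abs_le_square_iff abs_of_nonneg mult_nonneg_nonneg norm_ge_zero)
  then show ?thesis by simp
qed

lemma hinv_cancel [simp]: "hinv a \<odot> (a \<odot> p) = p" "a \<odot> (hinv a \<odot> p) = p"
  by (simp_all only: hmult_assoc[symmetric] hinv_hmult hmult_zero)

lemma hnorm_hzero [simp]: "hnorm hzero = 0"
  by (simp add: hnorm_eq_0_iff)

lemma hdil_hmult: "hdil r (p \<odot> q) = hdil r p \<odot> hdil r q"
  by (simp add: heis_eq_iff hform_scale algebra_simps power2_eq_square)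

lemma hdil_hinv: "hdil r (hinv p) = hinv (hdil r p)"
  by (simp add: heis_eq_iff)

lemma hdil_hdil: "hdil r (hdil s p) = hdil (r * s) p"
  by (simp add: heis_eq_iff power_mult_distrib algebra_simps)

lemma hdil_one [simp]: "hdil 1 p = p"
  by (simp add: heis_eq_iff)

lemma hdil_hzero [simp]: "hdil r hzero = hzero"
  by (simp add: heis_eq_iff)

lemma hnorm_hdil:
  assumes "0 \<le> r"
  shows "hnorm (hdil r p) = r * hnorm p"
proof (rule power_eq_imp_eq_base)
  show "hnorm (hdil r p) ^ 4 = (r * hnorm p) ^ 4"
    unfolding hnorm_pow4 power_mult_distrib using assms
    by (simp add: power_mult_distrib distrib_left flip: power_mult)
qed (use assms in \<open>auto simp: hnorm_nonneg\<close>)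

lemma dist_heis_alt: "dist p q = hnorm (hinv p \<odot> q)"
  by (simp add: dist_heis_def)

lemma dist_hmult_left [simp]: "dist (a \<odot> p) (a \<odot> q) = dist p q"
proof -
  have "hinv (a \<odot> p) \<odot> (a \<odot> q) = hinv p \<odot> (hinv a \<odot> (a \<odot> q))"
    by (simp only: hinv_mult hmult_assoc)
  then show ?thesis by (simp add: dist_heis_alt)
qed

lemma dist_hdil: "0 \<le> r \<Longrightarrow> dist (hdil r p) (hdil r q) = r * dist p q"
  unfolding dist_heis_alt hdil_hinv[symmetric] hdil_hmult[symmetric] by (rule hnorm_hdil)

lemma dist_hzero [simp]: "dist hzero p = hnorm p" "dist p hzero = hnorm p"
proof -
  have "hinv hzero = (hzero :: 'a heis)" by (simp add: heis_eq_iff)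
  then show "dist hzero p = hnorm p" by (simp add: dist_heis_alt)
  then show "dist p hzero = hnorm p" by (subst dist_commute)
qed

lemma dist_hinv_left: "dist (hinv a \<odot> p) q = dist p (a \<odot> q)"
proof -
  have "dist (hinv a \<odot> p) q = dist (a \<odot> (hinv a \<odot> p)) (a \<odot> q)" by (rule dist_hmult_left[symmetric])
  then show ?thesis by (simp only: hinv_cancel(2))
qed

lemma abs_vert_le: "\<bar>vert p\<bar> \<le> (hnorm p)\<^sup>2"
proof -
  have "(vert p)\<^sup>2 \<le> hnorm p ^ 4" by (simp only: hnorm_pow4) simp
  also have "\<dots> = ((hnorm p)\<^sup>2)\<^sup>2" by (simp flip: power_mult)
  finally have "\<bar>vert p\<bar> \<le> \<bar>(hnorm p)\<^sup>2\<bar>" by (rule abs_le_square_iff[THEN iffD2])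
  then show ?thesis by (simp only: abs_power2)
qed

lemma hnorm_le: "hnorm p \<le> norm (hor p) + sqrt \<bar>vert p\<bar>"
proof -
  define a b where "a = norm (hor p)" and "b = sqrt \<bar>vert p\<bar>"
  have ab: "0 \<le> a" "0 \<le> b" by (simp_all add: a_def b_def)
  have "b ^ 4 = (b\<^sup>2)\<^sup>2" by (simp only: flip: power_mult) simp
  also have "\<dots> = (vert p)\<^sup>2" by (simp add: b_def)
  finally have b: "(vert p)\<^sup>2 = b ^ 4" by simp
  have "0 \<le> 4 * (a ^ 3 * b) + 6 * (a\<^sup>2 * b\<^sup>2) + 4 * (a * b ^ 3)" using ab by simp
  moreover have "(a + b) ^ 4 = a ^ 4 + b ^ 4 + (4 * (a ^ 3 * b) + 6 * (a\<^sup>2 * b\<^sup>2) + 4 * (a * b ^ 3))"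
    by algebra
  ultimately have "hnorm p ^ 4 \<le> (a + b) ^ 4" 
    unfolding hnorm_pow4 b a_def[symmetric] by linarith
  then have "hnorm p ^ Suc 3 \<le> (a + b) ^ Suc 3" by simp
  then have "hnorm p \<le> a + b" by (rule power_le_imp_le_base) (use ab in simp)
  then show ?thesis by (simp add: a_def b_def)
qed

lemma dist_heis_le:
  "dist p q \<le> norm (hor q - hor p) + sqrt \<bar>vert q - vert p - hform (hor p) (hor q)\<bar>"
  using hnorm_le[of "hinv p \<odot> q"] by (simp add: dist_heis_alt hform_simps)

lemma norm_hor_diff_le: "norm (hor q - hor p) \<le> dist p q"
  using norm_hor_le_hnorm[of "hinv p \<odot> q"] by (simp add: dist_heis_alt)

text \<open>The form is alternating, so the twist equals
  \<open>hform (hor p) (hor q - hor p)\<close>. It costs a term linear in the distance whose factor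
  grows with the base point: \<open>vert\<close> is continuous, but not uniformly so.\<close>

lemma abs_vert_diff_le: "\<bar>vert q - vert p\<bar> \<le> (dist p q)\<^sup>2 + 2 * norm (hor p) * dist p q"
proof -
  have "\<bar>vert q - vert p - hform (hor p) (hor q)\<bar> \<le> (dist p q)\<^sup>2"
    using abs_vert_le[of "hinv p \<odot> q"] by (simp add: dist_heis_alt hform_simps)
  moreover have "hform (hor p) (hor q) = hform (hor p) (hor q - hor p)"
    by (simp add: hform_diff)
  moreover have "\<bar>hform (hor p) (hor q - hor p)\<bar> \<le> 2 * norm (hor p) * norm (hor q - hor p)"
    by (rule abs_hform_le)
  moreover have "2 * norm (hor p) * norm (hor q - hor p) \<le> 2 * norm (hor p) * dist p q"
    by (intro mult_left_mono norm_hor_diff_le) auto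
  ultimately show ?thesis by linarith
qed

lemma tendsto_hform [tendsto_intros]:
  fixes f g :: "'a \<Rightarrow> real ^ ('n::finite + 'n)"
  assumes "(f \<longlongrightarrow> x) F" "(g \<longlongrightarrow> y) F"
  shows "((\<lambda>z. hform (f z) (g z)) \<longlongrightarrow> hform x y) F"
  unfolding hform_def by (intro tendsto_intros assms)

lemma tendsto_hor [tendsto_intros]:
  assumes "(f \<longlongrightarrow> p) F"
  shows "((\<lambda>z. hor (f z)) \<longlongrightarrow> hor p) F"
proof (rule Lim_null_comparison[THEN LIM_zero_cancel])
  have "((\<lambda>z. dist p (f z)) \<longlongrightarrow> dist p p) F" by (intro tendsto_intros assms)
  then show "((\<lambda>z. dist p (f z)) \<longlongrightarrow> 0) F" by simp
qed (auto intro!: always_eventually norm_hor_diff_le)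

lemma tendsto_vert [tendsto_intros]:
  assumes "(f \<longlongrightarrow> p) F"
  shows "((\<lambda>z. vert (f z)) \<longlongrightarrow> vert p) F"
proof (rule Lim_null_comparison[THEN LIM_zero_cancel])
  have "((\<lambda>z. (dist p (f z))\<^sup>2 + 2 * norm (hor p) * dist p (f z)) \<longlongrightarrow>
      (dist p p)\<^sup>2 + 2 * norm (hor p) * dist p p) F" by (intro tendsto_intros assms)
  then show "((\<lambda>z. (dist p (f z))\<^sup>2 + 2 * norm (hor p) * dist p (f z)) \<longlongrightarrow> 0) F" by simp
qed (auto intro!: always_eventually abs_vert_diff_le)

text \<open>With \<open>tendsto_hor\<close> and \<open>tendsto_vert\<close> this says that the
  metric induces the Euclidean topology of the coordinates, so continuity can be checked
  coordinatewise.\<close>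

lemma tendsto_heisI:
  assumes "((\<lambda>z. hor (f z)) \<longlongrightarrow> hor p) F" "((\<lambda>z. vert (f z)) \<longlongrightarrow> vert p) F"
  shows "(f \<longlongrightarrow> p) F"
proof (rule Lim_transform_bound[THEN tendsto_dist_iff[THEN iffD2], rotated])
  let ?g = "\<lambda>z. norm (hor (f z) - hor p) + sqrt \<bar>vert (f z) - vert p - hform (hor p) (hor (f z))\<bar>"
  have "(?g \<longlongrightarrow> norm (hor p - hor p) + sqrt \<bar>vert p - vert p - hform (hor p) (hor p)\<bar>) F"
    by (intro tendsto_intros assms)
  then show "(?g \<longlongrightarrow> 0) F" by simp
  show "\<forall>\<^sub>F z in F. norm (dist (f z) p) \<le> norm (?g z)"
  proof (rule always_eventually, rule allI)
    fix z
    have "dist (f z) p \<le> ?g z" by (subst dist_commute) (rule dist_heis_le)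
    then show "norm (dist (f z) p) \<le> norm (?g z)"
      unfolding real_norm_def abs_of_nonneg[OF zero_le_dist] by (rule order.trans[OF _ abs_ge_self])
  qed
qed

lemma tendsto_hmult [tendsto_intros]:
  assumes "(f \<longlongrightarrow> p) F" "(g \<longlongrightarrow> q) F"
  shows "((\<lambda>z. f z \<odot> g z) \<longlongrightarrow> p \<odot> q) F"
  by (rule tendsto_heisI; simp; intro tendsto_intros assms)

lemma tendsto_hinv [tendsto_intros]:
  assumes "(f \<longlongrightarrow> p) F"
  shows "((\<lambda>z. hinv (f z)) \<longlongrightarrow> hinv p) F"
  by (rule tendsto_heisI; simp; intro tendsto_intros assms)

lemma tendsto_hdil [tendsto_intros]:
  assumes "(r \<longlongrightarrow> s) F" "(f \<longlongrightarrow> p) F"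
  shows "((\<lambda>z. hdil (r z) (f z)) \<longlongrightarrow> hdil s p) F"
  by (rule tendsto_heisI; simp; intro tendsto_intros assms)

lemma tendsto_hnorm [tendsto_intros]:
  assumes "(f \<longlongrightarrow> p) F"
  shows "((\<lambda>z. hnorm (f z)) \<longlongrightarrow> hnorm p) F"
  unfolding hnorm_def by (intro tendsto_intros assms)

lemma tendsto_Heis [tendsto_intros]:
  assumes "(f \<longlongrightarrow> x) F" "(g \<longlongrightarrow> t) F"
  shows "((\<lambda>z. Heis (f z) (g z)) \<longlongrightarrow> Heis x t) F"
  by (rule tendsto_heisI; simp; intro tendsto_intros assms)

lemma continuous_on_heis [continuous_intros]:
  assumes "continuous_on S f"
  shows "continuous_on S (\<lambda>x. hor (f x))" "continuous_on S (\<lambda>x. vert (f x))"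
    "continuous_on S (\<lambda>x. hinv (f x))" "continuous_on S (\<lambda>x. hnorm (f x))"
    "continuous_on S (\<lambda>x. hdil r (f x))"
  using assms unfolding continuous_on_def by (blast intro: tendsto_hor tendsto_vert tendsto_hinv tendsto_hnorm tendsto_hdil[OF tendsto_const])+

lemma continuous_on_hmult [continuous_intros]:
  "continuous_on S f \<Longrightarrow> continuous_on S g \<Longrightarrow> continuous_on S (\<lambda>x. f x \<odot> g x)"
  unfolding continuous_on_def by (blast intro: tendsto_hmult)

text \<open>Closed balls must be compact for limits of magnifications to exist. Boundedness in the
  metric bounds both coordinates, \<open>vert\<close> quadratically, and a subsequence that
  converges in the coordinates converges in the metric.\<close>

instance heis :: (finite) heine_borel
proof
  fix f :: "nat \<Rightarrow> 'a heis"
  assume "bounded (range f)"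
  then obtain B where B: "\<And>j. hnorm (f j) \<le> B"
    using bounded_any_center[of "range f" hzero] by auto
  define g where "g j = (hor (f j), vert (f j))" for j
  have "norm (g j) \<le> B + B\<^sup>2" for j
  proof -
    have "norm (g j) \<le> norm (hor (f j)) + \<bar>vert (f j)\<bar>"
      unfolding g_def by (metis norm_Pair_le real_norm_def)
    also have "\<dots> \<le> B + (hnorm (f j))\<^sup>2"
      by (intro add_mono abs_vert_le order.trans[OF norm_hor_le_hnorm B])
    also have "\<dots> \<le> B + B\<^sup>2"
      by (intro add_mono power_mono B hnorm_nonneg) auto
    finally show ?thesis .
  qed
  then have "bounded (range g)" by (auto simp: bounded_iff)
  then obtain l r where r: "strict_mono r" "(g \<circ> r) \<longlonglongrightarrow> l"
    using bounded_imp_convergent_subsequence by blast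
  then have "((\<lambda>j. fst ((g \<circ> r) j)) \<longlonglongrightarrow> fst l)" "((\<lambda>j. snd ((g \<circ> r) j)) \<longlonglongrightarrow> snd l)"
    using tendsto_fst tendsto_snd by blast+
  then have "(f \<circ> r) \<longlonglongrightarrow> Heis (fst l) (snd l)"
    by (intro tendsto_heisI) (auto simp: g_def o_def)
  with r show "\<exists>l r. strict_mono r \<and> (f \<circ> r) \<longlonglongrightarrow> l" by blast
qed

lemma heis_countable_dense:
  "\<exists>D :: 'n::finite heis set. countable D \<and> (\<forall>x. \<forall>e>0. \<exists>y\<in>D. dist x y < e)"
proof -
  obtain D :: "((real ^ ('n + 'n)) \<times> real) set" where D: "countable D"
    "\<And>U. open U \<Longrightarrow> U \<noteq> {} \<Longrightarrow> \<exists>d\<in>D. d \<in> U"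
    using countable_dense_setE by blast
  define h where "h = (\<lambda>z :: (real ^ ('n + 'n)) \<times> real. Heis (fst z) (snd z))"
  have "continuous_on UNIV h"
    unfolding continuous_on_def h_def by (intro ballI tendsto_intros)
  then have "open (h -` ball x e)" for x :: "'n heis" and e
    by (simp add: open_vimage)
  moreover have "h (hor x, vert x) = x" for x by (simp add: h_def)
  then have "h -` ball x e \<noteq> {}" if "0 < e" for x :: "'n heis" and e
    using that by (metis centre_in_ball empty_iff vimageI)
  ultimately have "\<exists>y\<in>h ` D. dist x y < e" if "0 < e" for x e
    using D(2)[of "h -` ball x e"] that by auto
  with \<open>countable D\<close> show ?thesis by (intro exI[of _ "h ` D"]) auto
qed

text \<open>The metric is only left invariant, so a change of base point from \<open>x\<close> to a
  nearby \<open>g\<close> moves the translated \<open>b\<close>. The displacement is a conjugate of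
  \<open>hinv g \<odot> x\<close>, whose commutator term is linear in \<open>dist g x\<close>; the
  square root of the vertical part leaves a modulus of order 1/2.\<close>

lemma dist_hmult_right_le:
  "dist (hinv g \<odot> b) (hinv x \<odot> b) \<le> dist g x + sqrt ((dist g x)\<^sup>2 + 4 * dist g x * hnorm (hinv x \<odot> b))"
proof -
  define c where "c = hinv x \<odot> b"
  define k where "k = hinv x \<odot> g"
  have "hinv (hinv x \<odot> b) \<odot> (hinv g \<odot> b) = hinv c \<odot> (hinv k \<odot> c)"
    by (simp add: c_def k_def hinv_mult hmult_assoc)
  then have eq: "dist (hinv g \<odot> b) (hinv x \<odot> b) = hnorm (hinv c \<odot> (hinv k \<odot> c))"
    by (subst dist_commute) (simp add: dist_heis_alt)
  have kd: "hnorm k = dist g x" by (subst dist_commute) (simp add: k_def dist_heis_alt)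
  have "hor (hinv c \<odot> (hinv k \<odot> c)) = - hor k" by simp
  moreover have "vert (hinv c \<odot> (hinv k \<odot> c)) = - vert k + 2 * hform (hor c) (hor k)"
    using hform_skew[of "hor c" "hor k"] by (simp add: hform_simps hform_diff)
  ultimately have "dist (hinv g \<odot> b) (hinv x \<odot> b) \<le> norm (hor k) + sqrt \<bar>- vert k + 2 * hform (hor c) (hor k)\<bar>"
    unfolding eq using hnorm_le by (metis norm_minus_cancel)
  also have "\<dots> \<le> hnorm k + sqrt ((hnorm k)\<^sup>2 + 4 * hnorm k * hnorm c)"
  proof (intro add_mono norm_hor_le_hnorm real_sqrt_le_mono)
    have "\<bar>hform (hor c) (hor k)\<bar> \<le> 2 * (norm (hor c) * norm (hor k))"
      using abs_hform_le[of "hor c" "hor k"] by simp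
    also have "\<dots> \<le> 2 * (hnorm c * hnorm k)"
      by (intro mult_left_mono mult_mono norm_hor_le_hnorm hnorm_nonneg) auto
    finally show "\<bar>- vert k + 2 * hform (hor c) (hor k)\<bar> \<le> (hnorm k)\<^sup>2 + 4 * hnorm k * hnorm c"
      using abs_vert_le[of k] by (simp add: abs_if algebra_simps split: if_splits)
  qed
  finally show ?thesis by (simp add: kd c_def)
qed

section \<open>Local Hausdorff convergence of subsets\<close>

text \<open>One-sided closeness on a window. Only the points of \<open>A\<close> are restricted to
  radius \<open>R\<close>; their partners in \<open>X\<close> may lie slightly outside, which avoids
  boundary effects.\<close>

definition inside :: "'n::finite heis set \<Rightarrow> 'n heis set \<Rightarrow> real \<Rightarrow> real \<Rightarrow> bool" where
  "inside A X e R \<longleftrightarrow> (\<forall>a\<in>A. hnorm a \<le> R \<longrightarrow> (\<exists>x\<in>X. dist a x \<le> e))"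

lemma insideD: "inside A X e R \<Longrightarrow> a \<in> A \<Longrightarrow> hnorm a \<le> R \<Longrightarrow> \<exists>x\<in>X. dist a x \<le> e"
  by (simp add: inside_def)

lemma inside_mono: "inside A X e R \<Longrightarrow> A' \<subseteq> A \<Longrightarrow> e \<le> e' \<Longrightarrow> R' \<le> R \<Longrightarrow> inside A' X e' R'"
  unfolding inside_def by (meson order_trans subsetD)

lemma hnorm_le_add_dist: "hnorm b \<le> hnorm a + dist a b"
  using dist_triangle[of hzero b a] by simp

lemma inside_trans:
  assumes "inside A B e R" "inside B C e' (R + e)"
  shows "inside A C (e + e') R"
  unfolding inside_def
proof (intro ballI impI)
  fix a assume "a \<in> A" "hnorm a \<le> R"
  then obtain b where b: "b \<in> B" "dist a b \<le> e" using assms(1) insideD by blast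
  then have "hnorm b \<le> R + e" using hnorm_le_add_dist[of b a] \<open>hnorm a \<le> R\<close> by linarith
  then obtain c where c: "c \<in> C" "dist b c \<le> e'" using assms(2) b insideD by blast
  then have "dist a c \<le> e + e'" using dist_triangle[of a c b] b by linarith
  with c show "\<exists>x\<in>C. dist a x \<le> e + e'" by blast
qed

text \<open>Arzela-Ascoli in pointwise form: a diagonal sequence converges on a countable dense set,
  and the common Lipschitz constant spreads the Cauchy property to every point.\<close>

lemma lipschitz_pointwise_convergent_subseq:
  fixes f :: "nat \<Rightarrow> 'n::finite heis \<Rightarrow> real"
  assumes bdd: "\<And>j x. \<bar>f j x\<bar> \<le> 1" and lip: "\<And>j x y. \<bar>f j x - f j y\<bar> \<le> dist x y"
  shows "\<exists>\<phi>. strict_mono \<phi> \<and> (\<forall>x. convergent (\<lambda>j. f (\<phi> j) x))"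
proof -
  obtain D :: "'n heis set" where D: "countable D" "\<And>x e. e > 0 \<Longrightarrow> \<exists>y\<in>D. dist x y < e"
    using heis_countable_dense by blast
  have ne: "D \<noteq> {}" using D(2)[of 1] by force
  define d where "d = from_nat_into D"
  interpret subseqs "\<lambda>n s. convergent (\<lambda>j. f (s j) (d n))"
  proof
    fix n :: nat and s :: "nat \<Rightarrow> nat" assume "strict_mono s"
    have "bounded (range (\<lambda>j. f (s j) (d n)))"
      using bdd by (auto simp: bounded_iff)
    then obtain l r where "strict_mono r" "((\<lambda>j. f (s j) (d n)) \<circ> r) \<longlonglongrightarrow> l"
      using bounded_imp_convergent_subsequence by blast
    then show "\<exists>r'. strict_mono r' \<and> convergent (\<lambda>j. f ((s \<circ> r') j) (d n))"
      by (auto simp: o_def convergent_def)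
  qed
  have conv: "convergent (\<lambda>j. f (diagseq j) (d n))" for n
  proof -
    have "convergent (\<lambda>j. f ((diagseq \<circ> ((+) (Suc n))) j) (d n))"
    proof (rule diagseq_holds)
      fix n :: nat and s r :: "nat \<Rightarrow> nat" 
      assume "strict_mono r" "convergent (\<lambda>j. f (s j) (d n))"
      then show "convergent (\<lambda>j. f ((s \<circ> r) j) (d n))"
        using LIMSEQ_subseq_LIMSEQ by (fastforce simp: convergent_def o_def)
    qed
    then obtain l where l: "(\<lambda>j. f (diagseq (Suc n + j)) (d n)) \<longlonglongrightarrow> l"
      unfolding convergent_def o_def by blast
    have "(\<lambda>j. f (diagseq (j + Suc n)) (d n)) \<longlonglongrightarrow> l"
      by (subst add.commute) (rule l)
    then have "(\<lambda>j. f (diagseq j) (d n)) \<longlonglongrightarrow> l" by (rule LIMSEQ_offset)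
    then show ?thesis unfolding convergent_def by (rule exI)
  qed
  have "convergent (\<lambda>j. f (diagseq j) x)" for x
  proof (rule Cauchy_convergent, rule metric_CauchyI)
    fix e :: real assume "0 < e"
    then obtain y where y: "y \<in> D" "dist x y < e / 3" using D(2)[of "e/3" x] by auto
    then obtain n where n: "y = d n"
      unfolding d_def using from_nat_into_surj[OF D(1)] by metis
    have "Cauchy (\<lambda>j. f (diagseq j) y)" using conv[of n] n convergent_Cauchy by blast
    then obtain M where M: "\<And>i j. i \<ge> M \<Longrightarrow> j \<ge> M \<Longrightarrow> dist (f (diagseq i) y) (f (diagseq j) y) < e / 3"
      using metric_CauchyD[of _ "e/3"] \<open>0 < e\<close> by (metis divide_pos_pos zero_less_numeral)
    have "dist (f (diagseq i) x) (f (diagseq j) x) < e" if "i \<ge> M" "j \<ge> M" for i j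
      using M[OF that] lip[of "diagseq i" x y] lip[of "diagseq j" x y] y(2)
      unfolding dist_real_def by linarith
    then show "\<exists>M. \<forall>m\<ge>M. \<forall>n\<ge>M. dist (f (diagseq m) x) (f (diagseq n) x) < e" by blast
  qed
  then show ?thesis using subseq_diagseq by blast
qed

text \<open>Compactness through distance functions: these are 1-Lipschitz, and cutting them at 1
  keeps them bounded even if the sets run off to infinity. The limit set is the zero set of the
  limit function; a failure of either inclusion yields a convergent sequence of bad points.\<close>

lemma subseq_local_Hausdorff_convergent:
  fixes A :: "nat \<Rightarrow> 'n::finite heis set"
  assumes ne: "\<And>j. A j \<noteq> {}"
  shows "\<exists>X \<phi>. closed X \<and> strict_mono \<phi> \<and>
    (\<forall>e>0. \<forall>R. eventually (\<lambda>j. inside (A (\<phi> j)) X e R \<and> inside X (A (\<phi> j)) e R) sequentially)"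
proof -
  define f where "f j x = min 1 (infdist x (A j))" for j x
  have lip: "\<bar>f j x - f j y\<bar> \<le> dist x y" for j x y
  proof -
    have "\<bar>infdist x (A j) - infdist y (A j)\<bar> \<le> dist x y"
      using infdist_triangle_abs by blast
    then show ?thesis unfolding f_def min_def by auto
  qed
  have "\<bar>f j x\<bar> \<le> 1" for j x using infdist_nonneg[of x "A j"] by (simp add: f_def min_def)
  then obtain \<phi> where \<phi>: "strict_mono \<phi>" "\<And>x. convergent (\<lambda>j. f (\<phi> j) x)"
    using lipschitz_pointwise_convergent_subseq[of f] lip by blast
  define g where "g x = lim (\<lambda>j. f (\<phi> j) x)" for x
  have g: "(\<lambda>j. f (\<phi> j) x) \<longlonglongrightarrow> g x" for x
    unfolding g_def using \<phi>(2) by (simp add: convergent_LIMSEQ_iff)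
  have gl: "\<bar>g x - g y\<bar> \<le> dist x y" for x y
  proof (rule LIMSEQ_le_const2)
    show "(\<lambda>j. \<bar>f (\<phi> j) x - f (\<phi> j) y\<bar>) \<longlonglongrightarrow> \<bar>g x - g y\<bar>" by (intro tendsto_intros g)
  qed (use lip in auto)
  have gcont: "(\<lambda>n. g (s n)) \<longlonglongrightarrow> g x" if "s \<longlonglongrightarrow> x" for s x
  proof (rule LIM_zero_cancel, rule Lim_null_comparison)
    show "\<forall>\<^sub>F n in sequentially. norm (g (s n) - g x) \<le> dist (s n) x" using gl by auto
    show "(\<lambda>n. dist (s n) x) \<longlonglongrightarrow> 0" by (rule tendsto_dist_iff[THEN iffD1, OF that])
  qed
  define X where "X = {x. g x = 0}"
  have "closed X"
    unfolding closed_sequential_limits X_def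
  proof clarify
    fix s x assume *: "\<forall>n. s n \<in> {x. g x = 0}" and sx: "s \<longlonglongrightarrow> x"
    then have "(\<lambda>n. 0) \<longlonglongrightarrow> g x" using gcont[OF sx] by simp
    then show "g x = 0" using LIMSEQ_unique by blast
  qed
  have *: "\<exists>y s. strict_mono s \<and> (a \<circ> s) \<longlonglongrightarrow> y" if "\<And>j::nat. hnorm (a j) \<le> R" for a :: "nat \<Rightarrow> 'n heis" and R
  proof -
    have "bounded (range a)" unfolding bounded_def using that by (auto intro!: exI[of _ hzero] exI[of _ R])
    then show ?thesis using bounded_imp_convergent_subsequence[of a] by blast
  qed
  have freq: "\<exists>s::nat \<Rightarrow> nat. strict_mono s \<and> (\<forall>i. P (s i))" if "\<not> eventually (\<lambda>j. \<not> P j) sequentially" for P :: "nat \<Rightarrow> bool"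
  proof -
    have "infinite {n. P n}"
      unfolding infinite_nat_iff_unbounded_le using that by (auto simp: eventually_sequentially)
    from infinite_enumerate[OF this] show ?thesis by auto
  qed
  \<comment> \<open>The common Lipschitz constant upgrades pointwise convergence to convergence
    along moving points.\<close>
  have flim: "(\<lambda>i. f (\<phi> (s i)) (a i)) \<longlonglongrightarrow> g x" if "strict_mono s" "a \<longlonglongrightarrow> x" for s a x
  proof (rule LIM_zero_cancel, rule Lim_null_comparison)
    show "\<forall>\<^sub>F i in sequentially. norm (f (\<phi> (s i)) (a i) - g x) \<le> dist (a i) x + \<bar>f (\<phi> (s i)) x - g x\<bar>"
    proof (rule always_eventually, rule allI)
      fix i show "norm (f (\<phi> (s i)) (a i) - g x) \<le> dist (a i) x + \<bar>f (\<phi> (s i)) x - g x\<bar>"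
        using lip[of "\<phi> (s i)" "a i" x] unfolding real_norm_def by linarith
    qed
    have "(\<lambda>i. f (\<phi> (s i)) x) \<longlonglongrightarrow> g x"
      using LIMSEQ_subseq_LIMSEQ[OF g[of x] that(1)] by (simp add: o_def)
    then have "(\<lambda>i. dist (a i) x + \<bar>f (\<phi> (s i)) x - g x\<bar>) \<longlonglongrightarrow> dist x x + \<bar>g x - g x\<bar>"
      by (intro tendsto_intros that(2))
    then show "(\<lambda>i. dist (a i) x + \<bar>f (\<phi> (s i)) x - g x\<bar>) \<longlonglongrightarrow> 0" by simp
  qed
  have one: "eventually (\<lambda>j. inside (A (\<phi> j)) X e R) sequentially" if e: "0 < e" for e R
  proof (rule ccontr)
    assume "\<not> ?thesis"
    then obtain s :: "nat \<Rightarrow> nat" where s: "strict_mono s" "\<And>i. \<not> inside (A (\<phi> (s i))) X e R"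
      using freq[of "\<lambda>j. \<not> inside (A (\<phi> j)) X e R"] by auto
    then have "\<exists>a. a \<in> A (\<phi> (s i)) \<and> hnorm a \<le> R \<and> (\<forall>x\<in>X. dist a x > e)" for i
      unfolding inside_def by (meson not_le)
    then obtain a where a: "\<And>i. a i \<in> A (\<phi> (s i))" "\<And>i. hnorm (a i) \<le> R" "\<And>i x. x \<in> X \<Longrightarrow> dist (a i) x > e"
      by metis
    obtain y and t :: "nat \<Rightarrow> nat" where t: "strict_mono t" "(a \<circ> t) \<longlonglongrightarrow> y" using *[of a R] a(2) by blast
    have "(\<lambda>i. f (\<phi> ((s \<circ> t) i)) ((a \<circ> t) i)) \<longlonglongrightarrow> g y"
      by (rule flim[OF strict_mono_o[OF s(1) t(1)] t(2)])
    moreover have "f (\<phi> ((s \<circ> t) i)) ((a \<circ> t) i) = 0" for i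
      using a(1)[of "t i"] by (simp add: f_def)
    ultimately have "g y = 0" using LIMSEQ_unique tendsto_const by (metis (no_types, lifting) ext)
    then have "y \<in> X" by (simp add: X_def)
    moreover have "eventually (\<lambda>i. dist ((a \<circ> t) i) y < e) sequentially"
      using t(2) e tendstoD by blast
    ultimately show False using a(3)[of y] by (auto simp: eventually_sequentially intro: less_asym)
  qed
  have two: "eventually (\<lambda>j. inside X (A (\<phi> j)) e R) sequentially" if e: "0 < e" for e R
  proof (rule ccontr)
    assume "\<not> ?thesis"
    then obtain s :: "nat \<Rightarrow> nat" where s: "strict_mono s" "\<And>i. \<not> inside X (A (\<phi> (s i))) e R"
      using freq[of "\<lambda>j. \<not> inside X (A (\<phi> j)) e R"] by auto
    then have "\<exists>a. a \<in> X \<and> hnorm a \<le> R \<and> (\<forall>x\<in>A (\<phi> (s i)). dist a x > e)" for i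
      unfolding inside_def by (meson not_le)
    then obtain a where a: "\<And>i. a i \<in> X" "\<And>i. hnorm (a i) \<le> R" "\<And>i x. x \<in> A (\<phi> (s i)) \<Longrightarrow> dist (a i) x > e"
      by metis
    obtain y and t :: "nat \<Rightarrow> nat" where t: "strict_mono t" "(a \<circ> t) \<longlonglongrightarrow> y" using *[of a R] a(2) by blast
    have "(\<lambda>i. g ((a \<circ> t) i)) \<longlonglongrightarrow> g y" by (rule gcont[OF t(2)])
    moreover have "g ((a \<circ> t) i) = 0" for i using a(1)[of "t i"] by (simp add: X_def)
    ultimately have gy: "g y = 0" using LIMSEQ_unique tendsto_const by (metis (no_types, lifting) ext)
    have "(\<lambda>i. f (\<phi> ((s \<circ> t) i)) ((a \<circ> t) i)) \<longlonglongrightarrow> g y"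
      by (rule flim[OF strict_mono_o[OF s(1) t(1)] t(2)])
    then have "eventually (\<lambda>i. f (\<phi> ((s \<circ> t) i)) ((a \<circ> t) i) < min 1 e) sequentially"
      using e gy order_tendstoD(2)[of _ "g y" sequentially "min 1 e"] by simp
    then obtain i where i: "f (\<phi> (s (t i))) (a (t i)) < min 1 e"
      by (auto simp: eventually_sequentially)
    have "e \<le> infdist (a (t i)) (A (\<phi> (s (t i))))"
      unfolding infdist_notempty[OF ne] by (rule cINF_greatest[OF ne]) (use a(3) less_imp_le in blast)
    with i show False unfolding f_def by linarith
  qed
  show ?thesis
    using \<open>closed X\<close> \<phi>(1) eventually_conj[OF one two] by blast
qed

section \<open>Tangent sets\<close>

text \<open>Magnification by \<open>l\<close> that carries \<open>p\<close> to the origin: the ball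
  of radius \<open>R / l\<close> about \<open>p\<close> becomes the ball of radius \<open>R\<close>
  about \<open>hzero\<close>.\<close>

definition view :: "'n::finite heis \<Rightarrow> real \<Rightarrow> 'n heis \<Rightarrow> 'n heis" where
  "view p l y = hdil l (hinv p \<odot> y)"

lemma dist_view: "0 \<le> l \<Longrightarrow> dist (view p l y) (view p l z) = l * dist y z"
  by (simp add: view_def dist_hdil)

lemma view_self [simp]: "view p l p = hzero"
  by (simp add: view_def)

lemma hnorm_view: "0 \<le> l \<Longrightarrow> hnorm (view p l y) = l * dist p y"
  by (simp add: view_def hnorm_hdil dist_heis_alt)

lemma view_hdil: "hdil s (view p l y) = view p (s * l) y"
  by (simp add: view_def hdil_hdil)

lemma view_change: "hinv (view p l q) \<odot> view p l z = view q l z"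
  by (simp add: view_def hdil_hinv[symmetric] hdil_hmult[symmetric] hinv_mult hmult_assoc)

lemma inside_hdil:
  assumes "inside A X e R" "0 < s"
  shows "inside (hdil s ` A) (hdil s ` X) (s * e) (s * R)"
  using assms by (auto simp: inside_def hnorm_hdil dist_hdil)

lemma hdil_inverse: "0 < s \<Longrightarrow> hdil (1 / s) (hdil s p) = p" "0 < s \<Longrightarrow> hdil s (hdil (1 / s) p) = p"
  by (simp_all add: hdil_hdil)

lemma closed_hdil_image:
  assumes "closed X" "0 < s"
  shows "closed (hdil s ` X)"
proof -
  have "hdil s ` X = hdil (1 / s) -` X"
  proof (intro set_eqI iffI)
    fix x assume "x \<in> hdil (1 / s) -` X"
    then show "x \<in> hdil s ` X"
      using hdil_inverse(2)[OF assms(2), of x] by (metis image_eqI vimageD)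
  qed (auto simp: hdil_inverse(1)[OF assms(2)])
  moreover have "continuous_on UNIV (hdil (1 / s))" by (intro continuous_intros)
  ultimately show ?thesis using closed_vimage[OF assms(1)] by metis
qed

lemma closed_left_image:
  assumes "closed X"
  shows "closed ((\<lambda>p. a \<odot> p) ` X)"
proof -
  have "(\<lambda>p. a \<odot> p) ` X = (\<lambda>p. hinv a \<odot> p) -` X"
    by (auto simp: image_iff) (metis hinv_cancel(2))
  moreover have "continuous_on UNIV (\<lambda>p. hinv a \<odot> p)" by (intro continuous_intros)
  ultimately show ?thesis using closed_vimage[OF assms(1)] by metis
qed

text \<open>\<open>B\<close> stands for the norm in \<open>dist_hmult_right_le\<close>: a
  displacement \<open>d\<close> of a point and a displacement \<open>d\<close> of the base point
  together cost at most \<open>e\<close>.\<close>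

lemma small_modulus:
  fixes B e :: real
  assumes "0 < e" "0 \<le> B"
  shows "\<exists>d>0. d \<le> 1 \<and> d + (d + sqrt (d\<^sup>2 + 4 * d * B)) \<le> e"
proof -
  define d where "d = min 1 (min (e / 4) (e\<^sup>2 / (4 * (1 + 4 * B))))"
  have d: "0 < d" "d \<le> 1" "d \<le> e / 4" "d \<le> e\<^sup>2 / (4 * (1 + 4 * B))"
    using assms unfolding d_def by (simp, simp, linarith, linarith)
  have "d\<^sup>2 + 4 * d * B \<le> d * (1 + 4 * B)"
    using d by (simp add: power2_eq_square algebra_simps)
  also have "\<dots> \<le> (e / 2)\<^sup>2"
  proof -
    have "0 < 1 + 4 * B" using assms by simp
    then show ?thesis
      using d(4) by (simp add: pos_le_divide_eq power_divide algebra_simps)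
  qed
  finally have "sqrt (d\<^sup>2 + 4 * d * B) \<le> e / 2"
    using assms real_sqrt_le_mono by fastforce
  with d show ?thesis by (intro exI[of _ d]) auto
qed

text \<open>Only one inclusion of Hausdorff convergence is recorded, that points of \<open>X\<close>
  are limits of dilated points of \<open>Y\<close>. It is the one that transfers closed conditions
  from \<open>Y\<close> to \<open>X\<close>.\<close>

definition is_blowup :: "'n::finite heis set \<Rightarrow> 'n heis set \<Rightarrow> bool" where
  "is_blowup X Y \<longleftrightarrow> (\<exists>s. filterlim s at_top sequentially \<and>
     (\<forall>z\<in>X. \<exists>y. (\<forall>j::nat. y j \<in> Y) \<and> (\<lambda>j. hdil (s j) (y j)) \<longlonglongrightarrow> z))"

definition homogeneous :: "('n::finite heis \<Rightarrow> real) \<Rightarrow> nat \<Rightarrow> bool" where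
  "homogeneous f d \<longleftrightarrow> 0 < d \<and> continuous_on UNIV f \<and> (\<forall>s>0. \<forall>p. f (hdil s p) = s ^ d * f p)"

section \<open>Separated sets and nets\<close>

lemma separated_card_bound:
  fixes K :: "'a::metric_space set"
  assumes "compact K" "0 < r"
  shows "\<exists>N::nat. \<forall>P. finite P \<longrightarrow> P \<subseteq> K \<longrightarrow> pairwise (\<lambda>p q. r \<le> dist p q) P \<longrightarrow> card P \<le> N"
proof -
  obtain k where k: "finite k" "K \<subseteq> (\<Union>x\<in>k. ball x (r / 2))"
    using compact_eq_totally_bounded assms by (metis half_gt_zero)
  have "card P \<le> card k" if P: "finite P" "P \<subseteq> K" "pairwise (\<lambda>p q. r \<le> dist p q) P" for P
  proof -
    have "\<exists>x\<in>k. dist x p < r / 2" if p: "p \<in> P" for p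
    proof -
      have "p \<in> (\<Union>x\<in>k. ball x (r / 2))" using P p k(2) by blast
      then show ?thesis by (simp only: UN_iff mem_ball)
    qed
    then obtain f where f: "\<And>p. p \<in> P \<Longrightarrow> f p \<in> k \<and> dist (f p) p < r / 2" by metis
    have "inj_on f P"
    proof (rule inj_onI, rule ccontr)
      fix p q assume *: "p \<in> P" "q \<in> P" "f p = f q" "p \<noteq> q"
      then have "r \<le> dist p q" using P by (auto simp: pairwise_def)
      moreover have "dist p q \<le> dist (f p) p + dist (f q) q"
        using * dist_triangle3 by metis
      ultimately show False using f[OF *(1)] f[OF *(2)] by linarith
    qed
    then show ?thesis using f k(1) by (metis card_inj_on_le image_subsetI)
  qed
  then show ?thesis by blast
qed

text \<open>A separated subset of largest cardinality is a net; total boundedness of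
  \<open>K\<close> bounds the cardinalities.\<close>

lemma separated_net:
  fixes K :: "'a::metric_space set"
  assumes "compact K" "E \<subseteq> K" "0 < r"
  shows "\<exists>P. finite P \<and> P \<subseteq> E \<and> pairwise (\<lambda>p q. r < dist p q) P \<and> E \<subseteq> (\<Union>p\<in>P. cball p r)"
proof -
  obtain N :: nat where N: "\<forall>P. finite P \<longrightarrow> P \<subseteq> K \<longrightarrow> pairwise (\<lambda>p q. r \<le> dist p q) P \<longrightarrow> card P \<le> N"
    using separated_card_bound[OF assms(1,3)] ..
  let ?Q = "\<lambda>P. finite P \<and> P \<subseteq> E \<and> pairwise (\<lambda>p q. r < dist p q) P"
  have "card P \<le> N" if P: "?Q P" for P
  proof -
    have "pairwise (\<lambda>p q. r \<le> dist p q) P" using P unfolding pairwise_def by (meson less_imp_le)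
    then show ?thesis using N P assms(2) by (meson order_trans)
  qed
  then have le: "\<forall>P. ?Q P \<longrightarrow> card P < Suc N" by (intro allI impI le_imp_less_Suc)
  have "?Q {}" by simp
  then have "\<exists>P. ?Q P \<and> (\<forall>P'. ?Q P' \<longrightarrow> card P' \<le> card P)"
    by (rule ex_has_greatest_nat[OF _ le])
  then obtain P where P: "?Q P" "\<And>P'. ?Q P' \<Longrightarrow> card P' \<le> card P" by (elim exE conjE) simp
  have "x \<in> (\<Union>p\<in>P. cball p r)" if "x \<in> E" for x
  proof (rule ccontr)
    assume n: "x \<notin> (\<Union>p\<in>P. cball p r)"
    then have "x \<notin> P" using assms(3) by auto
    moreover have "?Q (insert x P)"
      using n P(1) that by (auto simp: pairwise_insert not_le dist_commute)
    ultimately show False using P(2)[of "insert x P"] P(1) by simp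
  qed
  with P(1) show ?thesis by blast
qed

text \<open>The situation extracted from boundedness of the maximal transforms: a regular measure on
  \<open>K\<close>, and integrals over annuli that are bounded at centres in \<open>E\<close>.
  Positivity is asked of \<open>closure E\<close>, which is always measurable. Lower regularity
  stops at radius 1 because the measure is finite.\<close>

locale ad_riesz = finite_measure \<mu> for \<mu> :: "'n::finite heis measure" +
  fixes K E :: "'n heis set" and m :: nat and c0 C0 M :: real
  assumes compact_K: "compact K"
    and E_sub: "E \<subseteq> K"
    and sets_mu [simp, measurable_cong]: "sets \<mu> = sets borel"
    and null_compl: "emeasure \<mu> (- K) = 0"
    and upper: "\<And>p t. p \<in> K \<Longrightarrow> 0 < t \<Longrightarrow> measure \<mu> (cball p t) \<le> C0 * t ^ m"
    and lower: "\<And>p t. p \<in> K \<Longrightarrow> 0 < t \<Longrightarrow> t \<le> 1 \<Longrightarrow> c0 * t ^ m \<le> measure \<mu> (cball p t)"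
    and c0: "0 < c0"
    and E_pos: "emeasure \<mu> (closure E) \<noteq> 0"
    and riesz: "\<And>k p a b. p \<in> E \<Longrightarrow> 0 < a \<Longrightarrow> a < b \<Longrightarrow>
      \<bar>LINT y:{y. a < dist p y \<and> dist p y \<le> b}|\<mu>. riesz_kernel (real m) k (hinv p \<odot> y)\<bar> \<le> M"
begin

text \<open>As \<open>E\<close> lies in \<open>K\<close>, both views are close to \<open>X\<close>.
  The arbitrary \<open>e\<close> and \<open>R\<close> stand for a sequence of magnifications with
  factors tending to infinity.\<close>

definition tangents :: "'n heis set set" where
  "tangents = {X. closed X \<and> (\<forall>e>0. \<forall>R>0. \<exists>p\<in>E. \<exists>l\<ge>R.
     inside (view p l ` K) X e R \<and> inside X (view p l ` E) e R)}"

lemma tangentsD: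
  assumes "X \<in> tangents" "0 < e" "0 < R"
  obtains p l where "p \<in> E" "R \<le> l" "inside (view p l ` K) X e R" "inside X (view p l ` E) e R"
  using assms unfolding tangents_def by blast

lemma closed_tangents: "X \<in> tangents \<Longrightarrow> closed X"
  by (simp add: tangents_def)

lemma space_mu [simp]: "space \<mu> = UNIV"
  using sets_eq_imp_space_eq[OF sets_mu] by simp

lemma E_nonempty: "E \<noteq> {}"
  using E_pos by auto

lemma C0: "0 < C0"
proof -
  obtain p where "p \<in> K" using E_nonempty E_sub by blast
  then have "c0 * 1 ^ m \<le> C0 * 1 ^ m" using upper[of p 1] lower[of p 1] by linarith
  then show ?thesis using c0 by simp
qed

lemma hzero_tangents: assumes "X \<in> tangents" shows "hzero \<in> X"
proof -
  have "\<exists>x\<in>X. dist x hzero < e" if e: "0 < e" for e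
  proof -
    obtain p l where pl: "p \<in> E" "inside (view p l ` K) X (e/2) 1"
      using tangentsD[OF assms, of "e/2" 1] e by (metis half_gt_zero zero_less_one)
    have "hzero \<in> view p l ` K" using pl(1) E_sub by (metis image_eqI subsetD view_self)
    then obtain x where "x \<in> X" "dist hzero x \<le> e/2"
      using insideD[OF pl(2), of hzero] by auto
    then show ?thesis using e by (intro bexI[of _ x]) auto
  qed
  then show ?thesis using closed_approachable[OF closed_tangents[OF assms]] by blast
qed

lemma tangents_hdil:
  assumes X: "X \<in> tangents" and s: "0 < s"
  shows "hdil s ` X \<in> tangents"
proof -
  have "\<exists>p\<in>E. \<exists>l\<ge>R. inside (view p l ` K) (hdil s ` X) e R \<and> inside (hdil s ` X) (view p l ` E) e R"
    if eR: "0 < e" "0 < R" for e R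
  proof -
    obtain p l where pl: "p \<in> E" "R / s \<le> l" "inside (view p l ` K) X (e/s) (R/s)" "inside X (view p l ` E) (e/s) (R/s)"
      using tangentsD[OF X, of "e/s" "R/s"] eR s by auto
    have "hdil s ` view p l ` A = view p (s * l) ` A" for A
      by (simp add: image_image view_hdil)
    moreover have "s * (e/s) = e" "s * (R/s) = R" using s by auto
    ultimately show ?thesis
      using inside_hdil[OF pl(3) s] inside_hdil[OF pl(4) s] pl(1,2) s
      by (intro bexI[of _ p] exI[of _ "s * l"]) (auto simp: field_simps)
  qed
  then show ?thesis
    using closed_hdil_image[OF closed_tangents[OF X] s] by (simp add: tangents_def)
qed

text \<open>A point \<open>x\<close> of \<open>X\<close> is close to the view of some
  \<open>q\<close> in \<open>E\<close>, and views from \<open>q\<close> differ from views from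
  \<open>p\<close> by a left translation (\<open>view_change\<close>). Hence the same factor
  \<open>l\<close> works with the base point \<open>q\<close>.\<close>

lemma tangents_translate:
  assumes X: "X \<in> tangents" and x: "x \<in> X"
  shows "(\<lambda>p. hinv x \<odot> p) ` X \<in> tangents"
proof -
  let ?Y = "(\<lambda>p. hinv x \<odot> p) ` X"
  have "\<exists>p\<in>E. \<exists>l\<ge>R. inside (view p l ` K) ?Y e R \<and> inside ?Y (view p l ` E) e R"
    if eR: "0 < e" "0 < R" for e R
  proof -
    obtain d where d: "0 < d" "d \<le> 1" "d + (d + sqrt (d\<^sup>2 + 4 * d * (R + 2))) \<le> e"
      using small_modulus[of e "R + 2"] eR by auto
    \<comment> \<open>Room for the window of radius \<open>R\<close> about \<open>x\<close> and for
      approximation errors of size at most 1.\<close>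
    define R1 where "R1 = R + hnorm x + 3"
    have R1: "0 < R1" "R \<le> R1" using eR hnorm_nonneg[of x] by (auto simp: R1_def)
    obtain p l where pl: "p \<in> E" "R1 \<le> l" "inside (view p l ` K) X d R1" "inside X (view p l ` E) d R1"
      using tangentsD[OF X d(1) R1(1)] by blast
    have "hnorm x \<le> R1" using eR by (simp add: R1_def)
    then obtain q where q: "q \<in> E" "dist x (view p l q) \<le> d" using insideD[OF pl(4) x] by auto
    define g where "g = view p l q"
    have g: "dist g x \<le> d" using q(2) by (simp add: g_def dist_commute)
    have est: "dist (hinv g \<odot> a) (hinv x \<odot> b) \<le> e" if "dist a b \<le> d" "hnorm (hinv x \<odot> b) \<le> R + 2" for a b
    proof -
      have "dist (hinv g \<odot> a) (hinv x \<odot> b) \<le> dist (hinv g \<odot> a) (hinv g \<odot> b) + dist (hinv g \<odot> b) (hinv x \<odot> b)"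
        by (rule dist_triangle)
      also have "\<dots> \<le> d + (dist g x + sqrt ((dist g x)\<^sup>2 + 4 * dist g x * hnorm (hinv x \<odot> b)))"
        using that dist_hmult_right_le[of g b x] by simp
      also have "\<dots> \<le> d + (d + sqrt (d\<^sup>2 + 4 * d * (R + 2)))"
        by (intro add_mono real_sqrt_le_mono power_mono mult_mono g that order.refl mult_nonneg_nonneg hnorm_nonneg zero_le_dist)
          (use d in auto)
      finally show ?thesis using d(3) by linarith
    qed
    have vq: "view q l z = hinv g \<odot> view p l z" for z
      unfolding g_def by (rule view_change[symmetric])
    have "inside (view q l ` K) ?Y e R"
      unfolding inside_def
    proof (intro ballI impI)
      fix w assume w: "w \<in> view q l ` K" "hnorm w \<le> R"
      then obtain z where z: "z \<in> K" "w = view q l z" by blast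
      define a where "a = view p l z"
      have wa: "w = hinv g \<odot> a" using z vq a_def by simp
      then have ga: "dist g a \<le> R" using w(2) by (simp add: dist_heis_alt)
      have "hnorm a \<le> hnorm x + dist x g + dist g a"
        using hnorm_le_add_dist[of a x] dist_triangle[of x a g] by linarith
      then have "hnorm a \<le> R1" using ga g d(2) unfolding R1_def by (simp add: dist_commute)
      moreover have "a \<in> view p l ` K" using z(1) a_def by blast
      ultimately obtain b where b: "b \<in> X" "dist a b \<le> d" using insideD[OF pl(3)] by blast
      have "hnorm (hinv x \<odot> b) \<le> R + 2"
      proof -
        have "dist x b \<le> dist x g + dist g a + dist a b"
          using dist_triangle[of x b g] dist_triangle[of g b a] by linarith
        then show ?thesis using g ga b d(2) by (simp add: dist_heis_alt[symmetric] dist_commute)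
      qed
      then show "\<exists>y\<in>?Y. dist w y \<le> e" using est[OF b(2)] wa b(1) by blast
    qed
    moreover have "inside ?Y (view q l ` E) e R"
      unfolding inside_def
    proof (intro ballI impI)
      fix w assume w: "w \<in> ?Y" "hnorm w \<le> R"
      then obtain b where b: "b \<in> X" "w = hinv x \<odot> b" by blast
      then have "dist x b \<le> R" using w(2) by (simp add: dist_heis_alt)
      then have "hnorm b \<le> R1" using hnorm_le_add_dist[of b x] by (simp add: R1_def)
      then obtain z where z: "z \<in> E" "dist b (view p l z) \<le> d" using insideD[OF pl(4) b(1)] by blast
      then have "dist (hinv g \<odot> view p l z) w \<le> e"
        unfolding b(2) using w(2) b(2) by (intro est) (auto simp: dist_commute)
      then show "\<exists>y\<in>view q l ` E. dist w y \<le> e" using z(1) vq by (auto simp: dist_commute)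
    qed
    ultimately show ?thesis using q(1) pl(2) R1(2) by (meson order_trans)
  qed
  then show ?thesis
    using closed_left_image[OF closed_tangents[OF X]] by (simp add: tangents_def)
qed

lemma tangents_limit:
  assumes cl: "closed X"
    and ap: "\<And>e R. 0 < e \<Longrightarrow> 0 < R \<Longrightarrow> \<exists>Y\<in>tangents. inside Y X e R \<and> inside X Y e R"
  shows "X \<in> tangents"
proof -
  have "\<exists>p\<in>E. \<exists>l\<ge>R. inside (view p l ` K) X e R \<and> inside X (view p l ` E) e R"
    if eR: "0 < e" "0 < R" for e R
  proof -
    obtain Y where Y: "Y \<in> tangents" "inside Y X (e/2) (R + e/2)" "inside X Y (e/2) (R + e/2)"
      using ap[of "e/2" "R + e/2"] eR by auto
    obtain p l where pl: "p \<in> E" "R + e/2 \<le> l" "inside (view p l ` K) Y (e/2) (R + e/2)" "inside Y (view p l ` E) (e/2) (R + e/2)"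
      using tangentsD[OF Y(1), of "e/2" "R + e/2"] eR by auto
    have "inside (view p l ` K) X (e/2 + e/2) R"
      by (rule inside_trans[OF inside_mono[OF pl(3)] Y(2)]) (use eR in auto)
    moreover have "inside X (view p l ` E) (e/2 + e/2) R"
      by (rule inside_trans[OF inside_mono[OF Y(3)] pl(4)]) (use eR in auto)
    ultimately show ?thesis using pl(1,2) eR by (intro bexI[of _ p] exI[of _ l]) auto
  qed
  with cl show ?thesis by (simp add: tangents_def)
qed

text \<open>A local Hausdorff limit of the dilates by \<open>Suc j\<close>, which are tangent sets
  themselves. Nearest points in the dilates give the sequences that \<open>is_blowup\<close> asks
  for.\<close>

lemma blowup_exists:
  assumes Y: "Y \<in> tangents"
  shows "\<exists>X\<in>tangents. is_blowup X Y"
proof -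
  define A where "A j = hdil (real (Suc j)) ` Y" for j
  have AT: "A j \<in> tangents" for j unfolding A_def by (rule tangents_hdil[OF Y]) simp
  have ne: "A j \<noteq> {}" for j using hzero_tangents[OF AT] by blast
  obtain X \<phi> where X: "closed X" "strict_mono \<phi>"
    and ev: "\<And>e R. 0 < e \<Longrightarrow> eventually (\<lambda>j. inside (A (\<phi> j)) X e R \<and> inside X (A (\<phi> j)) e R) sequentially"
    using subseq_local_Hausdorff_convergent[of A] ne by blast
  have "X \<in> tangents"
  proof (rule tangents_limit[OF X(1)])
    fix e R :: real assume "0 < e" "0 < R"
    from ev[OF this(1), of R] show "\<exists>Y\<in>tangents. inside Y X e R \<and> inside X Y e R"
      using AT by (auto simp: eventually_sequentially)
  qed
  moreover have "is_blowup X Y"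
    unfolding is_blowup_def
  proof (rule exI[of _ "\<lambda>j. real (Suc (\<phi> j))"], intro conjI ballI)
    have "filterlim (\<lambda>j. real (\<phi> j)) at_top sequentially"
      using filterlim_compose[OF filterlim_real_sequentially filterlim_subseq[OF X(2)]] by simp
    then show "filterlim (\<lambda>j. real (Suc (\<phi> j))) at_top sequentially"
      by (rule filterlim_at_top_mono) (auto intro: always_eventually)
    fix z assume z: "z \<in> X"
    have "\<exists>a\<in>A (\<phi> j). infdist z (A (\<phi> j)) = dist z a" for j
      by (rule infdist_attains_inf[OF closed_tangents[OF AT] ne]) blast
    then have "\<exists>y\<in>Y. infdist z (A (\<phi> j)) = dist z (hdil (real (Suc (\<phi> j))) y)" for j
      unfolding A_def by blast
    then obtain y where y: "\<And>j. y j \<in> Y" "\<And>j. infdist z (A (\<phi> j)) = dist z (hdil (real (Suc (\<phi> j))) (y j))"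
      by metis
    have "(\<lambda>j. hdil (real (Suc (\<phi> j))) (y j)) \<longlonglongrightarrow> z"
    proof (rule tendstoI)
      fix e :: real assume "0 < e"
      then have "eventually (\<lambda>j. inside X (A (\<phi> j)) (e/2) (hnorm z)) sequentially"
        using ev[of "e/2" "hnorm z"] by (auto elim: eventually_mono)
      then show "eventually (\<lambda>j. dist (hdil (real (Suc (\<phi> j))) (y j)) z < e) sequentially"
      proof eventually_elim
        case (elim j)
        then obtain a where a: "a \<in> A (\<phi> j)" "dist z a \<le> e/2" using insideD[OF _ z] by blast
        have "infdist z (A (\<phi> j)) \<le> e/2" using infdist_le2[OF a] .
        then show ?case using y(2)[of j] \<open>0 < e\<close> by (simp add: dist_commute)
      qed
    qed
    with y(1) show "\<exists>y. (\<forall>j. y j \<in> Y) \<and> (\<lambda>j. hdil (real (Suc (\<phi> j))) (y j)) \<longlonglongrightarrow> z" by blast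
  qed
  ultimately show ?thesis by blast
qed

end

section \<open>Homogeneous functions of constant sign on a tangent set\<close>

lemma homogeneous_hdil: "homogeneous f d \<Longrightarrow> 0 < s \<Longrightarrow> f (hdil s p) = s ^ d * f p"
  by (simp add: homogeneous_def)

lemma homogeneous_hzero: assumes "homogeneous f d" shows "f hzero = 0"
proof -
  have "f (hdil 2 hzero) = 2 ^ d * f hzero" by (rule homogeneous_hdil[OF assms]) simp
  moreover have "0 < d" using assms by (simp add: homogeneous_def)
  then have "1 < (2::real) ^ d" by (intro one_less_power) auto
  ultimately show ?thesis by simp
qed

lemma hnorm_pos: "p \<noteq> hzero \<Longrightarrow> 0 < hnorm p"
  using hnorm_nonneg[of p] hnorm_eq_0_iff[of p] by linarith

text \<open>For \<open>x\<close> on the unit sphere this is uniform continuity; homogeneity makes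
  the relative radius \<open>c\<close> independent of the scale.\<close>

lemma homogeneous_stable:
  assumes f: "homogeneous f d" and "0 < \<eta>"
  shows "\<exists>c>0. c \<le> 1/4 \<and> (\<forall>x z. x \<noteq> hzero \<longrightarrow> \<eta> * hnorm x ^ d \<le> f x \<longrightarrow> dist z x \<le> c * hnorm x
     \<longrightarrow> \<eta> / 2 * hnorm x ^ d \<le> f z)"
proof -
  have "uniformly_continuous_on (cball hzero 2) f"
    by (rule compact_uniformly_continuous[OF continuous_on_subset[of UNIV]])
      (use f in \<open>auto simp: homogeneous_def\<close>)
  then obtain e where e: "0 < e"
    "\<And>x z. x \<in> cball hzero 2 \<Longrightarrow> z \<in> cball hzero 2 \<Longrightarrow> dist z x < e \<Longrightarrow> dist (f z) (f x) < \<eta> / 2"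
    using \<open>0 < \<eta>\<close> unfolding uniformly_continuous_on_def by (metis half_gt_zero)
  define c where "c = min (1/4) (e/2)"
  have c: "0 < c" "c \<le> 1/4" "c < e" using e(1) by (auto simp: c_def)
  have "\<eta> / 2 * hnorm x ^ d \<le> f z"
    if x: "x \<noteq> hzero" "\<eta> * hnorm x ^ d \<le> f x" "dist z x \<le> c * hnorm x" for x z
  proof -
    let ?r = "hnorm x"
    have r: "0 < ?r" by (rule hnorm_pos[OF x(1)])
    define u w where "u = hdil (1 / ?r) x" and "w = hdil (1 / ?r) z"
    have xu: "x = hdil ?r u" "z = hdil ?r w" by (simp_all add: u_def w_def hdil_inverse[OF r])
    have fx: "f x = ?r ^ d * f u" "f z = ?r ^ d * f w"
      using homogeneous_hdil[OF f r] xu by metis+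
    have u1: "hnorm u = 1" using r by (simp add: u_def hnorm_hdil)
    have "dist w u = dist z x / ?r" using r by (simp add: u_def w_def dist_hdil)
    also have "\<dots> \<le> c" using x(3) r by (simp add: pos_divide_le_eq)
    finally have wu: "dist w u \<le> c" .
    have "hnorm w \<le> 2" using hnorm_le_add_dist[of w u] wu u1 c by (simp add: dist_commute)
    then have "dist (f w) (f u) < \<eta> / 2" using e(2)[of u w] u1 wu c by simp
    moreover have "\<eta> \<le> f u" using x(2) r unfolding fx by (simp add: mult.commute)
    ultimately have "\<eta> / 2 \<le> f w" unfolding dist_real_def by linarith
    then show ?thesis unfolding fx using r by (simp add: mult.commute mult_left_mono)
  qed
  with c show ?thesis by blast
qed

context ad_riesz
begin

definition annulus :: "'n heis \<Rightarrow> real \<Rightarrow> real \<Rightarrow> 'n heis set" where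
  "annulus p a b = {y. a < dist p y \<and> dist p y \<le> b}"

text \<open>Of degree \<open>-m\<close> when \<open>f\<close> has degree \<open>d\<close>, so that
  all scales have the same weight against an \<open>m\<close>-dimensional measure. Coordinates, of
  degree 1 or 2, give the components of the Riesz kernel.\<close>

definition rkernel :: "('n heis \<Rightarrow> real) \<Rightarrow> nat \<Rightarrow> 'n heis \<Rightarrow> real" where
  "rkernel f d p = f p / hnorm p ^ (m + d)"

definition riesz_bounded :: "('n heis \<Rightarrow> real) \<Rightarrow> nat \<Rightarrow> bool" where
  "riesz_bounded f d \<longleftrightarrow> (\<exists>B. \<forall>p\<in>E. \<forall>a b. 0 < a \<longrightarrow> a < b \<longrightarrow>
     \<bar>LINT y:annulus p a b|\<mu>. rkernel f d (hinv p \<odot> y)\<bar> \<le> B)"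

lemma annulus_sets [measurable]: "annulus p a b \<in> sets borel"
proof -
  have "annulus p a b = cball p b - cball p a" by (auto simp: annulus_def)
  then show ?thesis by simp
qed

lemma rkernel_measurable:
  assumes "homogeneous f d"
  shows "(\<lambda>y. rkernel f d (hinv p \<odot> y)) \<in> borel_measurable \<mu>"
proof -
  have "continuous_on UNIV (\<lambda>y. f (hinv p \<odot> y))"
    by (rule continuous_on_compose2[of UNIV f]) (use assms in \<open>auto simp: homogeneous_def intro!: continuous_on_hmult continuous_on_const continuous_on_id\<close>)
  moreover have "continuous_on UNIV (\<lambda>y. hnorm (hinv p \<odot> y))" by (intro continuous_intros)
  ultimately have "(\<lambda>y. f (hinv p \<odot> y)) \<in> borel_measurable borel"
    "(\<lambda>y. hnorm (hinv p \<odot> y)) \<in> borel_measurable borel"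
    by (auto intro: borel_measurable_continuous_onI)
  then show ?thesis unfolding rkernel_def measurable_cong_sets[OF sets_mu refl] by measurable
qed

lemma rkernel_integrable:
  assumes f: "homogeneous f d" and "0 < a"
  shows "set_integrable \<mu> (annulus p a b) (\<lambda>y. rkernel f d (hinv p \<odot> y))"
proof -
  have "compact (f ` cball hzero b)"
    by (rule compact_continuous_image) (use f in \<open>auto simp: homogeneous_def intro: continuous_on_subset\<close>)
  then have "bounded (f ` cball hzero b)" by (rule compact_imp_bounded)
  then obtain B where "\<And>x. x \<in> f ` cball hzero b \<Longrightarrow> norm x \<le> B"
    unfolding bounded_iff by blast
  then have B: "\<bar>f q\<bar> \<le> B" if "hnorm q \<le> b" for q using that by force
  show ?thesis
    unfolding set_integrable_def
  proof (rule integrable_const_bound)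
    show "AE y in \<mu>. norm (indicator (annulus p a b) y *\<^sub>R rkernel f d (hinv p \<odot> y)) \<le> \<bar>B\<bar> / a ^ (m + d)"
    proof (rule AE_I2)
      fix y
      show "norm (indicator (annulus p a b) y *\<^sub>R rkernel f d (hinv p \<odot> y)) \<le> \<bar>B\<bar> / a ^ (m + d)"
      proof (cases "y \<in> annulus p a b")
        case True
        then have h: "a < hnorm (hinv p \<odot> y)" "hnorm (hinv p \<odot> y) \<le> b"
          by (auto simp: annulus_def dist_heis_alt)
        have "\<bar>f (hinv p \<odot> y)\<bar> / hnorm (hinv p \<odot> y) ^ (m + d) \<le> \<bar>B\<bar> / a ^ (m + d)"
          using B[OF h(2)] h(1) \<open>0 < a\<close> by (intro frac_le power_mono) auto
        then show ?thesis using True h(1) \<open>0 < a\<close> by (simp add: rkernel_def)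
      qed (use \<open>0 < a\<close> in simp)
    qed
    show "(\<lambda>y. indicator (annulus p a b) y *\<^sub>R rkernel f d (hinv p \<odot> y)) \<in> borel_measurable \<mu>"
      using rkernel_measurable[OF f, of p] annulus_sets[of p a b]
      by (intro borel_measurable_scaleR borel_measurable_indicator) auto
  qed
qed

text \<open>
  A set that stays on one side of \<open>f = 0\<close> flattens at the origin: every scale at which it leaves
  \<open>f = 0\<close> substantially contributes a fixed amount to the truncated integrals.
\<close>

lemma riesz_flat:
  assumes X: "X \<in> tangents" and f: "homogeneous f d" and fB: "riesz_bounded f d"
    and pos: "\<And>x. x \<in> X \<Longrightarrow> 0 \<le> f x" and \<eta>: "0 < \<eta>"
  shows "\<exists>r>0. \<forall>x\<in>X. x \<noteq> hzero \<longrightarrow> hnorm x < r \<longrightarrow> f x < \<eta> * hnorm x ^ d"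
proof (rule ccontr)
  assume "\<not> ?thesis"
  then have ex: "\<exists>x\<in>X. x \<noteq> hzero \<and> hnorm x < r \<and> \<eta> * hnorm x ^ d \<le> f x" if "0 < r" for r
    using that by (meson not_less)
  obtain B where B: "\<And>p a b. p \<in> E \<Longrightarrow> 0 < a \<Longrightarrow> a < b \<Longrightarrow>
     \<bar>LINT y:annulus p a b|\<mu>. rkernel f d (hinv p \<odot> y)\<bar> \<le> B"
    using fB unfolding riesz_bounded_def by blast
  obtain c where c: "0 < c" "c \<le> 1/4" "\<And>x z. x \<noteq> hzero \<Longrightarrow> \<eta> * hnorm x ^ d \<le> f x
     \<Longrightarrow> dist z x \<le> c * hnorm x \<Longrightarrow> \<eta> / 2 * hnorm x ^ d \<le> f z"
    using homogeneous_stable[OF f \<eta>] by blast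
  \<comment> \<open>Contribution of one scale: a lower bound for the kernel near \<open>x i\<close>
    times the least mass of a ball of radius \<open>c * hnorm (x i) / (2 * l)\<close>. The factors
    \<open>hnorm (x i)\<close> and \<open>l\<close> cancel.\<close>
  define \<kappa> where "\<kappa> = (\<eta> / 2) / 2 ^ (m + d) * (c0 * (c / 2) ^ m)"
  have \<kappa>: "0 < \<kappa>" using \<eta> c0 c by (simp add: \<kappa>_def)
  obtain T :: nat where T: "(B + 1) / \<kappa> < real T" using reals_Archimedean2 by blast
  then have T\<kappa>: "B + 1 < real T * \<kappa>" using \<kappa> by (simp add: pos_divide_less_eq)
  let ?P = "\<lambda>x. x \<in> X \<and> x \<noteq> hzero \<and> hnorm x < 1 \<and> \<eta> * hnorm x ^ d \<le> f x"
  obtain x0 where "?P x0" using ex[of 1] by auto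
  \<comment> \<open>Norms more than halve, so that balls of relative radius 1/4 about different
    \<open>x i\<close> occupy disjoint shells: 5/4 of the smaller norm is below 3/4 of the larger
    one.\<close>
  moreover have "\<exists>y. ?P y \<and> hnorm y < hnorm x / 2" if "?P x" for x and i :: nat
  proof -
    have "0 < hnorm x" using that hnorm_pos by blast
    then obtain y where "y \<in> X" "y \<noteq> hzero" "hnorm y < hnorm x / 2" "\<eta> * hnorm y ^ d \<le> f y"
      using ex[of "hnorm x / 2"] by auto
    then show ?thesis using that \<open>0 < hnorm x\<close> by (intro exI[of _ y]) auto
  qed
  ultimately obtain x :: "nat \<Rightarrow> 'n heis" where x: "\<And>i. ?P (x i)" "\<And>i. hnorm (x (Suc i)) < hnorm (x i) / 2"
    using dependent_nat_choice[of "\<lambda>i. ?P" "\<lambda>i x y. hnorm y < hnorm x / 2"] by metis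
  have xp: "0 < hnorm (x i)" for i using x(1) hnorm_pos by blast
  have dec: "hnorm (x j) \<le> hnorm (x i) / 2" if "i < j" for i j
    using that
  proof (induction j)
    case (Suc j)
    then show ?case
    proof (cases "i = j")
      case False
      then have "hnorm (x j) \<le> hnorm (x i) / 2" using Suc by simp
      then show ?thesis using x(2)[of j] xp[of j] by linarith
    qed (use x(2)[of i] in simp)
  qed simp
  define \<rho> where "\<rho> = hnorm (x T) / 2"
  have \<rho>: "0 < \<rho>" using xp by (simp add: \<rho>_def)
  have \<rho>x: "2 * \<rho> \<le> hnorm (x i)" if "i < T" for i using dec[OF that] xp[of T] xp[of i] by (simp add: \<rho>_def)
  \<comment> \<open>Views of \<open>K\<close> are only close to \<open>X\<close>, so
    \<open>f\<close> may be slightly negative on them. With this tolerance the negative part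
    contributes at least -1 over the annulus of magnified radii \<open>\<rho>\<close> and 2; the
    factor \<open>2 ^ m\<close> stems from the outer radius.\<close>
  define e2 where "e2 = \<rho> ^ (m + d) / (C0 * 2 ^ m)"
  have e2: "0 < e2" using \<rho> C0 by (simp add: e2_def)
  have "uniformly_continuous_on (cball hzero 3) f"
    by (rule compact_uniformly_continuous[OF continuous_on_subset[of UNIV]])
      (use f in \<open>auto simp: homogeneous_def\<close>)
  then obtain d1 where d1: "0 < d1"
    "\<And>x z. x \<in> cball hzero 3 \<Longrightarrow> z \<in> cball hzero 3 \<Longrightarrow> dist z x < d1 \<Longrightarrow> dist (f z) (f x) < e2"
    using e2 unfolding uniformly_continuous_on_def by metis
  \<comment> \<open>In turn: continuity of \<open>f\<close> up to \<open>e2\<close>, half of the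
    relative radius \<open>c\<close> at every \<open>x i\<close> with \<open>i < T\<close>, and
    staying inside the ball of radius 3.\<close>
  define \<epsilon> where "\<epsilon> = min (d1 / 2) (min (c / 2 * (2 * \<rho>)) (1/2))"
  have \<epsilon>: "0 < \<epsilon>" "\<epsilon> < d1" "\<epsilon> \<le> c / 2 * (2 * \<rho>)" "\<epsilon> \<le> 1/2"
    using d1(1) c(1) \<rho> by (auto simp: \<epsilon>_def)
  obtain p l where pl: "p \<in> E" "2 \<le> l" "inside (view p l ` K) X \<epsilon> 2" "inside X (view p l ` E) \<epsilon> 2"
    using tangentsD[OF X \<epsilon>(1), of 2] by auto
  have l: "0 < l" "0 \<le> l" using pl(2) by auto
  have "\<exists>y\<in>E. dist (x i) (view p l y) \<le> \<epsilon>" for i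
  proof -
    have "hnorm (x i) \<le> 2" using x(1)[of i] by simp
    then show ?thesis using insideD[OF pl(4), of "x i"] x(1)[of i] by auto
  qed
  then obtain y where y: "\<And>i. y i \<in> E" "\<And>i. dist (x i) (view p l (y i)) \<le> \<epsilon>" by metis
  define rad where "rad i = c * hnorm (x i) / (2 * l)" for i
  define Bl where "Bl i = cball (y i) (rad i)" for i
  have rad: "0 < rad i" "rad i \<le> 1" for i
  proof -
    show "0 < rad i" using c xp l by (simp add: rad_def)
    have "c * hnorm (x i) \<le> 1 * 1" using c x(1)[of i] xp[of i] by (intro mult_mono) auto
    then show "rad i \<le> 1" using pl(2) by (simp add: rad_def pos_divide_le_eq)
  qed
  have near: "dist (view p l z) (x i) \<le> c * hnorm (x i)" if "z \<in> Bl i" "i < T" for z i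
  proof -
    have "dist (view p l z) (view p l (y i)) \<le> l * rad i"
      using that(1) l by (simp add: dist_view Bl_def dist_commute)
    also have "\<dots> = c / 2 * hnorm (x i)" using l by (simp add: rad_def)
    finally have 1: "dist (view p l z) (view p l (y i)) \<le> c / 2 * hnorm (x i)" .
    have "c / 2 * (2 * \<rho>) \<le> c / 2 * hnorm (x i)" using c \<rho>x[OF that(2)] by (intro mult_left_mono) auto
    then have "dist (view p l z) (x i) \<le> c / 2 * hnorm (x i) + c / 2 * hnorm (x i)"
      using 1 y(2)[of i] \<epsilon>(3) dist_triangle2[of "view p l z" "x i" "view p l (y i)"] by linarith
    then show ?thesis by simp
  qed
  have shell: "3/4 * hnorm (x i) \<le> hnorm (view p l z)" "hnorm (view p l z) \<le> 5/4 * hnorm (x i)"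
    if "z \<in> Bl i" "i < T" for z i
  proof -
    have "c * hnorm (x i) \<le> 1/4 * hnorm (x i)" using c xp[of i] by (intro mult_right_mono) auto
    then have "dist (view p l z) (x i) \<le> 1/4 * hnorm (x i)" using near[OF that] by linarith
    then show "3/4 * hnorm (x i) \<le> hnorm (view p l z)" "hnorm (view p l z) \<le> 5/4 * hnorm (x i)"
      using hnorm_le_add_dist[of "x i" "view p l z"] hnorm_le_add_dist[of "view p l z" "x i"]
      by (simp_all add: dist_commute)
  qed
  have disj: "i = j" if z: "z \<in> Bl i" "z \<in> Bl j" "i < T" "j < T" for z i j
  proof (rule ccontr)
    have *: False if "z \<in> Bl i" "z \<in> Bl j" "i < T" "j < T" "i < j" for i j
      using shell(1)[OF that(1,3)] shell(2)[OF that(2,4)] dec[OF that(5)] xp[of i] by linarith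
    assume "i \<noteq> j"
    then show False using *[of i j] *[of j i] z by linarith
  qed
  define a b where "a = \<rho> / l" and "b = 2 / l"
  have "hnorm (x T) < 1" using x(1) by blast
  then have "\<rho> < 2" by (simp add: \<rho>_def)
  then have ab: "0 < a" "a < b" using \<rho> l by (auto simp: a_def b_def divide_strict_right_mono)
  define A where "A = annulus p a b"
  have A_iff: "z \<in> A \<longleftrightarrow> \<rho> < hnorm (view p l z) \<and> hnorm (view p l z) \<le> 2" for z
    using l by (simp add: A_def annulus_def a_def b_def hnorm_view field_simps)
  define \<alpha> where "\<alpha> i = l ^ m * ((\<eta> / 2) / 2 ^ (m + d) / hnorm (x i) ^ m)" for i
  define \<beta> where "\<beta> = e2 * l ^ m / \<rho> ^ (m + d)"
  have \<alpha>\<beta>: "0 \<le> \<alpha> i" "0 \<le> \<beta>" for i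
    using \<eta> l xp[of i] e2 \<rho> by (auto simp: \<alpha>_def \<beta>_def)
  have ker: "rkernel f d (hinv p \<odot> z) = l ^ m * (f (view p l z) / hnorm (view p l z) ^ (m + d))" for z
    using l(1) homogeneous_hdil[OF f l(1)]
    by (simp add: rkernel_def view_def hnorm_hdil power_add power_mult_distrib)
  \<comment> \<open>A simple function below the kernel on the annulus, whose integral involves only
    the measures of the balls and of the annulus.\<close>
  define g where "g z = (\<Sum>i<T. \<alpha> i * indicator (Bl i) z) - \<beta> * indicator A z" for z
  have BlA: "z \<in> A" if "z \<in> Bl i" "i < T" for z i
  proof -
    have "hnorm (x i) < 1" using x(1) by blast
    then show ?thesis using shell[OF that] \<rho>x[OF that(2)] \<rho> unfolding A_iff by linarith
  qed
  have g_le: "g z \<le> indicator A z *\<^sub>R rkernel f d (hinv p \<odot> z)" if zK: "z \<in> K" for z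
  proof (cases "\<exists>i<T. z \<in> Bl i")
    case True
    then obtain i where i: "i < T" "z \<in> Bl i" by blast
    have "(\<Sum>j<T. \<alpha> j * indicator (Bl j) z) = (\<Sum>j<T. if j = i then \<alpha> i else 0)"
      by (rule sum.cong) (use disj i in \<open>auto simp: indicator_def\<close>)
    then have s: "(\<Sum>j<T. \<alpha> j * indicator (Bl j) z) = \<alpha> i" using i(1) by simp
    have fv: "\<eta> / 2 * hnorm (x i) ^ d \<le> f (view p l z)"
      by (rule c(3)) (use x(1) near[OF i(2,1)] in auto)
    have "0 \<le> \<eta> / 2 * hnorm (x i) ^ d" using \<eta> xp[of i] by simp
    then have "0 \<le> f (view p l z)" using fv by linarith
    moreover note fv
    moreover have "hnorm (view p l z) ^ (m + d) \<le> (2 * hnorm (x i)) ^ (m + d)"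
      using shell(2)[OF i(2,1)] xp[of i] by (intro power_mono hnorm_nonneg) auto
    moreover have "0 < hnorm (view p l z)" using shell(1)[OF i(2,1)] xp[of i] by linarith
    ultimately have "(\<eta> / 2 * hnorm (x i) ^ d) / (2 * hnorm (x i)) ^ (m + d)
        \<le> f (view p l z) / hnorm (view p l z) ^ (m + d)"
      by (intro frac_le zero_less_power)
    moreover have "(\<eta> / 2 * hnorm (x i) ^ d) / (2 * hnorm (x i)) ^ (m + d) = (\<eta> / 2) / 2 ^ (m + d) / hnorm (x i) ^ m"
      using xp[of i] by (simp add: power_add power_mult_distrib)
    ultimately have "\<alpha> i \<le> rkernel f d (hinv p \<odot> z)"
      unfolding \<alpha>_def ker using l by (intro mult_left_mono) auto
    then show ?thesis using BlA[OF i(2,1)] \<alpha>\<beta>(2) by (simp add: g_def s)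
  next
    case False
    then have s: "(\<Sum>j<T. \<alpha> j * indicator (Bl j) z) = 0" by (intro sum.neutral) auto
    show ?thesis
    proof (cases "z \<in> A")
      case zA: True
      then have h: "\<rho> < hnorm (view p l z)" "hnorm (view p l z) \<le> 2" unfolding A_iff by auto
      obtain w where w: "w \<in> X" "dist (view p l z) w \<le> \<epsilon>" using insideD[OF pl(3) _ h(2)] zK by blast
      have "hnorm w \<le> 3" using hnorm_le_add_dist[of w "view p l z"] h(2) w(2) \<epsilon>(4) by linarith
      then have "dist (f (view p l z)) (f w) < e2" using d1(2)[of w "view p l z"] h w \<epsilon> by simp
      then have fz: "- e2 \<le> f (view p l z)" using pos[OF w(1)] unfolding dist_real_def by linarith
      have "- (e2 / \<rho> ^ (m + d)) \<le> f (view p l z) / hnorm (view p l z) ^ (m + d)"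
      proof (cases "0 \<le> f (view p l z)")
        case True
        then have "0 \<le> f (view p l z) / hnorm (view p l z) ^ (m + d)" using h \<rho> by simp
        moreover have "0 \<le> e2 / \<rho> ^ (m + d)" using e2 \<rho> by simp
        ultimately show ?thesis by linarith
      next
        case False
        have "(- f (view p l z)) / hnorm (view p l z) ^ (m + d) \<le> e2 / \<rho> ^ (m + d)"
          using fz False h \<rho> by (intro frac_le power_mono) auto
        then show ?thesis by simp
      qed
      then have "l ^ m * (- (e2 / \<rho> ^ (m + d))) \<le> rkernel f d (hinv p \<odot> z)"
        unfolding ker using l by (intro mult_left_mono) auto
      moreover have "l ^ m * (- (e2 / \<rho> ^ (m + d))) = - \<beta>" by (simp add: \<beta>_def)
      ultimately show ?thesis using zA by (simp add: g_def s)
    qed (simp add: g_def s)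
  qed
  have mBl: "Bl i \<in> sets \<mu>" and mA: "A \<in> sets \<mu>" for i
    unfolding Bl_def A_def sets_mu by auto
  have ind: "integrable \<mu> (\<lambda>z. indicator S z :: real)" if "S \<in> sets \<mu>" for S
    by (rule integrable_real_indicator[OF that]) (simp add: less_top[symmetric])
  have i1: "integrable \<mu> (\<lambda>z. \<Sum>i<T. \<alpha> i * indicator (Bl i) z)"
    by (intro Bochner_Integration.integrable_sum integrable_mult_right ind mBl)
  have i2: "integrable \<mu> (\<lambda>z. \<beta> * indicator A z)"
    by (intro integrable_mult_right ind mA)
  have "(\<Sum>i<T. \<alpha> i * measure \<mu> (Bl i)) - \<beta> * measure \<mu> A = (\<integral>z. g z \<partial>\<mu>)"
    unfolding g_def Bochner_Integration.integral_diff[OF i1 i2]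
    by (subst Bochner_Integration.integral_sum) (simp_all add: ind[OF mBl])
  also have "\<dots> \<le> (LINT z:A|\<mu>. rkernel f d (hinv p \<odot> z))"
    unfolding set_lebesgue_integral_def
  proof (rule integral_mono_AE)
    show "integrable \<mu> g" unfolding g_def by (rule Bochner_Integration.integrable_diff[OF i1 i2])
    show "integrable \<mu> (\<lambda>z. indicator A z *\<^sub>R rkernel f d (hinv p \<odot> z))"
      using rkernel_integrable[OF f ab(1), of p b] by (simp add: set_integrable_def A_def)
    have "- K \<in> null_sets \<mu>" using null_compl compact_K
      by (auto simp: null_sets_def compact_imp_closed borel_open)
    then show "AE z in \<mu>. g z \<le> indicator A z *\<^sub>R rkernel f d (hinv p \<odot> z)"
      by (rule AE_I') (use g_le in auto)
  qed
  also have "\<dots> \<le> B" using B[OF pl(1) ab] unfolding A_def by linarith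
  finally have up: "(\<Sum>i<T. \<alpha> i * measure \<mu> (Bl i)) - \<beta> * measure \<mu> A \<le> B" .
  have "\<kappa> \<le> \<alpha> i * measure \<mu> (Bl i)" for i
  proof -
    have "\<alpha> i * (c0 * rad i ^ m) \<le> \<alpha> i * measure \<mu> (Bl i)"
      unfolding Bl_def using lower[of "y i" "rad i"] rad[of i] y(1) E_sub \<alpha>\<beta>(1) by (intro mult_left_mono) auto
    moreover have "\<alpha> i * (c0 * rad i ^ m) = \<kappa>"
      using l xp[of i] by (simp add: \<alpha>_def \<kappa>_def rad_def power_divide power_mult_distrib)
    ultimately show ?thesis by simp
  qed
  then have "real T * \<kappa> \<le> (\<Sum>i<T. \<alpha> i * measure \<mu> (Bl i))"
    using sum_bounded_below[of "{..<T}" \<kappa> "\<lambda>i. \<alpha> i * measure \<mu> (Bl i)"] by simp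
  moreover have "\<beta> * measure \<mu> A \<le> 1"
  proof -
    have "measure \<mu> A \<le> measure \<mu> (cball p b)"
      by (rule finite_measure_mono) (auto simp: A_def annulus_def)
    also have "\<dots> \<le> C0 * b ^ m" using upper[of p b] pl(1) E_sub ab by auto
    finally have "\<beta> * measure \<mu> A \<le> \<beta> * (C0 * b ^ m)" using \<alpha>\<beta>(2) by (rule mult_left_mono)
    also have "\<dots> = 1" using l \<rho> C0 by (simp add: \<beta>_def e2_def b_def power_divide)
    finally show ?thesis .
  qed
  ultimately show False using up T\<kappa> by linarith
qed

text \<open>By \<open>riesz_flat\<close>, \<open>f\<close> is of smaller order than
  \<open>hnorm x ^ d\<close> on \<open>Y\<close> near the origin, and \<open>f\<close> is
  homogeneous of exactly this degree, so nothing positive survives the blow-up.\<close>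

lemma blowup_zero:
  assumes Y: "Y \<in> tangents" and f: "homogeneous f d" and fB: "riesz_bounded f d"
    and pos: "\<And>x. x \<in> Y \<Longrightarrow> 0 \<le> f x" and X: "is_blowup X Y" and z: "z \<in> X"
  shows "f z = 0"
proof -
  have fc: "(\<lambda>j. f (w j)) \<longlonglongrightarrow> f z" if "w \<longlonglongrightarrow> z" for w
    using f that continuous_on_tendsto_compose[of UNIV f w z] by (simp add: homogeneous_def)
  obtain s y where sy: "filterlim s at_top sequentially" "\<And>j. y j \<in> Y" "(\<lambda>j. hdil (s j) (y j)) \<longlonglongrightarrow> z"
    using X z unfolding is_blowup_def by metis
  have s1: "eventually (\<lambda>j. 1 \<le> s j) sequentially" using sy(1) by (auto simp: filterlim_at_top)
  have fz: "(\<lambda>j. f (hdil (s j) (y j))) \<longlonglongrightarrow> f z" by (rule fc[OF sy(3)])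
  have "0 \<le> f z"
  proof (rule tendsto_lowerbound[OF fz])
    show "\<forall>\<^sub>F j in sequentially. 0 \<le> f (hdil (s j) (y j))"
      using s1
    proof eventually_elim
      case (elim j)
      then show ?case using homogeneous_hdil[OF f, of "s j" "y j"] pos[OF sy(2)] by simp
    qed
  qed simp
  moreover have "\<not> 0 < f z"
  proof
    assume fz0: "0 < f z"
    then have z0: "z \<noteq> hzero" using homogeneous_hzero[OF f] by auto
    have hz: "0 < hnorm z" by (rule hnorm_pos[OF z0])
    \<comment> \<open>Half of the normalised value of \<open>f\<close> at \<open>z\<close>; the
      limit would give \<open>f z \<le> f z / 2\<close>.\<close>
    define \<eta> where "\<eta> = f z / (2 * hnorm z ^ d)"
    have "0 < \<eta>" using fz0 hz by (simp add: \<eta>_def)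
    from riesz_flat[OF Y f fB pos this]
    obtain r where r: "0 < r" "\<And>x. x \<in> Y \<Longrightarrow> x \<noteq> hzero \<Longrightarrow> hnorm x < r \<Longrightarrow> f x < \<eta> * hnorm x ^ d" by blast
    have hn: "(\<lambda>j. hnorm (hdil (s j) (y j))) \<longlonglongrightarrow> hnorm z" by (intro tendsto_intros sy(3))
    then have e1: "eventually (\<lambda>j. 0 < hnorm (hdil (s j) (y j))) sequentially"
      and e2: "eventually (\<lambda>j. hnorm (hdil (s j) (y j)) < hnorm z + 1) sequentially"
      using hz order_tendstoD by (blast, metis less_add_one order_tendstoD(2))
    have e3: "eventually (\<lambda>j. (hnorm z + 1) / r \<le> s j) sequentially" using sy(1) by (auto simp: filterlim_at_top)
    have "\<forall>\<^sub>F j in sequentially. f (hdil (s j) (y j)) \<le> \<eta> * hnorm (hdil (s j) (y j)) ^ d"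
      using e1 e2 e3 s1
    proof eventually_elim
      case (elim j)
      have s0: "0 < s j" using elim(4) by linarith
      have 1: "y j \<noteq> hzero" using elim(1) by auto
      have "s j * hnorm (y j) < hnorm z + 1" using elim(2) s0 by (simp add: hnorm_hdil)
      also have "\<dots> \<le> s j * r" using elim(3) r(1) by (simp add: pos_divide_le_eq)
      finally have "hnorm (y j) < r" using s0 by simp
      then have "f (y j) < \<eta> * hnorm (y j) ^ d" using r(2)[OF sy(2) 1] by blast
      then have "s j ^ d * f (y j) \<le> s j ^ d * (\<eta> * hnorm (y j) ^ d)" using s0 by (intro mult_left_mono) auto
      then show ?case using homogeneous_hdil[OF f s0, of "y j"] s0
        by (simp add: hnorm_hdil power_mult_distrib algebra_simps)
    qed
    then have "f z \<le> \<eta> * hnorm z ^ d"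
      by (intro tendsto_le[OF sequentially_bot _ fz, of "\<lambda>j. \<eta> * hnorm (hdil (s j) (y j)) ^ d"] tendsto_intros hn)
    then show False using fz0 hz by (simp add: \<eta>_def)
  qed
  ultimately show ?thesis by linarith
qed

end

section \<open>A tangent set that is a homogeneous subgroup\<close>

definition vert_group :: "(real ^ ('n::finite + 'n)) set \<Rightarrow> 'n heis set" where
  "vert_group L = {p. hor p \<in> L}"

definition hor_group :: "(real ^ ('n::finite + 'n)) set \<Rightarrow> 'n heis set" where
  "hor_group L = {p. hor p \<in> L \<and> vert p = 0}"

lemma homogeneous_inner: "homogeneous (\<lambda>p. u \<bullet> hor p) 1"
  unfolding homogeneous_def by (auto intro!: continuous_on_inner continuous_on_heis continuous_on_const continuous_on_id)

lemma homogeneous_coord: "homogeneous (\<lambda>p. hor p $ i) 1"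
  unfolding homogeneous_def by (auto intro!: continuous_on_component continuous_on_heis continuous_on_id)

lemma homogeneous_vert: "homogeneous (\<lambda>p. c * vert p) 2"
  unfolding homogeneous_def by (auto intro!: continuous_on_mult continuous_on_heis continuous_on_const continuous_on_id)

lemma powr_Suc_eq_power: "0 \<le> x \<Longrightarrow> x powr (real m + 1) = x ^ (m + 1)" "0 \<le> x \<Longrightarrow> x powr (real m + 2) = x ^ (m + 2)"
  using powr_realpow'[of x "m + 1"] powr_realpow'[of x "m + 2"] by (auto simp: add.commute)

lemma subspace_kernel_less:
  fixes L :: "'b::euclidean_space set"
  assumes "subspace L" "linear f" "v \<in> L" "f v \<noteq> (0::real)"
  shows "subspace (L \<inter> {x. f x = 0})" "dim (L \<inter> {x. f x = 0}) < dim L"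
proof -
  have "subspace {x. f x = 0}" using linear_subspace_kernel assms(2) by blast
  then show s: "subspace (L \<inter> {x. f x = 0})" using assms(1) subspace_inter by blast
  have "L \<inter> {x. f x = 0} \<subset> L" using assms(3,4) by auto
  then show "dim (L \<inter> {x. f x = 0}) < dim L"
    using s assms(1) by (intro dim_psubset) (simp only: span_eq_iff[THEN iffD2])
qed

lemma linear_hform: "linear (hform x)"
  by (intro linearI) (simp_all add: hform_simps hform_scale)

text \<open>With the reciprocal scale \<open>t\<close> tending to 0, inequalities on
  \<open>Y\<close> can be expanded in \<open>t\<close>. Finitely many terms are dropped to make all
  scales positive.\<close>

lemma blowup_sequence:
  assumes "is_blowup X Y" "z \<in> X"
  obtains t w where "t \<longlonglongrightarrow> 0" "\<And>j::nat. 0 < t j" "w \<longlonglongrightarrow> z" "\<And>j. hdil (t j) (w j) \<in> Y"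
proof -
  obtain s y where sy: "filterlim s at_top sequentially" "\<And>j. y j \<in> Y" "(\<lambda>j. hdil (s j) (y j)) \<longlonglongrightarrow> z"
    using assms unfolding is_blowup_def by metis
  have "eventually (\<lambda>j. 1 \<le> s j) sequentially" using sy(1) by (auto simp: filterlim_at_top)
  then obtain N where N: "\<And>j. N \<le> j \<Longrightarrow> 1 \<le> s j" unfolding eventually_sequentially by blast
  have s0: "0 < s (j + N)" for j using N[of "j + N"] by linarith
  show ?thesis
  proof (rule that)
    show "(\<lambda>j. 1 / s (j + N)) \<longlonglongrightarrow> 0"
      using LIMSEQ_ignore_initial_segment[OF tendsto_inverse_0_at_top[OF sy(1)], of N] by (simp add: inverse_eq_divide)
    show "0 < 1 / s (j + N)" for j using s0 by simp
    show "(\<lambda>j. hdil (s (j + N)) (y (j + N))) \<longlonglongrightarrow> z"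
      using LIMSEQ_ignore_initial_segment[OF sy(3), of N] .
    show "hdil (1 / s (j + N)) (hdil (s (j + N)) (y (j + N))) \<in> Y" for j
      unfolding hdil_inverse(1)[OF s0] by (rule sy(2))
  qed
qed

lemma blowup_vert_group:
  assumes "is_blowup X Y" "Y \<subseteq> vert_group L" "subspace L"
  shows "X \<subseteq> vert_group L"
proof
  fix z assume "z \<in> X"
  then obtain t w where tw: "\<And>j::nat. 0 < t j" "w \<longlonglongrightarrow> z" "\<And>j. hdil (t j) (w j) \<in> Y"
    using blowup_sequence[OF assms(1)] by metis
  have "hor (w j) \<in> L" for j
  proof -
    have "t j *\<^sub>R hor (w j) \<in> L" using tw(3)[of j] assms(2) by (auto simp: vert_group_def)
    then have "(1 / t j) *\<^sub>R (t j *\<^sub>R hor (w j)) \<in> L" using assms(3) subspace_scale by blast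
    then show ?thesis using tw(1)[of j] by simp
  qed
  moreover have "(\<lambda>j. hor (w j)) \<longlonglongrightarrow> hor z" by (intro tendsto_intros tw(2))
  ultimately show "z \<in> vert_group L"
    using closed_sequentially[OF closed_subspace[OF assms(3)], of "\<lambda>j. hor (w j)" "hor z"]
    by (simp add: vert_group_def)
qed

text \<open>
  If the Koranyi ball around \<open>h\<close> through the origin avoids \<open>Y\<close>, then expanding
  \<open>d(h, y)\<^sup>4 \<ge> \<parallel>h\<parallel>\<^sup>4\<close> for \<open>y = \<delta>\<^sub>t(w)\<close> in \<open>t\<close> gives a half-space condition on blow-ups, to first order
  when \<open>h\<close> is not on the vertical axis and to second order when it is.
\<close>

lemma dist_hdil_expand:
  assumes "hnorm h \<le> dist h (hdil t w)" "0 < t"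
  shows "0 \<le> t * (t * (norm (hor w))\<^sup>2 - 2 * (hor h \<bullet> hor w))\<^sup>2
      + 2 * (norm (hor h))\<^sup>2 * (t * (norm (hor w))\<^sup>2 - 2 * (hor h \<bullet> hor w))
      + t * (t * vert w - hform (hor h) (hor w))\<^sup>2 - 2 * vert h * (t * vert w - hform (hor h) (hor w))"
proof -
  define a b A c where "a = (norm (hor w))\<^sup>2" and "b = hor h \<bullet> hor w" and "A = (norm (hor h))\<^sup>2" and "c = hform (hor h) (hor w)"
  have p4: "x ^ 4 = (x\<^sup>2)\<^sup>2" for x :: real by (simp flip: power_mult)
  have "hnorm h ^ 4 \<le> dist h (hdil t w) ^ 4" using assms(1) by (intro power_mono hnorm_nonneg)
  moreover have "(norm (- hor h + t *\<^sub>R hor w))\<^sup>2 = t\<^sup>2 * a - 2 * t * b + A"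
    unfolding a_def b_def A_def power2_norm_eq_inner
    by (simp add: inner_diff_left inner_diff_right inner_commute[of "hor w" "hor h"] power2_eq_square right_diff_distrib)
  moreover have "hnorm h ^ 4 = A\<^sup>2 + (vert h)\<^sup>2"
    unfolding hnorm_pow4 A_def by (simp only: p4)
  moreover have "dist h (hdil t w) ^ 4 = ((norm (- hor h + t *\<^sub>R hor w))\<^sup>2)\<^sup>2 + (t\<^sup>2 * vert w - vert h - t * c)\<^sup>2"
  proof -
    have "vert (hinv h \<odot> hdil t w) = t\<^sup>2 * vert w - vert h - t * c"
      by (simp add: c_def hform_simps hform_scale)
    then show ?thesis
      unfolding dist_heis_alt hnorm_pow4 by (simp only: hmult_sel(1) hinv_sel(1) hdil_sel(1) p4)
  qed
  ultimately have "A\<^sup>2 + (vert h)\<^sup>2 \<le> (t\<^sup>2 * a - 2 * t * b + A)\<^sup>2 + (t\<^sup>2 * vert w - vert h - t * c)\<^sup>2"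
    by (simp only:)
  then have "0 \<le> t * (t * (t * a - 2 * b)\<^sup>2 + 2 * A * (t * a - 2 * b) + t * (t * vert w - c)\<^sup>2 - 2 * vert h * (t * vert w - c))"
    by (simp add: power2_eq_square algebra_simps)
  then show ?thesis using assms(2) by (simp add: zero_le_mult_iff a_def b_def c_def A_def)
qed

text \<open>The expansion at \<open>t = 0\<close>. For a centre on the vertical axis,
  \<open>hor h = 0\<close>, it degenerates to \<open>0 \<le> 0\<close>, which is why poles are
  treated separately.\<close>

lemma blowup_ball_nonpole:
  assumes "is_blowup X Y" "z \<in> X" and ball: "\<And>y. y \<in> Y \<Longrightarrow> hnorm h \<le> dist h y"
  shows "0 \<le> 2 * vert h * hform (hor h) (hor z) - 4 * (norm (hor h))\<^sup>2 * (hor h \<bullet> hor z)"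
proof -
  obtain t w where tw: "t \<longlonglongrightarrow> 0" "\<And>j::nat. 0 < t j" "w \<longlonglongrightarrow> z" "\<And>j. hdil (t j) (w j) \<in> Y"
    using blowup_sequence[OF assms(1,2)] by metis
  define e where "e t (w :: 'a heis) = t * (t * (norm (hor w))\<^sup>2 - 2 * (hor h \<bullet> hor w))\<^sup>2
      + 2 * (norm (hor h))\<^sup>2 * (t * (norm (hor w))\<^sup>2 - 2 * (hor h \<bullet> hor w))
      + t * (t * vert w - hform (hor h) (hor w))\<^sup>2 - 2 * vert h * (t * vert w - hform (hor h) (hor w))" for t w
  have "(\<lambda>j. e (t j) (w j)) \<longlonglongrightarrow> e 0 z" unfolding e_def by (intro tendsto_intros tw)
  moreover have "0 \<le> e (t j) (w j)" for j unfolding e_def by (rule dist_hdil_expand[OF ball[OF tw(4)] tw(2)])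
  ultimately have "0 \<le> e 0 z" by (intro tendsto_lowerbound[of "\<lambda>j. e (t j) (w j)"]) auto
  then show ?thesis by (simp add: e_def)
qed

lemma blowup_ball_pole:
  assumes "is_blowup X Y" "z \<in> X" and ball: "\<And>y. y \<in> Y \<Longrightarrow> hnorm h \<le> dist h y" and h: "hor h = 0"
  shows "0 \<le> - vert h * vert z"
proof -
  obtain t w where tw: "t \<longlonglongrightarrow> 0" "\<And>j::nat. 0 < t j" "w \<longlonglongrightarrow> z" "\<And>j. hdil (t j) (w j) \<in> Y"
    using blowup_sequence[OF assms(1,2)] by metis
  \<comment> \<open>For \<open>hor h = 0\<close> the expansion contains one more factor
    \<open>t\<close>; this is the quotient by it.\<close>
  define e where "e t (w :: 'a heis) = t\<^sup>2 * ((norm (hor w))\<^sup>2)\<^sup>2 + t\<^sup>2 * (vert w)\<^sup>2 - 2 * vert h * vert w" for t w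
  have "(\<lambda>j. e (t j) (w j)) \<longlonglongrightarrow> e 0 z" unfolding e_def by (intro tendsto_intros tw)
  moreover have "0 \<le> e (t j) (w j)" for j
  proof -
    have "0 \<le> t j * e (t j) (w j)"
      using dist_hdil_expand[OF ball[OF tw(4)[of j]] tw(2)] by (simp add: e_def h power2_eq_square algebra_simps)
    then show ?thesis using tw(2)[of j] by (simp add: zero_le_mult_iff)
  qed
  ultimately have "0 \<le> e 0 z" by (intro tendsto_lowerbound[of "\<lambda>j. e (t j) (w j)"]) auto
  then show ?thesis by (simp add: e_def)
qed

context ad_riesz
begin

text \<open>Leads from the coordinate kernels, which are the ones assumed bounded, to arbitrary
  linear forms, since the direction of a contact cannot be prescribed.\<close>

lemma riesz_bounded_sum:
  assumes "finite I" "\<And>i. i \<in> I \<Longrightarrow> homogeneous (f i) d" "\<And>i. i \<in> I \<Longrightarrow> riesz_bounded (f i) d"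
  shows "riesz_bounded (\<lambda>p. \<Sum>i\<in>I. c i * f i p) d"
proof -
  obtain B where B: "\<And>i p a b. i \<in> I \<Longrightarrow> p \<in> E \<Longrightarrow> 0 < a \<Longrightarrow> a < b \<Longrightarrow>
     \<bar>LINT y:annulus p a b|\<mu>. rkernel (f i) d (hinv p \<odot> y)\<bar> \<le> B i"
    using assms(3) unfolding riesz_bounded_def by metis
  have "\<bar>LINT y:annulus p a b|\<mu>. rkernel (\<lambda>p. \<Sum>i\<in>I. c i * f i p) d (hinv p \<odot> y)\<bar> \<le> (\<Sum>i\<in>I. \<bar>c i\<bar> * B i)"
    if p: "p \<in> E" "0 < a" "a < b" for p a b
  proof -
    have *: "integrable \<mu> (\<lambda>y. indicator (annulus p a b) y *\<^sub>R rkernel (f i) d (hinv p \<odot> y))" if "i \<in> I" for i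
      using rkernel_integrable[OF assms(2)[OF that] p(2)] by (simp add: set_integrable_def)
    have "(LINT y:annulus p a b|\<mu>. rkernel (\<lambda>p. \<Sum>i\<in>I. c i * f i p) d (hinv p \<odot> y))
        = (\<integral>y. (\<Sum>i\<in>I. c i * (indicator (annulus p a b) y *\<^sub>R rkernel (f i) d (hinv p \<odot> y))) \<partial>\<mu>)"
      unfolding set_lebesgue_integral_def rkernel_def
      by (intro Bochner_Integration.integral_cong refl)
        (simp add: sum_divide_distrib sum_distrib_left mult.left_commute)
    also have "\<dots> = (\<Sum>i\<in>I. \<integral>y. c i * (indicator (annulus p a b) y *\<^sub>R rkernel (f i) d (hinv p \<odot> y)) \<partial>\<mu>)"
      by (rule Bochner_Integration.integral_sum) (rule integrable_mult_right, rule *)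
    also have "\<dots> = (\<Sum>i\<in>I. c i * (LINT y:annulus p a b|\<mu>. rkernel (f i) d (hinv p \<odot> y)))"
      unfolding set_lebesgue_integral_def
      by (rule sum.cong[OF refl]) (rule Bochner_Integration.integral_mult_right, rule *)
    also have "\<bar>\<dots>\<bar> \<le> (\<Sum>i\<in>I. \<bar>c i\<bar> * B i)"
      by (rule order.trans[OF sum_abs sum_mono]) (simp add: abs_mult mult_left_mono B p)
    finally show ?thesis .
  qed
  then show ?thesis unfolding riesz_bounded_def by blast
qed

lemma riesz_boundedI:
  assumes "\<And>p a b. p \<in> E \<Longrightarrow> 0 < a \<Longrightarrow> a < b \<Longrightarrow>
     \<bar>LINT y:{y. a < dist p y \<and> dist p y \<le> b}|\<mu>. rkernel f d (hinv p \<odot> y)\<bar> \<le> M"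
  shows "riesz_bounded f d"
  unfolding riesz_bounded_def annulus_def using assms by (intro exI[of _ M] ballI allI impI)

lemma riesz_bounded_coord: "riesz_bounded (\<lambda>p. hor p $ i) 1"
proof -
  have "rkernel (\<lambda>p. hor p $ i) 1 = riesz_kernel (real m) (Some i)"
    by (auto simp: rkernel_def riesz_kernel_def powr_Suc_eq_power hnorm_nonneg fun_eq_iff)
  then show ?thesis by (intro riesz_boundedI) (simp only: riesz)
qed

lemma riesz_bounded_vert: "riesz_bounded (\<lambda>p. c * vert p) 2"
proof -
  have "rkernel vert 2 = riesz_kernel (real m) None"
    by (auto simp: rkernel_def riesz_kernel_def powr_Suc_eq_power hnorm_nonneg fun_eq_iff)
  then have 1: "riesz_bounded vert 2" by (intro riesz_boundedI) (simp only: riesz)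
  show ?thesis
    using riesz_bounded_sum[of "{()}" "\<lambda>_. vert" 2 "\<lambda>_. c"] homogeneous_vert[of 1] 1 by simp
qed

lemma riesz_bounded_inner: "riesz_bounded (\<lambda>p. u \<bullet> hor p) 1"
  unfolding inner_vec_def inner_real_def
  by (intro riesz_bounded_sum riesz_bounded_coord homogeneous_coord finite)

lemma touching_nonpole:
  assumes X: "X \<in> tangents" "X \<subseteq> vert_group L" and L: "subspace L" and g: "g \<in> vert_group L"
    and x: "x \<in> X" "\<And>y. y \<in> X \<Longrightarrow> dist g x \<le> dist g y" "hor g \<noteq> hor x"
  shows "\<exists>L' X'. subspace L' \<and> dim L' < dim L \<and> X' \<in> tangents \<and> X' \<subseteq> vert_group L'"
proof -
  define Y where "Y = (\<lambda>p. hinv x \<odot> p) ` X"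
  define h where "h = hinv x \<odot> g"
  have Y: "Y \<in> tangents" unfolding Y_def by (rule tangents_translate[OF X(1) x(1)])
  have xL: "hor x \<in> L" using X(2) x(1) by (auto simp: vert_group_def)
  have YL: "Y \<subseteq> vert_group L"
    using X(2) xL L by (auto simp: Y_def vert_group_def subspace_diff)
  have hL: "hor h \<in> L" using g xL L by (auto simp: h_def vert_group_def subspace_diff)
  have h0: "hor h \<noteq> 0" using x(3) by (simp add: h_def)
  have ball: "hnorm h \<le> dist h y" if y: "y \<in> Y" for y
  proof -
    obtain y' where "y' \<in> X" "y = hinv x \<odot> y'" using y by (auto simp: Y_def)
    then show ?thesis using x(2)[of y'] by (simp add: h_def dist_heis_alt[symmetric] dist_commute)
  qed
  define \<phi> where "\<phi> v = 2 * vert h * hform (hor h) v - 4 * (norm (hor h))\<^sup>2 * (hor h \<bullet> v)" for v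
  have lin: "linear \<phi>"
    by (intro linearI) (simp_all add: \<phi>_def hform_simps hform_scale inner_add_right algebra_simps)
  \<comment> \<open>The half-space functional as an inner product, the form to which
    \<open>riesz_bounded_inner\<close> applies.\<close>
  define u where "u = adjoint \<phi> 1"
  have u: "u \<bullet> v = \<phi> v" for v using adjoint_works[OF lin, of v 1] by (simp add: u_def inner_commute)
  obtain X1 where X1: "X1 \<in> tangents" "is_blowup X1 Y" using blowup_exists[OF Y] by blast
  have X1L: "X1 \<subseteq> vert_group L" by (rule blowup_vert_group[OF X1(2) YL L])
  have pos: "0 \<le> u \<bullet> hor z" if "z \<in> X1" for z
    using blowup_ball_nonpole[OF X1(2) that ball] by (simp add: u \<phi>_def)
  obtain X2 where X2: "X2 \<in> tangents" "is_blowup X2 X1" using blowup_exists[OF X1(1)] by blast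
  have "\<phi> (hor z) = 0" if "z \<in> X2" for z
    using blowup_zero[OF X1(1) homogeneous_inner riesz_bounded_inner pos X2(2) that] by (simp add: u)
  then have "X2 \<subseteq> vert_group (L \<inter> {v. \<phi> v = 0})"
    using blowup_vert_group[OF X2(2) X1L L] by (auto simp: vert_group_def)
  \<comment> \<open>The twist vanishes at \<open>hor h\<close>, which leaves the value
    \<open>- 4 * norm (hor h) ^ 4\<close>. So the kernel meets \<open>L\<close> in a proper
    subspace.\<close>
  moreover have "\<phi> (hor h) \<noteq> 0" using h0 by (simp add: \<phi>_def)
  ultimately show ?thesis using subspace_kernel_less[OF L lin hL] X2(1) by blast
qed

text \<open>The sphere is horizontal at its poles, so the contact constrains the sign of
  \<open>vert\<close> instead of a horizontal direction; the second blow-up turns this into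
  \<open>vert = 0\<close>.\<close>

lemma touching_pole:
  assumes X: "X \<in> tangents" "X \<subseteq> vert_group L" and L: "subspace L"
    and x: "x \<in> X" "\<And>y. y \<in> X \<Longrightarrow> dist g x \<le> dist g y" "hor g = hor x" "g \<noteq> x"
  shows "\<exists>X'\<in>tangents. X' \<subseteq> hor_group L"
proof -
  define Y where "Y = (\<lambda>p. hinv x \<odot> p) ` X"
  define h where "h = hinv x \<odot> g"
  have Y: "Y \<in> tangents" unfolding Y_def by (rule tangents_translate[OF X(1) x(1)])
  have xL: "hor x \<in> L" using X(2) x(1) by (auto simp: vert_group_def)
  have YL: "Y \<subseteq> vert_group L"
    using X(2) xL L by (auto simp: Y_def vert_group_def subspace_diff)
  have h0: "hor h = 0" using x(3) by (simp add: h_def)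
  have "vert g \<noteq> vert x" using x(3,4) heis_eq_iff by blast
  then have v0: "vert h \<noteq> 0" using x(3) by (simp add: h_def hform_simps)
  have ball: "hnorm h \<le> dist h y" if y: "y \<in> Y" for y
  proof -
    obtain y' where "y' \<in> X" "y = hinv x \<odot> y'" using y by (auto simp: Y_def)
    then show ?thesis using x(2)[of y'] by (simp add: h_def dist_heis_alt[symmetric] dist_commute)
  qed
  obtain X1 where X1: "X1 \<in> tangents" "is_blowup X1 Y" using blowup_exists[OF Y] by blast
  have X1L: "X1 \<subseteq> vert_group L" by (rule blowup_vert_group[OF X1(2) YL L])
  have pos: "0 \<le> - vert h * vert z" if "z \<in> X1" for z
    by (rule blowup_ball_pole[OF X1(2) that ball h0])
  obtain X2 where X2: "X2 \<in> tangents" "is_blowup X2 X1" using blowup_exists[OF X1(1)] by blast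
  have "vert z = 0" if "z \<in> X2" for z
    using blowup_zero[OF X1(1) homogeneous_vert riesz_bounded_vert pos X2(2) that] v0 by simp
  then have "X2 \<subseteq> hor_group L"
    using blowup_vert_group[OF X2(2) X1L L] by (auto simp: vert_group_def hor_group_def)
  with X2(1) show ?thesis by blast
qed

lemma nearest_point:
  assumes "X \<in> tangents"
  obtains x where "x \<in> X" "\<And>y. y \<in> X \<Longrightarrow> dist g x \<le> dist g y"
  using distance_attains_inf[OF closed_tangents[OF assms]] hzero_tangents[OF assms] by blast

lemma tangent_subgroup:
  assumes ne: "tangents \<noteq> {}"
  shows "\<exists>X\<in>tangents. \<exists>L. subspace L \<and>
    (X = vert_group L \<or> X = hor_group L \<and> (\<forall>x\<in>L. \<forall>y\<in>L. hform x y = 0))"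
proof -
  let ?P = "\<lambda>L :: (real ^ ('n + 'n)) set. subspace L \<and> (\<exists>X\<in>tangents. X \<subseteq> vert_group L)"
  have "?P UNIV" using ne by (auto simp: vert_group_def)
  then obtain L where PL: "?P L" and min: "\<And>L'. ?P L' \<Longrightarrow> dim L \<le> dim L'"
    using ex_has_least_nat[of ?P UNIV dim] by blast
  have L: "subspace L" using PL by blast
  obtain X where X: "X \<in> tangents" "X \<subseteq> vert_group L" using PL by blast
  have nonpole: False if that': "X \<in> tangents" "X \<subseteq> vert_group L" "g \<in> vert_group L" "x \<in> X"
    "\<And>y. y \<in> X \<Longrightarrow> dist g x \<le> dist g y" "hor g \<noteq> hor x" for X g x
  proof -
    obtain L' X' where "subspace L'" "dim L' < dim L" "X' \<in> tangents" "X' \<subseteq> vert_group L'"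
      using touching_nonpole[OF that'(1,2) L that'(3-6)] by blast
    then show False using min[of L'] by auto
  qed
  show ?thesis
  proof (cases "X = vert_group L")
    case False
    then obtain g where g: "g \<in> vert_group L" "g \<notin> X" using X(2) by blast
    obtain x where x: "x \<in> X" "\<And>y. y \<in> X \<Longrightarrow> dist g x \<le> dist g y" using nearest_point[OF X(1)] by blast
    have "hor g = hor x" using nonpole[OF X g(1) x] by blast
    moreover have "g \<noteq> x" using g(2) x(1) by blast
    ultimately obtain X2 where X2: "X2 \<in> tangents" "X2 \<subseteq> hor_group L"
      using touching_pole[OF X L x] by blast
    have X2V: "X2 \<subseteq> vert_group L" using X2(2) by (auto simp: hor_group_def vert_group_def)
    \<comment> \<open>Recentring at \<open>p\<close> tilts the horizontal set into the graph of
      \<open>- hform (hor p)\<close>. Under dilations \<open>vert\<close> scales with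
      \<open>t ^ 2\<close> and the form with \<open>t\<close>, so a blow-up keeps only points where
      the form vanishes; if it were nonzero somewhere on \<open>L\<close>, this would contradict
      minimality.\<close>
    have iso: "hform (hor p) v = 0" if p: "p \<in> X2" and v: "v \<in> L" for p v
    proof (rule ccontr)
      assume nz: "hform (hor p) v \<noteq> 0"
      define Y where "Y = (\<lambda>q. hinv p \<odot> q) ` X2"
      have Y: "Y \<in> tangents" unfolding Y_def by (rule tangents_translate[OF X2(1) p])
      have pL: "hor p \<in> L" "vert p = 0" using p X2(2) by (auto simp: hor_group_def)
      have YL: "Y \<subseteq> vert_group L"
        using X2V pL L by (auto simp: Y_def vert_group_def subspace_diff)
      have Yv: "vert y = - hform (hor p) (hor y)" if "y \<in> Y" for y
        using that X2(2) pL by (auto simp: Y_def hor_group_def hform_simps hform_diff)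
      obtain X3 where X3: "X3 \<in> tangents" "is_blowup X3 Y" using blowup_exists[OF Y] by blast
      have "hform (hor p) (hor z) = 0" if zX3: "z \<in> X3" for z
      proof -
        obtain t w where tw: "t \<longlonglongrightarrow> 0" "\<And>j::nat. 0 < t j" "w \<longlonglongrightarrow> z" "\<And>j. hdil (t j) (w j) \<in> Y"
          using blowup_sequence[OF X3(2) zX3] by metis
        have "t j * vert (w j) = - hform (hor p) (hor (w j))" for j
        proof -
          have "t j * (t j * vert (w j)) = t j * (- hform (hor p) (hor (w j)))"
            using Yv[OF tw(4)[of j]] by (simp add: hform_scale power2_eq_square)
          then show ?thesis using tw(2)[of j] mult_left_cancel[of "t j"] by (metis less_irrefl)
        qed
        moreover have "(\<lambda>j. t j * vert (w j)) \<longlonglongrightarrow> 0 * vert z" by (intro tendsto_intros tw)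
        ultimately have "(\<lambda>j. - hform (hor p) (hor (w j))) \<longlonglongrightarrow> 0" by simp
        moreover have "(\<lambda>j. - hform (hor p) (hor (w j))) \<longlonglongrightarrow> - hform (hor p) (hor z)" by (intro tendsto_intros tw)
        ultimately show ?thesis using LIMSEQ_unique by fastforce
      qed
      then have "X3 \<subseteq> vert_group (L \<inter> {v. hform (hor p) v = 0})"
        using blowup_vert_group[OF X3(2) YL L] by (auto simp: vert_group_def)
      then show False
        using subspace_kernel_less[OF L linear_hform v nz] X3(1) min[of "L \<inter> {v. hform (hor p) v = 0}"] by auto
    qed
    have "X2 = hor_group L"
    proof (rule ccontr)
      assume "X2 \<noteq> hor_group L"
      then obtain g where g: "g \<in> hor_group L" "g \<notin> X2" using X2(2) by blast
      obtain x where x: "x \<in> X2" "\<And>y. y \<in> X2 \<Longrightarrow> dist g x \<le> dist g y" using nearest_point[OF X2(1)] by blast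
      have "g \<in> vert_group L" using g(1) by (auto simp: hor_group_def vert_group_def)
      \<comment> \<open>Contact off the poles is excluded, so \<open>g\<close> and its nearest point
        have the same horizontal part. Both have \<open>vert = 0\<close> and hence coincide.\<close>
      from nonpole[OF X2(1) X2V this x] have "hor g = hor x" by blast
      then have "g = x" using g(1) x(1) X2(2) by (auto simp: heis_eq_iff hor_group_def)
      then show False using g x by blast
    qed
    moreover have "hform x y = 0" if "x \<in> L" "y \<in> L" for x y
    proof -
      have "Heis x 0 \<in> X2" using that \<open>X2 = hor_group L\<close> by (simp add: hor_group_def)
      from iso[OF this that(2)] show ?thesis by simp
    qed
    ultimately show ?thesis using X2(1) L by blast
  qed (use X L in blast)
qed

end

section \<open>Existence of tangent sets\<close>

context ad_riesz
begin

lemma closure_E_sub: "closure E \<subseteq> K"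
  by (rule closure_minimal[OF E_sub compact_imp_closed[OF compact_K]])

text \<open>
  If \<open>E\<close> had a hole of relative size \<open>e\<close> in every ball, then a thin neighbourhood of \<open>E\<close> would have
  measure at least a fixed multiple of that of \<open>closure E\<close>, outside of \<open>closure E\<close>.
\<close>

lemma porous_estimate:
  assumes e: "0 < e" "e \<le> R" and t: "0 < t" "e * t \<le> 1"
    and hole: "\<And>p. p \<in> E \<Longrightarrow> \<exists>y\<in>K. dist p y \<le> R * t \<and> (\<forall>z\<in>E. e * t < dist y z)"
  shows "c0 * (e / 2) ^ m / (C0 * (4 * R) ^ m) * measure \<mu> (closure E)
    \<le> measure \<mu> ({x. infdist x E \<le> 2 * R * t} - closure E)"
proof -
  have R: "0 < R" using e by linarith
  \<comment> \<open>The ball chosen in a hole stays within \<open>2 * R * t\<close> of its centre in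
    \<open>E\<close>, so this separation makes these balls disjoint, while balls of radius
    \<open>4 * R * t\<close> still cover \<open>E\<close>. The number of centres cancels between the
    two estimates.\<close>
  have "0 < 4 * R * t" using R t by simp
  from separated_net[OF compact_K E_sub this]
  obtain P where P: "finite P" "P \<subseteq> E" "pairwise (\<lambda>p q. 4 * R * t < dist p q) P" "E \<subseteq> (\<Union>p\<in>P. cball p (4 * R * t))"
    by (elim exE conjE)
  have "\<forall>p\<in>P. \<exists>y\<in>K. dist p y \<le> R * t \<and> (\<forall>z\<in>E. e * t < dist y z)" using hole P(2) by blast
  then obtain y where y: "\<And>p. p \<in> P \<Longrightarrow> y p \<in> K" "\<And>p. p \<in> P \<Longrightarrow> dist p (y p) \<le> R * t"
    "\<And>p z. p \<in> P \<Longrightarrow> z \<in> E \<Longrightarrow> e * t < dist (y p) z" by metis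
  let ?N = "{x. infdist x E \<le> 2 * R * t} - closure E"
  have N: "?N \<in> sets \<mu>"
  proof -
    have "closed {x. infdist x E \<le> 2 * R * t}" by (intro closed_Collect_le continuous_intros)
    then show ?thesis by (simp add: borel_closed)
  qed
  let ?B = "\<lambda>p. cball (y p) (e * t / 2)"
  have near: "dist p z \<le> 2 * R * t" if "p \<in> P" "z \<in> ?B p" for p z
  proof -
    have "e * t \<le> R * t" using e t by (intro mult_right_mono) auto
    moreover have "dist p z \<le> dist p (y p) + dist (y p) z" by (rule dist_triangle)
    moreover have "0 < R * t" using R t by simp
    ultimately show ?thesis using y(2)[OF that(1)] that(2) by simp
  qed
  have disj: "disjoint_family_on ?B P"
    unfolding disjoint_family_on_def
  proof (intro ballI impI, rule ccontr)
    fix p q assume pq: "p \<in> P" "q \<in> P" "p \<noteq> q" "?B p \<inter> ?B q \<noteq> {}"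
    then obtain z where "z \<in> ?B p" "z \<in> ?B q" by blast
    then have "dist p z \<le> 2 * R * t" "dist q z \<le> 2 * R * t" using near pq by blast+
    then have "dist p q \<le> 4 * R * t" using dist_triangle2[of p q z] by linarith
    then show False using P(3) pq unfolding pairwise_def by (meson not_less)
  qed
  have sub: "?B p \<subseteq> ?N" if p: "p \<in> P" for p
  proof
    fix z assume z: "z \<in> ?B p"
    have "infdist z E \<le> 2 * R * t"
      using infdist_le2[of p E z "2 * R * t"] near[OF p z] P(2) p by (auto simp: dist_commute)
    moreover have "z \<notin> closure E"
    proof
      assume "z \<in> closure E"
      moreover have "0 < e * t / 2" using e t by simp
      ultimately obtain w where w: "w \<in> E" "dist w z < e * t / 2" unfolding closure_approachable by blast
      have "dist (y p) w \<le> dist (y p) z + dist w z" by (rule dist_triangle2)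
      then show False using y(3)[OF p w(1)] w(2) z by simp
    qed
    ultimately show "z \<in> ?N" by blast
  qed
  have "real (card P) * (c0 * (e * t / 2) ^ m) \<le> (\<Sum>p\<in>P. measure \<mu> (?B p))"
    by (rule sum_bounded_below) (use lower[of _ "e * t / 2"] y(1) e t in auto)
  also have "\<dots> = measure \<mu> (\<Union>p\<in>P. ?B p)"
    by (rule finite_measure_finite_Union[symmetric, OF P(1) _ disj]) auto
  also have "\<dots> \<le> measure \<mu> ?N"
    by (rule finite_measure_mono[OF _ N]) (use sub in blast)
  finally have 1: "real (card P) * (c0 * (e * t / 2) ^ m) \<le> measure \<mu> ?N" .
  have "closure E \<subseteq> (\<Union>p\<in>P. cball p (4 * R * t))"
    by (rule closure_minimal[OF P(4)]) (use P(1) in auto)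
  then have "measure \<mu> (closure E) \<le> measure \<mu> (\<Union>p\<in>P. cball p (4 * R * t))"
    by (rule finite_measure_mono) (use P(1) in \<open>auto intro!: borel_closed closed_UN\<close>)
  also have "\<dots> \<le> (\<Sum>p\<in>P. measure \<mu> (cball p (4 * R * t)))"
    by (rule finite_measure_subadditive_finite[OF P(1)]) auto
  also have "\<dots> \<le> (\<Sum>p\<in>P. C0 * (4 * R * t) ^ m)"
    by (rule sum_mono) (use upper[of _ "4 * R * t"] P(2) E_sub \<open>0 < 4 * R * t\<close> in auto)
  finally have 2: "measure \<mu> (closure E) \<le> real (card P) * (C0 * (4 * R * t) ^ m)" by simp
  let ?k = "c0 * (e / 2) ^ m / (C0 * (4 * R) ^ m)"
  have "?k * measure \<mu> (closure E) \<le> ?k * (real (card P) * (C0 * (4 * R * t) ^ m))"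
    by (rule mult_left_mono[OF 2]) (use c0 C0 e R in auto)
  also have "\<dots> = real (card P) * (c0 * (e * t / 2) ^ m)"
    using C0 R by (simp add: power_mult_distrib power_divide)
  finally show ?thesis using 1 by linarith
qed

text \<open>Otherwise \<open>porous_estimate\<close> applies at scales tending to 0. The thin
  neighbourhoods of \<open>E\<close> minus \<open>closure E\<close> decrease to the empty set, so
  their measures tend to 0, against a fixed positive lower bound.\<close>

lemma dense_scale:
  assumes e: "0 < e" and R: "0 < R"
  shows "\<exists>p\<in>E. \<exists>l\<ge>R. \<forall>y\<in>K. dist p y \<le> R / l \<longrightarrow> (\<exists>z\<in>E. dist y z \<le> e / l)"
proof (rule ccontr)
  assume "\<not> ?thesis"
  then have hole: "\<exists>y\<in>K. dist p y \<le> R / l \<and> (\<forall>z\<in>E. e / l < dist y z)" if "p \<in> E" "R \<le> l" for p l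
    using that by (meson not_less)
  \<comment> \<open>Shrinking \<open>e\<close> and starting from a large \<open>L\<close> meets the
    conditions \<open>e' \<le> R\<close> and \<open>e' * t j \<le> 1\<close> of
    \<open>porous_estimate\<close>.\<close>
  define e' where "e' = min e R"
  define L where "L = max R (max e' 1)"
  have e': "0 < e'" "e' \<le> R" "e' \<le> e" and L: "R \<le> L" "e' \<le> L" "1 \<le> L"
    using e R by (auto simp: e'_def L_def)
  define t where "t j = 1 / (L + real j)" for j :: nat
  have t: "0 < t j" "e' * t j \<le> 1" for j using L e' by (auto simp: t_def)
  define N where "N j = {x. infdist x E \<le> 2 * R * t j} - closure E" for j
  define k where "k = c0 * (e' / 2) ^ m / (C0 * (4 * R) ^ m)"
  have k: "0 < k" using c0 C0 e' R by (simp add: k_def)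
  have le: "k * measure \<mu> (closure E) \<le> measure \<mu> (N j)" for j
    unfolding k_def N_def
  proof (rule porous_estimate[OF e'(1,2) t])
    fix p assume "p \<in> E"
    then obtain y where y: "y \<in> K" "dist p y \<le> R / (L + real j)" "\<And>z. z \<in> E \<Longrightarrow> e / (L + real j) < dist y z"
      using hole[of p "L + real j"] L by auto
    have "e' * t j \<le> e / (L + real j)" using e' L by (simp add: t_def divide_right_mono)
    then have "\<forall>z\<in>E. e' * t j < dist y z" using y(3) by (meson order_le_less_trans)
    with y show "\<exists>y\<in>K. dist p y \<le> R * t j \<and> (\<forall>z\<in>E. e' * t j < dist y z)" by (auto simp: t_def)
  qed
  have "decseq N"
  proof (rule decseq_SucI)
    fix j
    have "t (Suc j) \<le> t j" using L by (simp add: t_def frac_le)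
    then have "2 * R * t (Suc j) \<le> 2 * R * t j" using R by (intro mult_left_mono) auto
    then show "N (Suc j) \<le> N j" by (auto simp: N_def)
  qed
  moreover have "range N \<subseteq> sets \<mu>"
  proof -
    have "closed {x. infdist x E \<le> 2 * R * t j}" for j by (intro closed_Collect_le continuous_intros)
    then show ?thesis by (auto simp: N_def borel_closed)
  qed
  ultimately have lim: "(\<lambda>j. measure \<mu> (N j)) \<longlonglongrightarrow> measure \<mu> (\<Inter>j. N j)"
    by (intro finite_Lim_measure_decseq)
  have t0: "(\<lambda>j. 2 * R * t j) \<longlonglongrightarrow> 2 * R * 0"
  proof (intro tendsto_intros)
    have "filterlim (\<lambda>j. L + real j) at_top sequentially"
      by (rule filterlim_tendsto_add_at_top[OF tendsto_const filterlim_real_sequentially])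
    then show "t \<longlonglongrightarrow> 0"
      unfolding t_def using tendsto_inverse_0_at_top by (simp add: inverse_eq_divide[symmetric])
  qed
  have "(\<Inter>j. N j) = {}"
  proof (rule ccontr)
    assume "(\<Inter>j. N j) \<noteq> {}"
    then obtain x where x: "\<And>j. x \<in> N j" by blast
    have "infdist x E \<le> 2 * R * 0"
      by (rule tendsto_lowerbound[OF t0]) (use x in \<open>auto simp: N_def\<close>)
    then have "x \<in> closure E" using in_closure_iff_infdist_zero[OF E_nonempty] infdist_nonneg[of x E] by auto
    then show False using x[of 0] by (simp add: N_def)
  qed
  then have "(\<lambda>j. measure \<mu> (N j)) \<longlonglongrightarrow> 0" using lim by simp
  then have "k * measure \<mu> (closure E) \<le> 0"
    by (rule tendsto_lowerbound) (use le in auto)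
  then have "measure \<mu> (closure E) \<le> 0" using k mult_pos_pos[of k "measure \<mu> (closure E)"] by linarith
  then have "measure \<mu> (closure E) = 0" using measure_nonneg[of \<mu> "closure E"] by linarith
  then show False using E_pos by (simp add: emeasure_eq_measure)
qed

text \<open>\<open>dense_scale\<close> with tolerance \<open>1 / r j\<close> on windows of radius
  \<open>r j\<close> gives views in which \<open>K\<close> and \<open>E\<close> become
  indistinguishable; a subsequential limit of them is a tangent set.\<close>

lemma tangents_nonempty: "tangents \<noteq> {}"
proof -
  define r where "r j = real (Suc j)" for j
  have r: "0 < r j" "1 \<le> r j" for j by (auto simp: r_def)
  have "\<exists>p l. p \<in> E \<and> r j \<le> l \<and> (\<forall>y\<in>K. dist p y \<le> r j / l \<longrightarrow> (\<exists>z\<in>E. dist y z \<le> 1 / r j / l))" for j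
    using dense_scale[of "1 / r j" "r j"] r(1)[of j] by auto
  then obtain p l where pl: "\<And>j. p j \<in> E" "\<And>j. r j \<le> l j"
    "\<And>j y. y \<in> K \<Longrightarrow> dist (p j) y \<le> r j / l j \<Longrightarrow> \<exists>z\<in>E. dist y z \<le> 1 / r j / l j" by metis
  have l: "0 < l j" for j using pl(2)[of j] r(1)[of j] by linarith
  define A where "A j = view (p j) (l j) ` K" for j
  have "A j \<noteq> {}" for j using pl(1) E_sub by (auto simp: A_def)
  then obtain X \<phi> where X: "closed X" "strict_mono \<phi>"
    and ev: "\<And>e R. 0 < e \<Longrightarrow> eventually (\<lambda>j. inside (A (\<phi> j)) X e R \<and> inside X (A (\<phi> j)) e R) sequentially"
    using subseq_local_Hausdorff_convergent[of A] by blast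
  have dense: "inside (A j) (view (p j) (l j) ` E) (1 / r j) (r j)" for j
    unfolding inside_def
  proof (intro ballI impI)
    fix a assume a: "a \<in> A j" "hnorm a \<le> r j"
    then obtain y where y: "y \<in> K" "a = view (p j) (l j) y" by (auto simp: A_def)
    have "dist (p j) y \<le> r j / l j" using a(2) y(2) l[of j] by (simp add: hnorm_view pos_le_divide_eq mult.commute)
    then obtain z where z: "z \<in> E" "dist y z \<le> 1 / r j / l j" using pl(3)[OF y(1)] by blast
    have "dist a (view (p j) (l j) z) \<le> 1 / r j"
    proof -
      have "l j * dist y z \<le> l j * (1 / r j / l j)" using z(2) l[of j] by (intro mult_left_mono) auto
      then show ?thesis using l[of j] y(2) by (simp add: dist_view)
    qed
    then show "\<exists>x\<in>view (p j) (l j) ` E. dist a x \<le> 1 / r j" using z(1) by blast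
  qed
  have "X \<in> tangents"
    unfolding tangents_def
  proof (intro CollectI conjI allI impI X(1))
    fix e R :: real assume eR: "0 < e" "0 < R"
    obtain j1 where j1: "\<And>j. j1 \<le> j \<Longrightarrow> inside (A (\<phi> j)) X (e/2) R \<and> inside X (A (\<phi> j)) (e/2) R"
      using ev[of "e/2" R] eR(1) unfolding eventually_sequentially by auto
    obtain j2 :: nat where j2: "R + e/2 + 2 / e \<le> real j2" using real_arch_simple by blast
    define j where "j = max j1 j2"
    have "j \<le> \<phi> j" using X(2) by (rule seq_suble)
    then have "real j2 \<le> r (\<phi> j)" by (simp add: r_def j_def)
    moreover have "0 < 2 / e" using eR by simp
    ultimately have rj: "R + e/2 \<le> r (\<phi> j)" "2 / e \<le> r (\<phi> j)" using j2 eR by linarith+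
    have "1 / r (\<phi> j) \<le> e / 2" using rj(2) eR r(1)[of "\<phi> j"] by (simp add: field_simps)
    then have d: "inside (A (\<phi> j)) (view (p (\<phi> j)) (l (\<phi> j)) ` E) (e/2) (R + e/2)"
      using inside_mono[OF dense[of "\<phi> j"] order.refl _ rj(1)] by simp
    have "inside X (view (p (\<phi> j)) (l (\<phi> j)) ` E) (e/2 + e/2) R"
      by (rule inside_trans[OF _ d]) (use j1[of j] in \<open>simp add: j_def\<close>)
    moreover have "inside (view (p (\<phi> j)) (l (\<phi> j)) ` K) X e R"
      using inside_mono[of _ X "e/2" R _ e R] j1[of j] eR by (auto simp: j_def A_def)
    moreover have "R \<le> l (\<phi> j)" using rj(1) pl(2)[of "\<phi> j"] eR by linarith
    ultimately show "\<exists>p\<in>E. \<exists>l\<ge>R. inside (view p l ` K) X e R \<and> inside X (view p l ` E) e R"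
      using pl(1)[of "\<phi> j"] by (intro bexI[of _ "p (\<phi> j)"] exI[of _ "l (\<phi> j)"]) auto
  qed
  then show ?thesis by blast
qed

end

section \<open>Dimension of the tangent subgroup\<close>

text \<open>Turns counting estimates at the scales \<open>1 / 2 ^ j\<close> into comparisons of
  dimensions.\<close>

lemma nat_power_growth:
  assumes "\<And>j::nat. (2::real) ^ (j * a) \<le> C * 2 ^ (j * b)"
  shows "a \<le> b"
proof (rule ccontr)
  assume "\<not> a \<le> b"
  then obtain k where k: "a = b + Suc k" using less_imp_Suc_add[of b a] by auto
  have "(2::real) ^ j \<le> C" for j :: nat
  proof -
    have "(2::real) ^ j * 2 ^ (j * b) \<le> 2 ^ (j * k) * (2 ^ j * 2 ^ (j * b))"
      using mult_right_mono[of 1 "(2::real) ^ (j * k)" "2 ^ j * 2 ^ (j * b)"] by simp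
    also have "\<dots> = 2 ^ (j * a)" by (simp add: k power_add[symmetric] algebra_simps)
    also have "\<dots> \<le> C * 2 ^ (j * b)" by (rule assms)
    finally show ?thesis by simp
  qed
  moreover obtain n :: nat where "C < 2 ^ n" using real_arch_pow[of 2 C] by auto
  ultimately show False by (meson not_less)
qed

lemma inner_grid:
  fixes B :: "'b::euclidean_space set"
  assumes "finite B" "pairwise orthogonal B" "\<And>x. x \<in> B \<Longrightarrow> norm x = 1" "b \<in> B"
  shows "(\<Sum>x\<in>B. f x *\<^sub>R x) \<bullet> b = f b"
proof -
  have "(\<Sum>x\<in>B. f x *\<^sub>R x) \<bullet> b = (\<Sum>x\<in>B. if x = b then f b else 0)"
    unfolding inner_sum_left
  proof (rule sum.cong[OF refl])
    fix x assume "x \<in> B"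
    show "(f x *\<^sub>R x) \<bullet> b = (if x = b then f b else 0)"
    proof (cases "x = b")
      case True
      then show ?thesis using assms(3)[OF assms(4)] by (simp add: norm_eq_1)
    next
      case False
      then show ?thesis using assms(2,4) \<open>x \<in> B\<close> by (auto simp: pairwise_def orthogonal_def)
    qed
  qed
  then show ?thesis using assms by simp
qed

text \<open>Dyadic coordinates in \<open>[0, 1)\<close> with respect to an orthonormal basis; a
  single differing coordinate already gives the separation.\<close>

lemma subspace_grid:
  fixes L :: "'b::euclidean_space set"
  assumes "subspace L"
  shows "\<exists>G. finite G \<and> G \<subseteq> L \<and> card G = 2 ^ (j * dim L) \<and>
     (\<forall>v\<in>G. norm v \<le> real (dim L)) \<and> (\<forall>v\<in>G. \<forall>w\<in>G. v \<noteq> w \<longrightarrow> 1 / 2 ^ j \<le> norm (v - w))"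
proof -
  obtain B where B: "B \<subseteq> L" "pairwise orthogonal B" "\<And>x. x \<in> B \<Longrightarrow> norm x = 1" "independent B" "card B = dim L" "span B = L"
    using orthonormal_basis_subspace[OF assms] by blast
  have fin: "finite B" using independent_imp_finite[OF B(4)] .
  define F where "F = (\<Pi>\<^sub>E b\<in>B. {..<(2::nat) ^ j})"
  define v where "v a = (\<Sum>b\<in>B. (real (a b) / 2 ^ j) *\<^sub>R b)" for a :: "'b \<Rightarrow> nat"
  have vb: "v a \<bullet> b = real (a b) / 2 ^ j" if "b \<in> B" for a b
    unfolding v_def by (rule inner_grid[OF fin B(2,3) that])
  have sep: "1 / 2 ^ j \<le> norm (v a - v a')" if "a \<in> F" "a' \<in> F" "a \<noteq> a'" for a a'
  proof -
    have "\<exists>b\<in>B. a b \<noteq> a' b"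
    proof (rule ccontr)
      assume "\<not> ?thesis"
      then have "a = a'" using PiE_ext[OF that(1,2)[unfolded F_def]] by blast
      then show False using that(3) by simp
    qed
    then obtain b where b: "b \<in> B" "a b \<noteq> a' b" by blast
    have "1 \<le> \<bar>real (a b) - real (a' b)\<bar>" using b(2) by linarith
    then have "1 / 2 ^ j \<le> \<bar>real (a b) - real (a' b)\<bar> / 2 ^ j" by (intro divide_right_mono) auto
    also have "\<dots> = \<bar>(v a - v a') \<bullet> b\<bar>"
      by (simp add: inner_diff_left vb[OF b(1)] diff_divide_distrib[symmetric])
    also have "\<dots> \<le> norm (v a - v a')" using Cauchy_Schwarz_ineq2[of "v a - v a'" b] B(3)[OF b(1)] by simp
    finally show ?thesis .
  qed
  have inj: "inj_on v F"
  proof (rule inj_onI, rule ccontr)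
    fix a a' assume *: "a \<in> F" "a' \<in> F" "v a = v a'" "a \<noteq> a'"
    have "norm (v a - v a') = 0" "(0::real) < 1 / 2 ^ j" using *(3) by simp_all
    then show False using sep[OF *(1,2,4)] by linarith
  qed
  have "finite F" unfolding F_def using fin by (intro finite_PiE) auto
  moreover have "card F = 2 ^ (j * dim L)"
    by (simp add: F_def card_PiE[OF fin] B(5) power_mult)
  moreover have "v ` F \<subseteq> L"
  proof clarify
    fix a assume "a \<in> F"
    show "v a \<in> L" unfolding v_def using B(1) assms by (intro subspace_sum subspace_scale) auto
  qed
  moreover have "norm (v a) \<le> real (dim L)" if "a \<in> F" for a
  proof -
    have "norm (v a) \<le> (\<Sum>b\<in>B. norm ((real (a b) / 2 ^ j) *\<^sub>R b))" unfolding v_def by (rule norm_sum)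
    also have "\<dots> \<le> (\<Sum>b\<in>B. 1)"
    proof (rule sum_mono)
      fix b assume b: "b \<in> B"
      then have "a b < 2 ^ j" using \<open>a \<in> F\<close> by (auto simp: F_def)
      then have "real (a b) \<le> 2 ^ j" by (metis less_imp_le of_nat_le_iff of_nat_numeral of_nat_power)
      then show "norm ((real (a b) / 2 ^ j) *\<^sub>R b) \<le> 1" using B(3)[OF b] by simp
    qed
    finally show ?thesis by (simp add: B(5))
  qed
  ultimately show ?thesis
    using sep by (intro exI[of _ "v ` F"]) (auto simp: card_image[OF inj])
qed

text \<open>Rounding the coordinates in an orthonormal basis to a mesh \<open>1 / N\<close> is
  injective on separated points, so it suffices to count cells.\<close>

lemma separated_card_le:
  fixes P :: "'b::euclidean_space set"
  assumes "finite P" "P \<subseteq> L" "subspace L" and bd: "\<And>v. v \<in> P \<Longrightarrow> norm v \<le> R" "0 \<le> R"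
    and sep: "\<And>v w. v \<in> P \<Longrightarrow> w \<in> P \<Longrightarrow> v \<noteq> w \<Longrightarrow> 1 / 2 ^ j < norm (v - w)"
  shows "real (card P) \<le> (2 * R * real (Suc (dim L)) + 4) ^ dim L * 2 ^ (j * dim L)"
proof -
  obtain B where B: "B \<subseteq> L" "pairwise orthogonal B" "\<And>x. x \<in> B \<Longrightarrow> norm x = 1" "independent B" "card B = dim L" "span B = L"
    using orthonormal_basis_subspace[OF assms(3)] by blast
  have fin: "finite B" using independent_imp_finite[OF B(4)] .
  \<comment> \<open>Two points of one cell are within \<open>dim L / N\<close>, at most
    \<open>1 / 2 ^ j\<close> by this choice; \<open>Suc\<close> keeps \<open>N\<close> positive for
    \<open>dim L = 0\<close>.\<close>
  define N where "N = real (Suc (dim L)) * 2 ^ j"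
  have N: "0 < N" by (simp add: N_def)
  define T where "T = \<lceil>N * R\<rceil>"
  define F where "F = (\<Pi>\<^sub>E b\<in>B. {- T - 1..T})"
  define c where "c v = restrict (\<lambda>b. \<lfloor>N * (v \<bullet> b)\<rfloor>) B" for v :: 'b
  have "c v \<in> F" if "v \<in> P" for v
    unfolding F_def c_def
  proof (rule restrict_PiE_iff[THEN iffD2], rule ballI)
    fix b assume b: "b \<in> B"
    have "\<bar>v \<bullet> b\<bar> \<le> R" using Cauchy_Schwarz_ineq2[of v b] B(3)[OF b] bd(1)[OF that] by simp
    then have "N * \<bar>v \<bullet> b\<bar> \<le> N * R" using N by (intro mult_left_mono) auto
    then have "\<bar>N * (v \<bullet> b)\<bar> \<le> N * R" using N by (simp add: abs_mult)
    then have "N * (v \<bullet> b) \<le> of_int T" "- of_int T \<le> N * (v \<bullet> b)"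
      using le_of_int_ceiling[of "N * R"] unfolding T_def by linarith+
    then show "\<lfloor>N * (v \<bullet> b)\<rfloor> \<in> {- T - 1..T}" by (simp add: floor_le_iff le_floor_iff; linarith)
  qed
  moreover have "inj_on c P"
  proof (rule inj_onI, rule ccontr)
    fix v w assume vw: "v \<in> P" "w \<in> P" "c v = c w" "v \<noteq> w"
    have *: "\<bar>(v - w) \<bullet> b\<bar> \<le> 1 / N" if b: "b \<in> B" for b
    proof -
      have "\<lfloor>N * (v \<bullet> b)\<rfloor> = \<lfloor>N * (w \<bullet> b)\<rfloor>" using vw(3) b by (metis c_def restrict_apply')
      then have "\<bar>N * (v \<bullet> b) - N * (w \<bullet> b)\<bar> \<le> 1" by linarith
      then have "N * \<bar>(v - w) \<bullet> b\<bar> \<le> 1"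
        using N by (metis abs_mult abs_of_pos inner_diff_left right_diff_distrib)
      then show ?thesis using N by (simp add: field_simps)
    qed
    have "v - w \<in> L" using vw(1,2) assms(2,3) subspace_diff by blast
    then have "v - w = (\<Sum>b\<in>B. ((v - w) \<bullet> b) *\<^sub>R b)"
    proof -
      assume "v - w \<in> L"
      then have "v - w \<in> span B" using B(6) by simp
      then obtain u where u: "v - w = (\<Sum>b\<in>B. u b *\<^sub>R b)" using span_finite[OF fin] by auto
      have "(v - w) \<bullet> b = u b" if "b \<in> B" for b
        unfolding u by (rule inner_grid[OF fin B(2,3) that])
      then show ?thesis using u by simp
    qed
    then have "norm (v - w) \<le> (\<Sum>b\<in>B. norm (((v - w) \<bullet> b) *\<^sub>R b))" by (metis norm_sum)
    also have "\<dots> \<le> (\<Sum>b\<in>B. 1 / N)"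
      by (rule sum_mono) (use * B(3) in auto)
    also have "\<dots> = real (dim L) / (real (Suc (dim L)) * 2 ^ j)" by (simp add: B(5) N_def)
    also have "\<dots> = real (dim L) / real (Suc (dim L)) * (1 / 2 ^ j)" by simp
    also have "\<dots> \<le> 1 * (1 / 2 ^ j)" by (intro mult_right_mono) auto
    finally have "norm (v - w) \<le> 1 / 2 ^ j" by simp
    then show False using sep[OF vw(1,2,4)] by linarith
  qed
  moreover have finF: "finite F" unfolding F_def using fin by (intro finite_PiE) auto
  ultimately have "card P \<le> card F" by (metis card_inj_on_le image_subsetI)
  then have "real (card P) \<le> real (card F)" by simp
  also have "\<dots> = real (nat (2 * T + 2)) ^ dim L"
    by (simp add: F_def card_PiE[OF fin] B(5) add.commute)
  also have "\<dots> \<le> ((2 * R * real (Suc (dim L)) + 4) * 2 ^ j) ^ dim L"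
  proof (rule power_mono)
    have "0 \<le> N * R" using N bd(2) by simp
    then have "0 \<le> T" "of_int T \<le> N * R + 1" unfolding T_def by linarith+
    have "(1::real) \<le> 2 ^ j" by simp
    then have "N * R + N * R + 4 \<le> (2 * R * real (Suc (dim L)) + 4) * 2 ^ j"
    proof -
      have "2 * R * real (Suc (dim L)) * 2 ^ j = N * R + N * R"
        unfolding N_def by (simp only: mult_ac mult_2[symmetric])
      then show ?thesis using \<open>(1::real) \<le> 2 ^ j\<close> unfolding distrib_right by linarith
    qed
    moreover have "real (nat (2 * T + 2)) = 2 * of_int T + 2" using \<open>0 \<le> T\<close> by simp
    ultimately show "real (nat (2 * T + 2)) \<le> (2 * R * real (Suc (dim L)) + 4) * 2 ^ j"
      using \<open>of_int T \<le> N * R + 1\<close> by linarith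
  qed simp
  also have "\<dots> = (2 * R * real (Suc (dim L)) + 4) ^ dim L * 2 ^ (j * dim L)"
    by (simp add: power_mult_distrib power_mult)
  finally show ?thesis .
qed

lemma hnorm_vertical: "hnorm (Heis 0 t) = sqrt \<bar>t\<bar>"
proof (rule power_eq_imp_eq_base)
  have "sqrt \<bar>t\<bar> ^ 4 = ((sqrt \<bar>t\<bar>)\<^sup>2)\<^sup>2" by (simp only: flip: power_mult) simp
  then show "hnorm (Heis 0 t) ^ 4 = sqrt \<bar>t\<bar> ^ 4" by (simp add: hnorm_pow4)
qed (auto simp: hnorm_nonneg)

lemma hnorm_horizontal: "hnorm (Heis x 0) = norm x"
  by (rule power_eq_imp_eq_base[of _ 4]) (auto simp: hnorm_nonneg hnorm_pow4)

text \<open>A vertical step of \<open>1 / 4 ^ j\<close> has length \<open>1 / 2 ^ j\<close>, as the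
  norm takes a square root of \<open>vert\<close>. The \<open>4 ^ j\<close> levels account for the 2
  in the homogeneous dimension \<open>dim L + 2\<close>.\<close>

lemma vertical_grid:
  fixes L :: "(real ^ ('n::finite + 'n)) set"
  assumes "subspace L"
  shows "\<exists>P. finite P \<and> P \<subseteq> vert_group L \<and> card P = 2 ^ (j * (dim L + 2)) \<and>
     (\<forall>p\<in>P. hnorm p \<le> real (dim L) + 1) \<and> (\<forall>p\<in>P. \<forall>q\<in>P. p \<noteq> q \<longrightarrow> 1 / 2 ^ j \<le> dist p q)"
proof -
  obtain G where G: "finite G" "G \<subseteq> L" "card G = 2 ^ (j * dim L)"
    "\<And>v. v \<in> G \<Longrightarrow> norm v \<le> real (dim L)"
    "\<And>v w. v \<in> G \<Longrightarrow> w \<in> G \<Longrightarrow> v \<noteq> w \<Longrightarrow> 1 / 2 ^ j \<le> norm (v - w)"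
    using subspace_grid[OF assms, of j] by auto
  define h where "h = (\<lambda>(v :: real ^ ('n + 'n), k::nat). Heis v (real k / 4 ^ j))"
  let ?S = "G \<times> {..<(4::nat) ^ j}"
  have sep: "1 / 2 ^ j \<le> dist (h x) (h y)" if xy: "x \<in> ?S" "y \<in> ?S" "x \<noteq> y" for x y
  proof -
    obtain v k w l where x: "x = (v, k)" and y: "y = (w, l)" by (metis surj_pair)
    show ?thesis
    proof (cases "v = w")
      case False
      then have "1 / 2 ^ j \<le> norm (w - v)" using G(5)[of w v] xy x y by auto
      also have "\<dots> \<le> dist (h x) (h y)" using norm_hor_diff_le[of "h y" "h x"] by (simp add: h_def x y)
      finally show ?thesis .
    next
      case True
      then have kl: "k \<noteq> l" using xy(3) x y by simp
      have "hinv (h x) \<odot> h y = Heis 0 ((real l - real k) / 4 ^ j)"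
        by (simp add: h_def x y True heis_eq_iff hform_simps diff_divide_distrib)
      then have d: "dist (h x) (h y) = sqrt \<bar>(real l - real k) / 4 ^ j\<bar>"
        by (simp only: dist_heis_alt hnorm_vertical)
      have "(1 / 2 ^ j)\<^sup>2 = 1 / (4::real) ^ j"
        by (simp add: power_divide power2_eq_square flip: power_mult_distrib)
      also have "\<dots> \<le> \<bar>(real l - real k) / 4 ^ j\<bar>"
        unfolding abs_divide using kl by (simp add: divide_right_mono)
      finally show ?thesis unfolding d by (rule real_le_rsqrt)
    qed
  qed
  have inj: "inj_on h ?S"
  proof (rule inj_onI, rule ccontr)
    fix x y assume *: "x \<in> ?S" "y \<in> ?S" "h x = h y" "x \<noteq> y"
    have "dist (h x) (h y) = 0" "(0::real) < 1 / 2 ^ j" using *(3) by simp_all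
    then show False using sep[OF *(1,2,4)] by linarith
  qed
  have "hnorm (h x) \<le> real (dim L) + 1" if "x \<in> ?S" for x
  proof -
    obtain v k where x: "x = (v, k)" by (metis surj_pair)
    have "k < 4 ^ j" using that x by simp
    then have "real k \<le> 4 ^ j" by (metis less_imp_le of_nat_le_iff of_nat_numeral of_nat_power)
    then have "\<bar>real k / 4 ^ j\<bar> \<le> 1" by simp
    then have "sqrt \<bar>real k / 4 ^ j\<bar> \<le> 1" by (metis real_sqrt_le_1_iff)
    moreover have "hnorm (h x) \<le> norm v + sqrt \<bar>real k / 4 ^ j\<bar>"
      using hnorm_le[of "h x"] by (simp only: h_def x prod.case heis.sel)
    moreover have "norm v \<le> real (dim L)" using G(4)[of v] that x by simp
    ultimately show ?thesis by linarith
  qed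
  moreover have "card (h ` ?S) = 2 ^ (j * (dim L + 2))"
  proof -
    have e: "(4::nat) ^ j = 2 ^ (j * 2)" by (simp add: power_mult power2_eq_square flip: power_mult_distrib)
    show ?thesis
      unfolding card_image[OF inj] card_cartesian_product G(3) card_lessThan
      unfolding e by (simp only: distrib_left power_add)
  qed
  moreover have "h ` ?S \<subseteq> vert_group L" using G(2) by (auto simp: h_def vert_group_def)
  moreover have "finite (h ` ?S)" using G(1) by simp
  moreover have "\<forall>p\<in>h ` ?S. \<forall>q\<in>h ` ?S. p \<noteq> q \<longrightarrow> 1 / 2 ^ j \<le> dist p q" using sep by blast
  ultimately show ?thesis by blast
qed

lemma horizontal_grid:
  fixes L :: "(real ^ ('n::finite + 'n)) set"
  assumes "subspace L"
  shows "\<exists>P. finite P \<and> P \<subseteq> hor_group L \<and> card P = 2 ^ (j * dim L) \<and>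
     (\<forall>p\<in>P. hnorm p \<le> real (dim L) + 1) \<and> (\<forall>p\<in>P. \<forall>q\<in>P. p \<noteq> q \<longrightarrow> 1 / 2 ^ j \<le> dist p q)"
proof -
  obtain G where G: "finite G" "G \<subseteq> L" "card G = 2 ^ (j * dim L)"
    "\<And>v. v \<in> G \<Longrightarrow> norm v \<le> real (dim L)"
    "\<And>v w. v \<in> G \<Longrightarrow> w \<in> G \<Longrightarrow> v \<noteq> w \<Longrightarrow> 1 / 2 ^ j \<le> norm (v - w)"
    using subspace_grid[OF assms, of j] by auto
  define h where "h v = Heis v 0" for v :: "real ^ ('n + 'n)"
  have sep: "1 / 2 ^ j \<le> dist (h v) (h w)" if "v \<in> G" "w \<in> G" "v \<noteq> w" for v w
    using G(5)[of w v] that norm_hor_diff_le[of "h w" "h v"] by (simp add: h_def)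
  have "inj_on h G" by (auto simp: inj_on_def h_def)
  then have "card (h ` G) = 2 ^ (j * dim L)" using G(3) by (simp add: card_image)
  moreover have "h ` G \<subseteq> hor_group L" using G(2) by (auto simp: h_def hor_group_def)
  moreover have "hnorm (h v) \<le> real (dim L) + 1" if "v \<in> G" for v
    using G(4)[OF that] by (simp add: h_def hnorm_horizontal)
  ultimately show ?thesis
    using sep G(1) by (intro exI[of _ "h ` G"]) auto
qed

context ad_riesz
begin

text \<open>Separated points of \<open>X\<close> are close to views of points of \<open>E\<close>,
  around which disjoint balls have mass bounded below. Upper regularity of one ball containing them
  all limits their number to a multiple of \<open>2 ^ (j * m)\<close>.\<close>

lemma tangent_packing:
  assumes X: "X \<in> tangents" and R: "1 \<le> R"
    and P: "\<And>j. \<exists>P. finite P \<and> P \<subseteq> X \<and> card P = 2 ^ (j * D) \<and>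
     (\<forall>p\<in>P. hnorm p \<le> R) \<and> (\<forall>p\<in>P. \<forall>q\<in>P. p \<noteq> q \<longrightarrow> 1 / 2 ^ j \<le> dist p q)"
  shows "D \<le> m"
proof (rule nat_power_growth)
  fix j :: nat
  define s where "s = 1 / (2::real) ^ j"
  have s: "0 < s" "s \<le> 1" by (auto simp: s_def)
  obtain P where P: "finite P" "P \<subseteq> X" "card P = 2 ^ (j * D)" and PR: "\<forall>p\<in>P. hnorm p \<le> R"
    and sep: "\<forall>p\<in>P. \<forall>q\<in>P. p \<noteq> q \<longrightarrow> s \<le> dist p q"
    using P[of j] unfolding s_def by (elim exE conjE)
  obtain p l where pl: "p \<in> E" "R \<le> l" "inside X (view p l ` E) (s/8) R"
  proof -
    have "0 < s/8" "0 < R" using s R by auto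
    from tangentsD[OF X this] show ?thesis using that by blast
  qed
  have l: "0 < l" "1 \<le> l" using pl(2) R by auto
  have "\<forall>x\<in>P. \<exists>y\<in>E. dist x (view p l y) \<le> s/8" using insideD[OF pl(3)] P(2) PR by blast
  then obtain y where y: "\<And>x. x \<in> P \<Longrightarrow> y x \<in> E" "\<And>x. x \<in> P \<Longrightarrow> dist x (view p l (y x)) \<le> s/8" by metis
  \<comment> \<open>Magnified, the balls have radius \<open>s/4\<close>; with the error
    \<open>s/8\<close> two of them could meet only if their points of \<open>P\<close> were within
    \<open>3/4 * s\<close>.\<close>
  let ?r = "s / (4 * l)"
  let ?B = "\<lambda>x. cball (y x) ?r"
  have r: "0 < ?r" "?r \<le> 1" using s l by (auto simp: field_simps)
  have near: "dist x (view p l z) \<le> s/8 + s/4" if "x \<in> P" "z \<in> ?B x" for x z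
  proof -
    have "l * dist (y x) z \<le> l * ?r" using that(2) l by (intro mult_left_mono) auto
    then have "dist (view p l (y x)) (view p l z) \<le> s / 4" using l by (simp add: dist_view)
    then show ?thesis using y(2)[OF that(1)] dist_triangle[of x "view p l z" "view p l (y x)"] by linarith
  qed
  have disj: "disjoint_family_on ?B P"
    unfolding disjoint_family_on_def
  proof (intro ballI impI, rule ccontr)
    fix a b assume ab: "a \<in> P" "b \<in> P" "a \<noteq> b" "?B a \<inter> ?B b \<noteq> {}"
    then obtain z where "z \<in> ?B a" "z \<in> ?B b" by blast
    then have "dist a (view p l z) \<le> s/8 + s/4" "dist b (view p l z) \<le> s/8 + s/4" using near ab by blast+
    then have "dist a b \<le> 3/4 * s" using dist_triangle2[of a b "view p l z"] by linarith
    then show False using sep[rule_format, OF ab(1-3)] s by linarith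
  qed
  have sub: "?B x \<subseteq> cball p (2 * R / l)" if x: "x \<in> P" for x
  proof
    fix z assume "z \<in> ?B x"
    then have "hnorm (view p l z) \<le> R + (s/8 + s/4)"
      using near[OF x] PR[rule_format, OF x] hnorm_le_add_dist[of "view p l z" x] by (meson add_mono order_trans)
    then have "l * dist p z \<le> 2 * R" using l s R by (simp add: hnorm_view)
    then show "z \<in> cball p (2 * R / l)" using l by (simp add: pos_le_divide_eq mult.commute)
  qed
  have "real (card P) * (c0 * ?r ^ m) \<le> (\<Sum>x\<in>P. measure \<mu> (?B x))"
    by (rule sum_bounded_below) (use lower[OF _ r] y(1) E_sub in auto)
  also have "\<dots> = measure \<mu> (\<Union>x\<in>P. ?B x)"
    by (rule finite_measure_finite_Union[symmetric, OF P(1) _ disj]) auto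
  also have "\<dots> \<le> measure \<mu> (cball p (2 * R / l))"
    by (rule finite_measure_mono) (use sub in auto)
  also have "\<dots> \<le> C0 * (2 * R / l) ^ m" using upper[of p "2 * R / l"] pl(1) E_sub l R by auto
  finally have "real (card P) * (c0 * ?r ^ m) \<le> C0 * (2 * R / l) ^ m" .
  then have "real (card P) * c0 * s ^ m / (4 ^ m * l ^ m) \<le> C0 * (2 * R) ^ m / l ^ m"
    by (simp add: power_divide power_mult_distrib)
  then have "real (card P) * c0 * s ^ m \<le> C0 * (2 * R) ^ m * 4 ^ m"
    using l by (simp add: field_simps)
  then have "real (card P) * s ^ m \<le> C0 * (2 * R) ^ m * 4 ^ m / c0"
    using c0 by (simp add: field_simps)
  then have "2 ^ (j * D) * s ^ m \<le> C0 * (2 * R) ^ m * 4 ^ m / c0" by (simp add: P(3))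
  then show "(2::real) ^ (j * D) \<le> (C0 * (2 * R) ^ m * 4 ^ m / c0) * 2 ^ (j * m)"
    by (simp add: s_def power_divide power_mult field_simps)
qed

lemma dim_vert_group:
  assumes "vert_group L \<in> tangents" "subspace L"
  shows "dim L + 2 \<le> m"
  by (rule tangent_packing[OF assms(1), of "real (dim L) + 1"]) (use vertical_grid[OF assms(2)] in auto)

lemma dim_hor_group:
  assumes "hor_group L \<in> tangents" "subspace L"
  shows "dim L \<le> m"
  by (rule tangent_packing[OF assms(1), of "real (dim L) + 1"]) (use horizontal_grid[OF assms(2)] in auto)

text \<open>On a translate of an isotropic horizontal group the metric is the Euclidean one of
  \<open>L\<close>. A net of \<open>K\<close> at scale \<open>1 / 2 ^ j\<close> thus has at most a
  multiple of \<open>2 ^ (j * dim L)\<close> points, while the balls around it carry the positive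
  mass of \<open>K\<close>.\<close>

lemma dim_isotropic_ge:
  assumes L: "subspace L" "\<And>x y. x \<in> L \<Longrightarrow> y \<in> L \<Longrightarrow> hform x y = 0"
    and KL: "K \<subseteq> (\<lambda>p. a \<odot> p) ` hor_group L"
  shows "m \<le> dim L"
proof -
  define v where "v p = hor (hinv a \<odot> p)" for p
  have vK: "v p \<in> L" "vert (hinv a \<odot> p) = 0" if p: "p \<in> K" for p
  proof -
    obtain h where h: "h \<in> hor_group L" "p = a \<odot> h" using KL p by blast
    have "hinv a \<odot> p = h" unfolding h(2) by (rule hinv_cancel(1))
    then show "v p \<in> L" "vert (hinv a \<odot> p) = 0" using h(1) by (auto simp: v_def hor_group_def)
  qed
  have dv: "dist p q = norm (v p - v q)" if p: "p \<in> K" and q: "q \<in> K" for p q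
  proof -
    have "dist p q = dist (hinv a \<odot> p) (hinv a \<odot> q)" by simp
    moreover have "hinv (hinv a \<odot> p) \<odot> (hinv a \<odot> q) = Heis (v q - v p) 0"
    proof -
      have "vert (hinv (hinv a \<odot> p) \<odot> (hinv a \<odot> q)) =
          vert (hinv a \<odot> q) - vert (hinv a \<odot> p) + hform (- v p) (v q)"
        unfolding v_def hmult_sel(2)[of "hinv (hinv a \<odot> p)"] hinv_sel[of "hinv a \<odot> p"] by simp
      also have "\<dots> = 0" using L(2) vK p q by (simp add: hform_simps)
      finally have "vert (hinv (hinv a \<odot> p) \<odot> (hinv a \<odot> q)) = 0" .
      moreover have "hor (hinv (hinv a \<odot> p) \<odot> (hinv a \<odot> q)) = v q - v p" by (simp add: v_def)
      ultimately show ?thesis unfolding heis_eq_iff by simp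
    qed
    ultimately show ?thesis by (simp only: dist_heis_alt hnorm_horizontal norm_minus_commute[of "v p"])
  qed
  have "bounded K" using compact_K by (rule compact_imp_bounded)
  then obtain R where R: "\<And>p. p \<in> K \<Longrightarrow> dist a p \<le> R" using bounded_any_center[of K a] by blast
  have vR: "norm (v p) \<le> \<bar>R\<bar>" if "p \<in> K" for p
    using norm_hor_le_hnorm[of "hinv a \<odot> p"] R[OF that] by (simp add: v_def dist_heis_alt)
  have "emeasure \<mu> (closure E) \<le> emeasure \<mu> K"
    by (rule emeasure_mono[OF closure_E_sub]) (simp add: borel_closed compact_imp_closed compact_K)
  then have "emeasure \<mu> K \<noteq> 0" using E_pos by auto
  then have MK: "0 < measure \<mu> K" using measure_nonneg[of \<mu> K] by (auto simp: emeasure_eq_measure less_le)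
  define C where "C = (2 * \<bar>R\<bar> * real (Suc (dim L)) + 4) ^ dim L"
  have "(2::real) ^ (j * m) \<le> (C * C0 / measure \<mu> K) * 2 ^ (j * dim L)" for j
  proof -
    define s where "s = 1 / (2::real) ^ j"
    have s: "0 < s" by (simp add: s_def)
    obtain P where P: "finite P" "P \<subseteq> K" "pairwise (\<lambda>p q. s < dist p q) P" "K \<subseteq> (\<Union>p\<in>P. cball p s)"
      using separated_net[OF compact_K subset_refl s] by (elim exE conjE)
    have sep: "s < norm (v p - v q)" if "p \<in> P" "q \<in> P" "p \<noteq> q" for p q
    proof -
      have "p \<in> K" "q \<in> K" using that P(2) by blast+
      moreover have "s < dist p q" using P(3) that unfolding pairwise_def by blast
      ultimately show ?thesis by (simp only: dv)
    qed
    have "inj_on v P"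
    proof (rule inj_onI, rule ccontr)
      fix p q assume "p \<in> P" "q \<in> P" "v p = v q" "p \<noteq> q"
      then show False using sep[of p q] s by simp
    qed
    then have "real (card P) = real (card (v ` P))" by (simp add: card_image)
    also have "\<dots> \<le> C * 2 ^ (j * dim L)"
      unfolding C_def
    proof (rule separated_card_le[OF _ _ L(1)])
      show "1 / 2 ^ j < norm (x - y)" if "x \<in> v ` P" "y \<in> v ` P" "x \<noteq> y" for x y
        using that sep unfolding s_def by blast
    qed (use P vK vR in auto)
    finally have card: "real (card P) \<le> C * 2 ^ (j * dim L)" .
    have "measure \<mu> K \<le> measure \<mu> (\<Union>p\<in>P. cball p s)"
      by (rule finite_measure_mono[OF P(4)]) (use P(1) in \<open>auto intro!: borel_closed closed_UN\<close>)
    also have "\<dots> \<le> (\<Sum>p\<in>P. measure \<mu> (cball p s))"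
      by (rule finite_measure_subadditive_finite[OF P(1)]) auto
    also have "\<dots> \<le> (\<Sum>p\<in>P. C0 * s ^ m)" by (rule sum_mono) (use upper[OF _ s] P(2) in auto)
    also have "\<dots> = real (card P) * (C0 * s ^ m)" by simp
    also have "\<dots> \<le> C * 2 ^ (j * dim L) * (C0 * s ^ m)"
      using card C0 s by (intro mult_right_mono) auto
    finally have "measure \<mu> K \<le> C * 2 ^ (j * dim L) * C0 / 2 ^ (j * m)"
      by (simp add: s_def power_divide power_mult)
    then show ?thesis using MK by (simp add: field_simps)
  qed
  then show ?thesis by (rule nat_power_growth)
qed

end

section \<open>Hausdorff measure under similarities\<close>

lemma diameter_le_dist:
  fixes A :: "'a::metric_space set"
  assumes "A \<noteq> {}" "\<And>x y. x \<in> A \<Longrightarrow> y \<in> A \<Longrightarrow> dist x y \<le> d"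
  shows "diameter A \<le> d"
  using assms by (auto simp: diameter_def intro!: cSUP_least)

text \<open>Images of a cover form a cover with diameters multiplied by at most \<open>c\<close>.
  The factor \<open>c ^ m\<close> is divided out on the left, so that the infimum over covers can be
  bounded directly.\<close>

lemma hausdorff_outer_lipschitz_image:
  fixes f :: "'a::metric_space \<Rightarrow> 'b::metric_space"
  assumes c: "0 < c" and lip: "\<And>x y. dist (f x) (f y) \<le> c * dist x y"
  shows "hausdorff_outer m (f ` A) \<le> ennreal (c ^ m) * hausdorff_outer m A"
proof -
  have one: "ennreal (1 / c ^ m) * ennreal (c ^ m) = 1"
    using c by (simp add: ennreal_mult[symmetric])
  have dia: "bounded (f ` U) \<and> diameter (f ` U) \<le> c * diameter U" if "bounded U" for U
  proof -
    have *: "dist (f x) (f y) \<le> c * diameter U" if "x \<in> U" "y \<in> U" for x y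
      using lip[of x y] mult_left_mono[OF diameter_bounded_bound[OF \<open>bounded U\<close> that], of c] c by linarith
    show ?thesis
    proof (cases "U = {}")
      case False
      then obtain x where "x \<in> U" by blast
      then have "bounded (f ` U)" using * unfolding bounded_def by blast
      moreover have "diameter (f ` U) \<le> c * diameter U"
        by (rule diameter_le_dist) (use False * in auto)
      ultimately show ?thesis by blast
    qed simp
  qed
  have "hausdorff_premeasure m \<delta> (f ` A) \<le> ennreal (c ^ m) * hausdorff_outer m A" if \<delta>: "0 < \<delta>" for \<delta>
  proof -
    have "ennreal (1 / c ^ m) * hausdorff_premeasure m \<delta> (f ` A) \<le> hausdorff_premeasure m (\<delta> / c) A"
      unfolding hausdorff_premeasure_def[of m "\<delta> / c"]
    proof (rule INF_greatest)
      fix U assume U: "U \<in> hausdorff_covers (\<delta> / c) A"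
      have V: "(\<lambda>i. f ` U i) \<in> hausdorff_covers \<delta> (f ` A)"
        unfolding hausdorff_covers_def
      proof (intro CollectI conjI allI)
        have "A \<subseteq> (\<Union>i. U i)" using U by (simp add: hausdorff_covers_def)
        then show "f ` A \<subseteq> (\<Union>i. f ` U i)" by blast
        fix i
        have b: "bounded (U i)" "diameter (U i) \<le> \<delta> / c" using U by (auto simp: hausdorff_covers_def)
        then have "c * diameter (U i) \<le> \<delta>" using c by (simp add: pos_le_divide_eq mult.commute)
        then show "bounded (f ` U i)" "diameter (f ` U i) \<le> \<delta>" using dia[OF b(1)] by linarith+
      qed
      have w: "hausdorff_weight m (f ` U i) \<le> ennreal (c ^ m) * hausdorff_weight m (U i)" for i
      proof (cases "U i = {}")
        case False
        have b: "bounded (U i)" using U by (auto simp: hausdorff_covers_def)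
        have "diameter (f ` U i) ^ m \<le> (c * diameter (U i)) ^ m"
          using dia[OF b] diameter_ge_0[of "f ` U i"] by (intro power_mono) auto
        then have "ennreal (diameter (f ` U i) ^ m) \<le> ennreal (c ^ m * diameter (U i) ^ m)"
          by (intro ennreal_leI) (simp add: power_mult_distrib)
        then show ?thesis
          using False c diameter_ge_0[OF b] by (simp add: hausdorff_weight_def ennreal_mult)
      qed simp
      have "hausdorff_premeasure m \<delta> (f ` A) \<le> (\<Sum>i. hausdorff_weight m (f ` U i))"
        by (rule hausdorff_premeasure_le[OF V])
      also have "\<dots> \<le> (\<Sum>i. ennreal (c ^ m) * hausdorff_weight m (U i))"
        by (intro suminf_le allI w) auto
      also have "\<dots> = ennreal (c ^ m) * (\<Sum>i. hausdorff_weight m (U i))" by simp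
      finally have "ennreal (1 / c ^ m) * hausdorff_premeasure m \<delta> (f ` A)
          \<le> ennreal (1 / c ^ m) * (ennreal (c ^ m) * (\<Sum>i. hausdorff_weight m (U i)))"
        by (rule mult_left_mono) simp
      then show "ennreal (1 / c ^ m) * hausdorff_premeasure m \<delta> (f ` A) \<le> (\<Sum>i. hausdorff_weight m (U i))"
        unfolding mult.assoc[symmetric] one by simp
    qed
    also have "\<dots> \<le> hausdorff_outer m A"
      unfolding hausdorff_outer_def by (rule SUP_upper) (use \<delta> c in simp)
    finally have "ennreal (c ^ m) * (ennreal (1 / c ^ m) * hausdorff_premeasure m \<delta> (f ` A))
        \<le> ennreal (c ^ m) * hausdorff_outer m A"
      by (rule mult_left_mono) simp
    moreover have "ennreal (c ^ m) * ennreal (1 / c ^ m) = 1" using one by (simp add: mult.commute)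
    ultimately show ?thesis unfolding mult.assoc[symmetric] by simp
  qed
  then show ?thesis unfolding hausdorff_outer_def[of m "f ` A"] by (intro SUP_least) simp
qed

section \<open>Self-similar sets\<close>

text \<open>Left translations and dilations carry every ball to one about the origin, so one compact
  ball supplies a bound for all centres and scales.\<close>

lemma heis_packing:
  fixes R s :: real
  assumes "0 < s"
  shows "\<exists>N::nat. \<forall>(p::'n::finite heis) t P. 0 < t \<longrightarrow> finite P \<longrightarrow> P \<subseteq> cball p (R * t) \<longrightarrow>
     pairwise (\<lambda>x y. s * t \<le> dist x y) P \<longrightarrow> card P \<le> N"
proof -
  have "compact (cball (hzero :: 'n heis) R)" by (simp add: compact_eq_bounded_closed)
  then obtain N :: nat where N: "\<And>P. finite P \<Longrightarrow> P \<subseteq> cball (hzero :: 'n heis) R \<Longrightarrow>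
      pairwise (\<lambda>p q. s \<le> dist p q) P \<Longrightarrow> card P \<le> N"
    using separated_card_bound[OF _ assms] by metis
  have "card P \<le> N" if P: "0 < t" "finite P" "P \<subseteq> cball p (R * t)" "pairwise (\<lambda>x y. s * t \<le> dist x y) P"
    for p :: "'n heis" and t P
  proof -
    let ?v = "view p (1 / t)"
    have d: "dist (?v x) (?v y) = dist x y / t" for x y using P(1) by (simp add: dist_view)
    have "inj_on ?v P"
    proof (rule inj_onI)
      fix x y assume "?v x = ?v y"
      then have "dist x y / t = 0" using d[of x y] by simp
      then show "x = y" using P(1) by simp
    qed
    moreover have "card (?v ` P) \<le> N"
    proof (rule N)
      show "?v ` P \<subseteq> cball hzero R"
        using P(1,3) by (auto simp: hnorm_view pos_divide_le_eq)
      show "pairwise (\<lambda>p q. s \<le> dist p q) (?v ` P)"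
        using P(1,4) by (auto simp: pairwise_def d pos_le_divide_eq)
    qed (use P in simp)
    ultimately show ?thesis by (simp add: card_image)
  qed
  then show ?thesis by blast
qed

text \<open>The index type is general so that systems indexed by \<open>{1..N}\<close> and the
  Cantor systems, indexed by pairs, are both instances.\<close>

locale heis_ifs =
  fixes I :: "'i set" and S :: "'i \<Rightarrow> 'n::finite heis \<Rightarrow> 'n heis" and q :: "'i \<Rightarrow> 'n heis" and r :: "'i \<Rightarrow> real"
  assumes finite_I: "finite I" and I_nonempty: "I \<noteq> {}"
    and S_eq: "\<And>i. i \<in> I \<Longrightarrow> S i = htrans (q i) \<circ> hdil (r i)"
    and r: "\<And>i. i \<in> I \<Longrightarrow> 0 < r i" "\<And>i. i \<in> I \<Longrightarrow> r i < 1"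
begin

lemma S_apply: "i \<in> I \<Longrightarrow> S i p = q i \<odot> hdil (r i) p"
  by (simp add: S_eq htrans_def)

lemma dist_S: "i \<in> I \<Longrightarrow> dist (S i x) (S i y) = r i * dist x y"
  using r(1)[of i] by (simp add: S_apply dist_hdil less_imp_le)

lemma inj_S: "i \<in> I \<Longrightarrow> inj (S i)"
proof (rule injI)
  fix x y assume i: "i \<in> I" and "S i x = S i y"
  then have "r i * dist x y = 0" using dist_S[OF i, of x y] by simp
  then show "x = y" using r(1)[OF i] by simp
qed

lemma continuous_S: "i \<in> I \<Longrightarrow> continuous_on A (S i)"
proof -
  assume "i \<in> I"
  then have "S i = (\<lambda>p. q i \<odot> hdil (r i) p)" by (simp add: fun_eq_iff S_apply)
  then show ?thesis by (simp add: continuous_on_hmult continuous_on_heis)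
qed

definition rmax :: real where "rmax = Max (r ` I)"
definition rmin :: real where "rmin = Min (r ` I)"

lemma rmax: "0 < rmax" "rmax < 1" "i \<in> I \<Longrightarrow> r i \<le> rmax"
  using finite_I I_nonempty r unfolding rmax_def by (auto simp: Max_gr_iff)

lemma rmin: "0 < rmin" "rmin < 1" "i \<in> I \<Longrightarrow> rmin \<le> r i"
proof -
  show "0 < rmin" using finite_I I_nonempty r unfolding rmin_def by (auto simp: Min_gr_iff)
  show le: "i \<in> I \<Longrightarrow> rmin \<le> r i" for i using finite_I unfolding rmin_def by auto
  obtain i where "i \<in> I" using I_nonempty by blast
  then show "rmin < 1" using le[of i] r(2)[of i] by linarith
qed

text \<open>The iterated images of a ball that the system maps into itself decrease to an invariant
  set.\<close>

lemma invariant_set_exists: "\<exists>K. is_invariant_set I S K"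
proof -
  \<comment> \<open>Ensures \<open>hnorm (S i hzero) + r i * \<rho> \<le> \<rho>\<close> for every
    \<open>i\<close>, so the ball of radius \<open>\<rho>\<close> is mapped into itself.\<close>
  define \<rho> where "\<rho> = Max ((\<lambda>i. hnorm (S i hzero) / (1 - r i)) ` I)"
  have \<rho>: "hnorm (S i hzero) \<le> (1 - r i) * \<rho>" if "i \<in> I" for i
  proof -
    have "hnorm (S i hzero) / (1 - r i) \<le> \<rho>" unfolding \<rho>_def using finite_I that by simp
    then show ?thesis using r(2)[OF that] by (simp add: pos_divide_le_eq mult.commute)
  qed
  have \<rho>0: "0 \<le> \<rho>"
  proof -
    obtain i where i: "i \<in> I" using I_nonempty by blast
    then have "0 \<le> (1 - r i) * \<rho>" using \<rho>[OF i] hnorm_nonneg[of "S i hzero"] by linarith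
    then show ?thesis using r(2)[OF i] by (simp add: zero_le_mult_iff)
  qed
  define H where "H A = (\<Union>i\<in>I. S i ` A)" for A
  define B where "B n = (H ^^ n) (cball hzero \<rho>)" for n
  have mono: "A \<subseteq> A' \<Longrightarrow> H A \<subseteq> H A'" for A A' by (auto simp: H_def)
  have B0: "H (cball hzero \<rho>) \<subseteq> cball hzero \<rho>"
  proof -
    have "hnorm (S i x) \<le> \<rho>" if i: "i \<in> I" and x: "hnorm x \<le> \<rho>" for i x
    proof -
      have "hnorm (S i x) \<le> hnorm (S i hzero) + dist (S i hzero) (S i x)" by (rule hnorm_le_add_dist)
      also have "\<dots> \<le> (1 - r i) * \<rho> + r i * \<rho>"
        unfolding dist_S[OF i] dist_hzero(1)
        by (intro add_mono \<rho>[OF i] mult_left_mono x) (use r(1)[OF i] in simp)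
      finally show ?thesis by (simp add: algebra_simps)
    qed
    then show ?thesis by (auto simp: H_def)
  qed
  have dec: "B (Suc n) \<subseteq> B n" for n
    by (induction n) (use B0 mono in \<open>auto simp: B_def\<close>)
  then have decs: "B n \<subseteq> B k" if "k \<le> n" for k n
    using lift_Suc_antimono_le[of B] that by blast
  have comp: "compact (B n)" for n
  proof (induction n)
    case 0
    show ?case by (simp add: B_def compact_eq_bounded_closed)
  next
    case (Suc n)
    have "B (Suc n) = (\<Union>i\<in>I. S i ` B n)" by (simp add: B_def H_def)
    then show ?case
      using Suc finite_I by (simp add: compact_UN compact_continuous_image[OF continuous_S])
  qed
  have ne: "B n \<noteq> {}" for n
    by (induction n) (use \<rho>0 I_nonempty in \<open>auto simp: B_def H_def intro!: exI[of _ hzero]\<close>)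
  define K where "K = (\<Inter>n. B n)"
  have "K \<noteq> {}" unfolding K_def by (rule compact_nest[OF comp ne]) (use decs in auto)
  moreover have "compact K"
    unfolding K_def using comp by (intro compact_Inter) auto
  moreover have "K = (\<Union>i\<in>I. S i ` K)"
  proof (intro equalityI subsetI)
    fix x assume x: "x \<in> K"
    have "\<exists>i\<in>I. x \<in> S i ` B n" for n
    proof -
      have "x \<in> B (Suc n)" using x unfolding K_def by blast
      then show ?thesis by (simp add: B_def H_def)
    qed
    then obtain g where g: "\<And>n. g n \<in> I" "\<And>n. x \<in> S (g n) ` B n" by metis
    \<comment> \<open>The piece containing \<open>x\<close> may depend on \<open>n\<close>. Some
      index occurs infinitely often and, as the iterates decrease, serves for all
      \<open>n\<close>.\<close>
    have "finite (range g)" using g(1) finite_I by (meson finite_subset image_subsetI)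
    then obtain i where i: "infinite {n. g n = i}" "i \<in> I"
      using inf_img_fin_dom[of g UNIV] g(1) by (auto simp: vimage_def)
    have all: "x \<in> S i ` B n" for n
    proof -
      obtain k where "n \<le> k" "g k = i" using i(1) unfolding infinite_nat_iff_unbounded_le by blast
      then show ?thesis using g(2)[of k] decs[of n k] by blast
    qed
    then obtain y where y: "y \<in> B 0" "x = S i y" by blast
    have "y \<in> B n" for n using all[of n] y(2) inj_S[OF i(2)] by (auto dest: injD)
    then show "x \<in> (\<Union>i\<in>I. S i ` K)" using y(2) i(2) by (auto simp: K_def)
  next
    fix x assume "x \<in> (\<Union>i\<in>I. S i ` K)"
    then obtain i y where iy: "i \<in> I" "y \<in> K" "x = S i y" by blast
    have "x \<in> B (Suc n)" for n using iy by (auto simp: B_def H_def K_def)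
    then have "x \<in> B n" for n using dec[of n] by blast
    then show "x \<in> K" by (simp add: K_def)
  qed
  ultimately show ?thesis unfolding is_invariant_set_def by blast
qed

text \<open>A point of \<open>K\<close> farthest from \<open>K'\<close> is the image of a point of
  \<open>K\<close> under some \<open>S i\<close>, which also maps \<open>K'\<close> into itself; so
  the largest distance is at most \<open>r i\<close> times itself.\<close>

lemma invariant_set_subset:
  assumes K: "is_invariant_set I S K" and K': "is_invariant_set I S K'"
  shows "K \<subseteq> K'"
proof -
  have cK: "compact K" "K \<noteq> {}" "K = (\<Union>i\<in>I. S i ` K)" and cK': "compact K'" "K' \<noteq> {}" "K' = (\<Union>i\<in>I. S i ` K')"
    using K K' unfolding is_invariant_set_def by blast+
  have "continuous_on K (\<lambda>x. infdist x K')" by (intro continuous_intros)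
  then obtain x where x: "x \<in> K" "\<And>y. y \<in> K \<Longrightarrow> infdist y K' \<le> infdist x K'"
    using continuous_attains_sup[OF cK(1,2)] by blast
  obtain i y where iy: "i \<in> I" "y \<in> K" "x = S i y" using x(1) cK(3) by blast
  obtain z where z: "z \<in> K'" "infdist y K' = dist y z"
    using infdist_attains_inf[OF compact_imp_closed[OF cK'(1)] cK'(2)] by blast
  have "S i z \<in> K'" using z(1) iy(1) cK'(3) by blast
  then have "infdist x K' \<le> dist x (S i z)" by (rule infdist_le)
  also have "\<dots> = r i * infdist y K'" using iy z by (simp add: dist_S)
  also have "\<dots> \<le> r i * infdist x K'" using x(2)[OF iy(2)] r(1)[OF iy(1)] by (intro mult_left_mono) auto
  finally have "(1 - r i) * infdist x K' \<le> 0" by (simp add: algebra_simps)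
  then have "infdist x K' \<le> 0" using r(2)[OF iy(1)] by (simp add: mult_le_0_iff)
  then have "infdist y K' = 0" if "y \<in> K" for y
    using x(2)[OF that] infdist_nonneg[of y K'] by linarith
  then show ?thesis
    using in_closed_iff_infdist_zero[OF compact_imp_closed[OF cK'(1)] cK'(2)] by blast
qed

lemma is_invariant_set_invariant_set: "is_invariant_set I S (invariant_set I S)"
  unfolding invariant_set_def
  by (rule theI', rule ex_ex1I[OF invariant_set_exists]) (use invariant_set_subset in blast)

abbreviation K :: "'n heis set" where "K \<equiv> invariant_set I S"

lemma K: "compact K" "K \<noteq> {}" "K = (\<Union>i\<in>I. S i ` K)"
  using is_invariant_set_invariant_set unfolding is_invariant_set_def by blast+

section \<open>Words and cells\<close>

fun word_map :: "'i list \<Rightarrow> 'n heis \<Rightarrow> 'n heis" where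
  "word_map [] p = p"
| "word_map (i # w) p = S i (word_map w p)"

definition ratio :: "'i list \<Rightarrow> real" where
  "ratio w = prod_list (map r w)"

lemma ratio_simps [simp]: "ratio [] = 1" "ratio (i # w) = r i * ratio w" "ratio (u @ v) = ratio u * ratio v"
  by (simp_all add: ratio_def)

lemma ratio_pos: "w \<in> lists I \<Longrightarrow> 0 < ratio w"
  by (induction w) (use r in auto)

lemma dist_word_map: "w \<in> lists I \<Longrightarrow> dist (word_map w x) (word_map w y) = ratio w * dist x y"
  by (induction w) (auto simp: dist_S)

lemma word_map_K: "w \<in> lists I \<Longrightarrow> x \<in> K \<Longrightarrow> word_map w x \<in> K"
  by (induction w) (use K(3) in auto)

lemma word_map_eq:
  assumes "w \<in> lists I"
  shows "\<exists>g. \<forall>p. word_map w p = g \<odot> hdil (ratio w) p"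
  using assms
proof (induction w)
  case Nil
  show ?case by (intro exI[of _ hzero]) simp
next
  case (Cons i w)
  then obtain g where g: "\<And>p. word_map w p = g \<odot> hdil (ratio w) p" by auto
  have "word_map (i # w) p = (q i \<odot> hdil (r i) g) \<odot> hdil (ratio (i # w)) p" for p
    using Cons by (simp add: S_apply g hdil_hmult hdil_hdil hmult_assoc)
  then show ?case by blast
qed

text \<open>Words stopped as soon as their ratio drops to \<open>t\<close> or below, so that their
  cells have size comparable to \<open>t\<close> for \<open>t \<le> 1\<close>. For
  \<open>t \<ge> 1\<close> only the empty word remains.\<close>

definition cut :: "real \<Rightarrow> 'i list set" where
  "cut t = {w \<in> lists I. ratio w \<le> t \<and> (\<forall>u v. w = u @ v \<longrightarrow> v \<noteq> [] \<longrightarrow> t < ratio u)}"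

lemma cutD: "w \<in> cut t \<Longrightarrow> w \<in> lists I" "w \<in> cut t \<Longrightarrow> ratio w \<le> t"
  by (auto simp: cut_def)

lemma cut_ratio_ge:
  assumes "w \<in> cut t" "t \<le> 1" "0 < t"
  shows "rmin * t \<le> ratio w"
proof (cases w rule: rev_cases)
  case Nil
  then show ?thesis using mult_mono[of rmin 1 t 1] assms rmin by simp
next
  case (snoc u i)
  then have "t < ratio u" "i \<in> I" using assms(1) by (auto simp: cut_def)
  then have "rmin * t \<le> r i * ratio u" using rmin(3)[of i] r(1)[of i] assms(3) by (intro mult_mono) auto
  then show ?thesis by (simp add: snoc mult.commute)
qed

text \<open>Removing the first letter \<open>i\<close> of an address turns the level
  \<open>t\<close> into \<open>t / r i\<close>; the induction is on a number of contractions by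
  \<open>rmax\<close> that suffices to get below \<open>t\<close>.\<close>

lemma cut_covers:
  assumes "0 < t" "p \<in> K"
  obtains w where "w \<in> cut t" "p \<in> word_map w ` K"
proof -
  have *: "\<exists>w\<in>cut t. p \<in> word_map w ` K" if "rmax ^ n \<le> t" "p \<in> K" for n t p
    using that
  proof (induction n arbitrary: t p)
    case 0
    then show ?case by (intro bexI[of _ "[]"]) (auto simp: cut_def)
  next
    case (Suc n)
    show ?case
    proof (cases "1 \<le> t")
      case True
      then show ?thesis using Suc.prems by (intro bexI[of _ "[]"]) (auto simp: cut_def)
    next
      case False
      obtain i y where iy: "i \<in> I" "y \<in> K" "p = S i y" using Suc.prems(2) K(3) by blast
      have "r i * rmax ^ n \<le> rmax * rmax ^ n" using rmax(3)[OF iy(1)] rmax(1) by (intro mult_right_mono) auto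
      then have "rmax ^ n \<le> t / r i" using Suc.prems(1) r(1)[OF iy(1)] by (simp add: pos_le_divide_eq mult.commute)
      from Suc.IH[OF this iy(2)] obtain w where w: "w \<in> cut (t / r i)" "y \<in> word_map w ` K" by blast
      have "i # w \<in> cut t"
        unfolding cut_def
      proof (intro CollectI conjI allI impI)
        show "i # w \<in> lists I" using cutD(1)[OF w(1)] iy(1) by simp
        show "ratio (i # w) \<le> t" using cutD(2)[OF w(1)] r(1)[OF iy(1)] by (simp add: pos_le_divide_eq mult.commute)
        fix u v assume uv: "i # w = u @ v" "v \<noteq> []"
        show "t < ratio u"
        proof (cases u)
          case Nil
          then show ?thesis using False by simp
        next
          case (Cons j u')
          then have "w = u' @ v" "j = i" using uv by auto
          then have "t / r i < ratio u'" using w(1) uv(2) by (auto simp: cut_def)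
          then show ?thesis using Cons \<open>j = i\<close> r(1)[OF iy(1)] by (simp add: pos_divide_less_eq mult.commute)
        qed
      qed
      moreover have "p \<in> word_map (i # w) ` K" using w(2) iy(3) by auto
      ultimately show ?thesis by blast
    qed
  qed
  obtain n where "rmax ^ n < t" using real_arch_pow_inv[OF assms(1) rmax(2)] by blast
  then show ?thesis using *[of n t p] assms(2) that by auto
qed

text \<open>Equality holds because the inverse of a word map is a similarity too, with ratio
  \<open>1 / ratio w\<close>.\<close>

lemma hausdorff_outer_word_map:
  assumes "w \<in> lists I"
  shows "hausdorff_outer m (word_map w ` A) = ennreal (ratio w ^ m) * hausdorff_outer m A"
proof (rule antisym)
  note rp = ratio_pos[OF assms]
  show "hausdorff_outer m (word_map w ` A) \<le> ennreal (ratio w ^ m) * hausdorff_outer m A"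
    by (rule hausdorff_outer_lipschitz_image[OF rp]) (simp add: dist_word_map[OF assms])
  obtain g where g: "\<And>p. word_map w p = g \<odot> hdil (ratio w) p" using word_map_eq[OF assms] by blast
  define h where "h p = hdil (1 / ratio w) (hinv g \<odot> p)" for p
  have hw: "h (word_map w p) = p" for p using hdil_inverse(1)[OF rp] by (simp add: h_def g)
  have "hausdorff_outer m (h ` (word_map w ` A)) \<le> ennreal ((1 / ratio w) ^ m) * hausdorff_outer m (word_map w ` A)"
    by (rule hausdorff_outer_lipschitz_image) (use rp in \<open>simp_all add: h_def dist_hdil\<close>)
  moreover have "h ` (word_map w ` A) = A" by (simp add: image_image hw)
  ultimately have "ennreal (ratio w ^ m) * hausdorff_outer m A
      \<le> ennreal (ratio w ^ m) * (ennreal ((1 / ratio w) ^ m) * hausdorff_outer m (word_map w ` A))"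
    by (intro mult_left_mono) auto
  also have "\<dots> = hausdorff_outer m (word_map w ` A)"
    using rp by (simp add: mult.assoc[symmetric] ennreal_mult[symmetric] power_divide)
  finally show "ennreal (ratio w ^ m) * hausdorff_outer m A \<le> hausdorff_outer m (word_map w ` A)" .
qed

text \<open>Injectivity strips the common prefix; then the first letters differ and the two sets lie
  in disjoint images of \<open>U\<close>.\<close>

lemma word_map_disjoint:
  assumes U: "(\<Union>i\<in>I. S i ` U) \<subseteq> U" "\<And>i j. i \<in> I \<Longrightarrow> j \<in> I \<Longrightarrow> i \<noteq> j \<Longrightarrow> S i ` U \<inter> S j ` U = {}"
    and "w \<in> lists I" "w' \<in> lists I" "\<forall>v. w' \<noteq> w @ v" "\<forall>v. w \<noteq> w' @ v"
  shows "word_map w ` U \<inter> word_map w' ` U = {}"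
  using assms(3-)
proof (induction w arbitrary: w' rule: list.induct)
  case Nil
  then show ?case by force
next
  case (Cons i w)
  have sub: "word_map v ` U \<subseteq> U" if "v \<in> lists I" for v
    using that by (induction v) (use U(1) in auto)
  obtain j v where w': "w' = j # v" using Cons.prems(4) by (cases w') auto
  show ?case
  proof (cases "i = j")
    case False
    have "word_map (i # w) ` U \<subseteq> S i ` U" "word_map w' ` U \<subseteq> S j ` U"
      using sub[of w] sub[of v] Cons.prems by (auto simp: w')
    moreover have "S i ` U \<inter> S j ` U = {}" using U(2) False Cons.prems by (simp add: w')
    ultimately show ?thesis by blast
  next
    case True
    have "word_map w ` U \<inter> word_map v ` U = {}"
      by (rule Cons.IH) (use Cons.prems True in \<open>auto simp: w'\<close>)
    moreover have "inj (S i)" using inj_S Cons.prems by simp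
    moreover have "word_map (i # w) ` U = S i ` word_map w ` U" "word_map w' ` U = S i ` word_map v ` U"
      by (simp_all add: image_image w' True)
    ultimately show ?thesis by (simp only: image_Int[symmetric] image_empty)
  qed
qed

text \<open>This is the only use of the open set condition.\<close>

lemma cut_overlap:
  assumes osc: "open_set_condition I S"
  shows "\<exists>N::nat. \<forall>p t. 0 < t \<longrightarrow> t \<le> 1 \<longrightarrow>
    finite {w \<in> cut t. word_map w ` K \<inter> cball p t \<noteq> {}} \<and>
    card {w \<in> cut t. word_map w ` K \<inter> cball p t \<noteq> {}} \<le> N"
proof -
  obtain U where U: "U \<noteq> {}" "open U" "(\<Union>i\<in>I. S i ` U) \<subseteq> U"
    and U_disj: "\<forall>i\<in>I. \<forall>j\<in>I. i \<noteq> j \<longrightarrow> S i ` U \<inter> S j ` U = {}"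
    using osc unfolding open_set_condition_def by (elim exE conjE)
  obtain x where x: "x \<in> U" using U(1) by blast
  then obtain e where e: "0 < e" "ball x e \<subseteq> U" using U(2) open_contains_ball by blast
  have "bounded K" using K(1) by (rule compact_imp_bounded)
  then obtain D where D: "\<And>y. y \<in> K \<Longrightarrow> dist x y \<le> D" using bounded_any_center[of K x] by blast
  have "0 < e * rmin" using e rmin by simp
  from heis_packing[OF this, of "1 + D"]
  obtain N :: nat where N: "\<And>(p::'n heis) t P. 0 < t \<Longrightarrow> finite P \<Longrightarrow> P \<subseteq> cball p ((1 + D) * t) \<Longrightarrow>
     pairwise (\<lambda>x y. e * rmin * t \<le> dist x y) P \<Longrightarrow> card P \<le> N" by blast
  have "finite {w \<in> cut t. word_map w ` K \<inter> cball p t \<noteq> {}} \<and>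
    card {w \<in> cut t. word_map w ` K \<inter> cball p t \<noteq> {}} \<le> N" if t: "0 < t" "t \<le> 1" for p t
  proof -
    let ?W = "{w \<in> cut t. word_map w ` K \<inter> cball p t \<noteq> {}}"
    let ?f = "\<lambda>w. word_map w x"
    \<comment> \<open>The images of \<open>ball x e\<close> under the words of a cut are disjoint
      and have radius at least \<open>e * rmin * t\<close>, which separates the images of
      \<open>x\<close>.\<close>
    have sep: "e * rmin * t \<le> dist (?f w) (?f w')" if w: "w \<in> cut t" "w' \<in> cut t" "w \<noteq> w'" for w w'
    proof (rule ccontr)
      assume n: "\<not> ?thesis"
      note wl = cutD(1)[OF w(1)] cutD(1)[OF w(2)]
      have np: "a \<noteq> b @ v" if "a \<in> cut t" "b \<in> cut t" "a \<noteq> b" for a b v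
        using that cutD(2)[of b t] by (cases "v = []") (force simp: cut_def)+
      have disj: "word_map w ` U \<inter> word_map w' ` U = {}"
        by (rule word_map_disjoint[OF U(3) U_disj[rule_format] wl]) (use np w in auto)
      obtain g where g: "\<And>p. word_map w p = g \<odot> hdil (ratio w) p" using word_map_eq[OF wl(1)] by blast
      define y where "y = hdil (1 / ratio w) (hinv g \<odot> ?f w')"
      have rp: "0 < ratio w" by (rule ratio_pos[OF wl(1)])
      have wy: "word_map w y = ?f w'" unfolding y_def g hdil_inverse(2)[OF rp] by simp
      have "ratio w * dist x y = dist (?f w) (?f w')" by (simp add: dist_word_map[OF wl(1), symmetric] wy)
      also have "\<dots> < e * (rmin * t)" using n by (simp add: mult.assoc)
      also have "\<dots> \<le> e * ratio w" using cut_ratio_ge[OF w(1) t(2,1)] e by (intro mult_left_mono) auto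
      finally have "y \<in> U" using e(2) rp by (auto simp: mult.commute)
      then have "?f w' \<in> word_map w ` U \<inter> word_map w' ` U" using wy x by (metis IntI imageI)
      then show False using disj by blast
    qed
    have inj: "inj_on ?f ?W"
    proof (rule inj_onI, rule ccontr)
      fix w w' assume "w \<in> ?W" "w' \<in> ?W" "?f w = ?f w'" "w \<noteq> w'"
      then have "e * rmin * t \<le> 0" using sep[of w w'] by simp
      moreover have "0 < e * rmin * t" using e rmin t by simp
      ultimately show False by linarith
    qed
    have cb: "?f ` ?W \<subseteq> cball p ((1 + D) * t)"
    proof clarify
      fix w assume w: "w \<in> cut t" "word_map w ` K \<inter> cball p t \<noteq> {}"
      then obtain y where y: "y \<in> K" "dist p (word_map w y) \<le> t" by auto
      have "dist (word_map w y) (?f w) \<le> D * t"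
      proof -
        have "dist (word_map w y) (?f w) = ratio w * dist x y"
          by (simp add: dist_word_map[OF cutD(1)[OF w(1)]] dist_commute)
        also have "\<dots> \<le> t * D"
          using cutD(2)[OF w(1)] D[OF y(1)] t by (intro mult_mono) auto
        finally show ?thesis by (simp add: mult.commute)
      qed
      then show "?f w \<in> cball p ((1 + D) * t)"
        using y(2) dist_triangle[of p "?f w" "word_map w y"] by (simp add: algebra_simps)
    qed
    have bound: "card P \<le> N" if "finite P" "P \<subseteq> ?W" for P
    proof -
      have "card (?f ` P) \<le> N"
      proof (rule N[OF t(1), of _ p])
        show "?f ` P \<subseteq> cball p ((1 + D) * t)" using cb that(2) by blast
        show "pairwise (\<lambda>x y. e * rmin * t \<le> dist x y) (?f ` P)"
          unfolding pairwise_def using sep that(2) by blast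
      qed (use that in simp)
      then show ?thesis using card_image[OF inj_on_subset[OF inj that(2)]] by simp
    qed
    have "finite ?W"
    proof (rule ccontr)
      assume "infinite ?W"
      then obtain P where "P \<subseteq> ?W" "finite P" "card P = Suc N" using infinite_arbitrarily_large by blast
      then show False using bound[of P] by simp
    qed
    with bound[of ?W] show ?thesis by simp
  qed
  then show ?thesis by blast
qed

end

section \<open>Points where the maximal Riesz transforms are finite\<close>

lemma riesz_kernel_le:
  assumes "0 < a" "a \<le> hnorm p"
  shows "\<bar>riesz_kernel (real m) k p\<bar> \<le> 1 / a ^ m"
proof -
  have h: "0 < hnorm p" using assms by linarith
  have "\<bar>riesz_kernel (real m) k p\<bar> \<le> 1 / hnorm p ^ m"
  proof (cases k)
    case None
    have "\<bar>vert p\<bar> / hnorm p ^ (m + 2) \<le> (hnorm p)\<^sup>2 / hnorm p ^ (m + 2)"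
      using h by (intro divide_right_mono abs_vert_le) auto
    also have "\<dots> = 1 / hnorm p ^ m" using h by (simp add: power_add power2_eq_square)
    finally show ?thesis using h None by (simp add: riesz_kernel_def powr_Suc_eq_power hnorm_nonneg)
  next
    case (Some i)
    have "\<bar>hor p $ i\<bar> \<le> hnorm p" using component_le_norm_cart[of "hor p" i] norm_hor_le_hnorm[of p] by linarith
    then have "\<bar>hor p $ i\<bar> / hnorm p ^ (m + 1) \<le> hnorm p / hnorm p ^ (m + 1)"
      using h by (intro divide_right_mono) auto
    then show ?thesis using h Some by (simp add: riesz_kernel_def powr_Suc_eq_power hnorm_nonneg)
  qed
  also have "\<dots> \<le> 1 / a ^ m" using assms by (intro frac_le power_mono) auto
  finally show ?thesis .
qed

lemma measurable_heis [measurable]: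
  "hor \<in> borel_measurable borel" "vert \<in> borel_measurable borel"
  by (intro borel_measurable_continuous_onI continuous_on_heis continuous_on_id)+

lemma measurable_hform [measurable]:
  fixes f g :: "'a \<Rightarrow> real ^ ('n::finite + 'n)"
  assumes "f \<in> borel_measurable M" "g \<in> borel_measurable M"
  shows "(\<lambda>x. hform (f x) (g x)) \<in> borel_measurable M"
proof -
  have "(\<lambda>v :: real ^ ('n + 'n). v $ i) \<in> borel_measurable borel" for i
    by (intro borel_measurable_continuous_onI continuous_on_component continuous_on_id)
  from measurable_compose[OF assms(1) this] measurable_compose[OF assms(2) this]
  show ?thesis unfolding hform_def by measurable
qed

lemma measurable_riesz_kernel:
  fixes N :: "'n::finite heis measure"
  assumes "sets N = sets borel"
  shows "(\<lambda>x. riesz_kernel s k (hinv (fst x) \<odot> snd x)) \<in> borel_measurable (borel \<Otimes>\<^sub>M N)"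
    and "(\<lambda>x. dist (fst x) (snd x)) \<in> borel_measurable (borel \<Otimes>\<^sub>M N)"
proof -
  have N [measurable_cong]: "sets N = sets borel" by (rule assms)
  have 1: "(\<lambda>x. hor (hinv (fst x) \<odot> snd x)) \<in> borel_measurable (borel \<Otimes>\<^sub>M N)" unfolding hmult_sel hinv_sel by measurable
  have 2: "(\<lambda>x. vert (hinv (fst x) \<odot> snd x)) \<in> borel_measurable (borel \<Otimes>\<^sub>M N)" unfolding hmult_sel hinv_sel by measurable
  have 3: "(\<lambda>x. hnorm (hinv (fst x) \<odot> snd x)) \<in> borel_measurable (borel \<Otimes>\<^sub>M N)"
    unfolding hnorm_def using 1 2 by measurable
  then show "(\<lambda>x. dist (fst x) (snd x)) \<in> borel_measurable (borel \<Otimes>\<^sub>M N)" by (simp add: dist_heis_alt)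
  have "(\<lambda>v :: real ^ ('n + 'n). v $ i) \<in> borel_measurable borel" for i
    by (intro borel_measurable_continuous_onI continuous_on_component continuous_on_id)
  from measurable_compose[OF 1 this]
  have 4: "(\<lambda>x. hor (hinv (fst x) \<odot> snd x) $ i) \<in> borel_measurable (borel \<Otimes>\<^sub>M N)" for i .
  show "(\<lambda>x. riesz_kernel s k (hinv (fst x) \<odot> snd x)) \<in> borel_measurable (borel \<Otimes>\<^sub>M N)"
    unfolding riesz_kernel_def using 2 3 4 by (cases k) simp_all
qed

locale borel_finite_measure = finite_measure \<mu> for \<mu> :: "'n::finite heis measure" +
  assumes sets_mu [simp, measurable_cong]: "sets \<mu> = sets borel"
begin

lemma space_mu [simp]: "space \<mu> = UNIV"
  using sets_eq_imp_space_eq[OF sets_mu] by simp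

lemma measurable_kernel_section:
  "(\<lambda>q. riesz_kernel s k (hinv p \<odot> q)) \<in> borel_measurable \<mu>"
  using measurable_compose[OF measurable_Pair1'[of p borel \<mu>] measurable_riesz_kernel(1)[OF sets_mu, of s k]] by simp

lemma kernel_integrable:
  assumes "0 < a" "A \<in> sets borel" "\<And>q. q \<in> A \<Longrightarrow> a \<le> dist p q"
  shows "set_integrable \<mu> A (\<lambda>q. riesz_kernel (real m) k (hinv p \<odot> q))"
  unfolding set_integrable_def
proof (rule integrable_const_bound[of _ "1 / a ^ m"])
  show "AE q in \<mu>. norm (indicator A q *\<^sub>R riesz_kernel (real m) k (hinv p \<odot> q)) \<le> 1 / a ^ m"
  proof (rule AE_I2)
    fix q
    show "norm (indicator A q *\<^sub>R riesz_kernel (real m) k (hinv p \<odot> q)) \<le> 1 / a ^ m"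
      using riesz_kernel_le[OF assms(1), of "hinv p \<odot> q" m k] assms(1,3)
      by (cases "q \<in> A") (auto simp: dist_heis_alt)
  qed
  show "(\<lambda>q. indicator A q *\<^sub>R riesz_kernel (real m) k (hinv p \<odot> q)) \<in> borel_measurable \<mu>"
    using assms(2) measurable_kernel_section by (intro borel_measurable_scaleR borel_measurable_indicator) auto
qed

lemma riesz_truncated_one:
  "riesz_truncated \<mu> s k e (\<lambda>_. 1) p = (LINT q:- cball p e|\<mu>. riesz_kernel s k (hinv p \<odot> q))"
  by (simp add: riesz_truncated_def)

lemma riesz_annulus:
  assumes "0 < a" "a < b"
  shows "(LINT y:{y. a < dist p y \<and> dist p y \<le> b}|\<mu>. riesz_kernel (real m) k (hinv p \<odot> y)) =
    riesz_truncated \<mu> (real m) k a (\<lambda>_. 1) p - riesz_truncated \<mu> (real m) k b (\<lambda>_. 1) p"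
proof -
  let ?A = "{y. a < dist p y \<and> dist p y \<le> b}"
  have "?A = cball p b - cball p a" by auto
  then have A: "?A \<in> sets borel" by simp
  have U: "- cball p a = ?A \<union> - cball p b" using assms by auto
  have "(LINT q:- cball p a|\<mu>. riesz_kernel (real m) k (hinv p \<odot> q)) =
      (LINT q:?A|\<mu>. riesz_kernel (real m) k (hinv p \<odot> q)) + (LINT q:- cball p b|\<mu>. riesz_kernel (real m) k (hinv p \<odot> q))"
    unfolding U
  proof (rule set_integral_Un)
    show "set_integrable \<mu> ?A (\<lambda>q. riesz_kernel (real m) k (hinv p \<odot> q))"
      by (rule kernel_integrable[OF assms(1) A]) auto
    show "set_integrable \<mu> (- cball p b) (\<lambda>q. riesz_kernel (real m) k (hinv p \<odot> q))"
      by (rule kernel_integrable[of b]) (use assms in auto)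
  qed auto
  then show ?thesis by (simp add: riesz_truncated_one)
qed

text \<open>Closed balls are removed from the domain, so for radii decreasing to \<open>e\<close>
  the integrands converge everywhere: points at distance exactly \<open>e\<close> are excluded
  throughout.\<close>

lemma riesz_truncated_right_continuous:
  assumes "0 < e" "e' \<longlonglongrightarrow> e" "\<And>n. e < e' n"
  shows "(\<lambda>n. riesz_truncated \<mu> (real m) k (e' n) (\<lambda>_. 1) p) \<longlonglongrightarrow> riesz_truncated \<mu> (real m) k e (\<lambda>_. 1) p"
  unfolding riesz_truncated_one set_lebesgue_integral_def
proof (rule integral_dominated_convergence[where w = "\<lambda>_. 1 / e ^ m"])
  let ?f = "\<lambda>e q. indicator (- cball p e) q *\<^sub>R riesz_kernel (real m) k (hinv p \<odot> q)"
  show "?f e \<in> borel_measurable \<mu>" "?f (e' n) \<in> borel_measurable \<mu>" for n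
    using measurable_kernel_section by (intro borel_measurable_scaleR borel_measurable_indicator; simp)+
  show "integrable \<mu> (\<lambda>_. 1 / e ^ m)" by simp
  show "AE q in \<mu>. (\<lambda>n. ?f (e' n) q) \<longlonglongrightarrow> ?f e q"
  proof (rule AE_I2)
    fix q
    show "(\<lambda>n. ?f (e' n) q) \<longlonglongrightarrow> ?f e q"
    proof (cases "e < dist p q")
      case True
      have "eventually (\<lambda>n. e' n < dist p q) sequentially" using order_tendstoD(2)[OF assms(2) True] .
      then have "eventually (\<lambda>n. ?f (e' n) q = ?f e q) sequentially"
        by eventually_elim (use True in simp)
      then show ?thesis by (rule tendsto_eventually)
    next
      case False
      then have z: "?f (e' n) q = 0" for n using assms(3)[of n] by simp
      have z': "?f e q = 0" using False by simp
      show ?thesis unfolding z z' by (rule tendsto_const)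
    qed
  qed
  show "AE q in \<mu>. norm (?f (e' n) q) \<le> 1 / e ^ m" for n
  proof (rule AE_I2)
    fix q
    show "norm (?f (e' n) q) \<le> 1 / e ^ m"
      using riesz_kernel_le[OF assms(1), of "hinv p \<odot> q" m k] assms(1) assms(3)[of n]
      by (cases "q \<in> cball p (e' n)") (auto simp: dist_heis_alt)
  qed
qed

text \<open>A countable supremum, which makes the maximal function measurable.\<close>

lemma riesz_maximal_rational:
  "riesz_maximal \<mu> (real m) k (\<lambda>_. 1) p =
    (SUP e\<in>{e. 0 < e \<and> e \<in> \<rat>}. ennreal \<bar>riesz_truncated \<mu> (real m) k e (\<lambda>_. 1) p\<bar>)"
  unfolding riesz_maximal_def
proof (rule antisym)
  show "(SUP e\<in>{0<..}. ennreal \<bar>riesz_truncated \<mu> (real m) k e (\<lambda>_. 1) p\<bar>)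
    \<le> (SUP e\<in>{e. 0 < e \<and> e \<in> \<rat>}. ennreal \<bar>riesz_truncated \<mu> (real m) k e (\<lambda>_. 1) p\<bar>)"
  proof (rule SUP_least)
    fix e :: real assume "e \<in> {0<..}"
    then have e: "0 < e" by simp
    have "\<exists>x. x \<in> \<rat> \<and> e < x \<and> x < e + 1 / real (Suc n)" for n
      using Rats_dense_in_real[of e "e + 1 / real (Suc n)"] by auto
    then obtain e' where e': "\<And>n. e' n \<in> \<rat>" "\<And>n. e < e' n" "\<And>n. e' n < e + 1 / real (Suc n)" by metis
    have "e' \<longlonglongrightarrow> e"
    proof (rule tendsto_sandwich[of "\<lambda>_. e" _ _ "\<lambda>n. e + 1 / real (Suc n)"])
      show "(\<lambda>n. e + 1 / real (Suc n)) \<longlonglongrightarrow> e"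
        using tendsto_add[OF tendsto_const LIMSEQ_inverse_real_of_nat, of e] by (simp add: inverse_eq_divide)
    qed (use e'(2,3) in \<open>auto intro!: always_eventually less_imp_le\<close>)
    then have lim: "(\<lambda>n. ennreal \<bar>riesz_truncated \<mu> (real m) k (e' n) (\<lambda>_. 1) p\<bar>)
        \<longlonglongrightarrow> ennreal \<bar>riesz_truncated \<mu> (real m) k e (\<lambda>_. 1) p\<bar>"
      by (intro tendsto_ennrealI tendsto_rabs riesz_truncated_right_continuous e e'(2))
    have le: "ennreal \<bar>riesz_truncated \<mu> (real m) k (e' n) (\<lambda>_. 1) p\<bar>
        \<le> (SUP e\<in>{e. 0 < e \<and> e \<in> \<rat>}. ennreal \<bar>riesz_truncated \<mu> (real m) k e (\<lambda>_. 1) p\<bar>)" for n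
      by (rule SUP_upper) (use e' e order.strict_trans in blast)
    show "ennreal \<bar>riesz_truncated \<mu> (real m) k e (\<lambda>_. 1) p\<bar>
        \<le> (SUP e\<in>{e. 0 < e \<and> e \<in> \<rat>}. ennreal \<bar>riesz_truncated \<mu> (real m) k e (\<lambda>_. 1) p\<bar>)"
      by (rule LIMSEQ_le_const2[OF lim]) (intro exI allI impI le)
  qed
qed (rule SUP_subset_mono; auto)

lemma measurable_riesz_maximal:
  "riesz_maximal \<mu> (real m) k (\<lambda>_. 1) \<in> borel_measurable \<mu>"
proof -
  have "(\<lambda>p. riesz_truncated \<mu> (real m) k e (\<lambda>_. 1) p) \<in> borel_measurable borel" for e
    unfolding riesz_truncated_one set_lebesgue_integral_def
  proof (rule borel_measurable_lebesgue_integral)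
    note [measurable] = measurable_riesz_kernel[OF sets_mu]
    have "(\<lambda>x. indicator {t. e < t} (dist (fst x) (snd x)) *\<^sub>R riesz_kernel (real m) k (hinv (fst x) \<odot> snd x))
        \<in> borel_measurable (borel \<Otimes>\<^sub>M \<mu>)" by measurable
    moreover have "(\<lambda>(p, q). indicator (- cball p e) q *\<^sub>R riesz_kernel (real m) k (hinv p \<odot> q)) =
        (\<lambda>x. indicator {t. e < t} (dist (fst x) (snd x)) *\<^sub>R riesz_kernel (real m) k (hinv (fst x) \<odot> snd x))"
      by (auto simp: fun_eq_iff indicator_def)
    ultimately show "(\<lambda>(p, q). indicator (- cball p e) q *\<^sub>R riesz_kernel (real m) k (hinv p \<odot> q))
        \<in> borel_measurable (borel \<Otimes>\<^sub>M \<mu>)" by (simp only:)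
  qed
  then have "(\<lambda>p. ennreal \<bar>riesz_truncated \<mu> (real m) k e (\<lambda>_. 1) p\<bar>) \<in> borel_measurable \<mu>" for e
    unfolding measurable_cong_sets[OF sets_mu refl] by measurable
  moreover have "countable {e :: real. 0 < e \<and> e \<in> \<rat>}"
    by (rule countable_subset[OF _ countable_rat]) auto
  ultimately show ?thesis
    unfolding riesz_maximal_rational[abs_def] by (intro borel_measurable_SUP) auto
qed

text \<open>Boundedness is tested on the constant 1, which is square integrable for a finite
  measure.\<close>

lemma AE_riesz_maximal_finite:
  assumes "riesz_bounded_in_L2 \<mu> (real m)"
  shows "AE p in \<mu>. \<forall>k. riesz_maximal \<mu> (real m) k (\<lambda>_. 1) p < \<infinity>"
proof (rule AE_all_countable[THEN iffD2], rule allI)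
  fix k
  let ?T = "riesz_maximal \<mu> (real m) k (\<lambda>_. 1)"
  obtain C where C: "\<And>f. integrable \<mu> f \<and> integrable \<mu> (\<lambda>x. (f x)\<^sup>2) \<Longrightarrow>
      (\<integral>\<^sup>+x. (riesz_maximal \<mu> (real m) k f x)\<^sup>2 \<partial>\<mu>) \<le> ennreal C * (\<integral>\<^sup>+x. ennreal ((f x)\<^sup>2) \<partial>\<mu>)"
    using assms unfolding riesz_bounded_in_L2_def bounded_in_L2_def by blast
  have "(\<integral>\<^sup>+x. (?T x)\<^sup>2 \<partial>\<mu>) \<le> ennreal C * (\<integral>\<^sup>+x. ennreal (1\<^sup>2) \<partial>\<mu>)" by (rule C) simp
  also have "\<dots> < \<infinity>" using emeasure_finite[of UNIV] by (simp add: ennreal_mult_eq_top_iff flip: less_top)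
  finally have "(\<integral>\<^sup>+x. (?T x)\<^sup>2 \<partial>\<mu>) \<noteq> \<infinity>" by simp
  moreover have "(\<lambda>x. (?T x)\<^sup>2) \<in> borel_measurable \<mu>" using measurable_riesz_maximal by measurable
  ultimately have "AE x in \<mu>. (?T x)\<^sup>2 \<noteq> \<infinity>" by (intro nn_integral_PInf_AE)
  then show "AE x in \<mu>. ?T x < \<infinity>" by eventually_elim (simp add: less_top power_less_top_ennreal)
qed

text \<open>The sublevel sets exhaust almost all of \<open>K\<close>, and one bound serves all of
  the finitely many components \<open>k\<close>. If all closures were null, almost no point would be
  left.\<close>

lemma riesz_good_set:
  assumes bdd: "riesz_bounded_in_L2 \<mu> (real m)" and K: "AE p in \<mu>. p \<in> K" and pos: "emeasure \<mu> UNIV \<noteq> 0"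
  shows "\<exists>M::nat. emeasure \<mu> (closure {p \<in> K. \<forall>k. riesz_maximal \<mu> (real m) k (\<lambda>_. 1) p \<le> of_nat M}) \<noteq> 0"
proof (rule ccontr)
  let ?E = "\<lambda>M::nat. {p \<in> K. \<forall>k. riesz_maximal \<mu> (real m) k (\<lambda>_. 1) p \<le> of_nat M}"
  assume "\<not> ?thesis"
  then have "closure (?E M) \<in> null_sets \<mu>" for M by (auto intro!: null_setsI borel_closed)
  then have "AE p in \<mu>. p \<notin> closure (?E M)" for M by (rule AE_not_in)
  then have "AE p in \<mu>. \<forall>M. p \<notin> closure (?E M)" by (simp add: AE_all_countable)
  then have "AE p in \<mu>. False"
    using AE_riesz_maximal_finite[OF bdd] K
  proof eventually_elim
    case (elim p)
    have "\<exists>n::nat. riesz_maximal \<mu> (real m) k (\<lambda>_. 1) p \<le> of_nat n" for k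
      using ennreal_Ex_less_of_nat[of "riesz_maximal \<mu> (real m) k (\<lambda>_. 1) p"] elim(2) by (auto simp: less_top intro: less_imp_le)
    then obtain n :: "('n + 'n) option \<Rightarrow> nat" where n: "\<And>k. riesz_maximal \<mu> (real m) k (\<lambda>_. 1) p \<le> of_nat (n k)" by metis
    have "riesz_maximal \<mu> (real m) k (\<lambda>_. 1) p \<le> of_nat (Max (range n))" for k
    proof -
      have "n k \<le> Max (range n)" by (rule Max_ge) auto
      then have "(of_nat (n k) :: ennreal) \<le> of_nat (Max (range n))" by simp
      with n[of k] show ?thesis by (rule order.trans)
    qed
    then have "p \<in> ?E (Max (range n))" using elim(3) by simp
    then have "p \<in> closure (?E (Max (range n)))" by (rule subsetD[OF closure_subset])
    with spec[OF elim(1), of "Max (range n)"] show ?case by (rule notE)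
  qed
  then have "emeasure \<mu> UNIV = 0" using AE_iff_measurable[of UNIV \<mu> "\<lambda>_. False"] by simp
  with pos show False by simp
qed

end

section \<open>Unboundedness on self-similar sets\<close>

lemma emeasure_hausdorff_on:
  assumes "closed C" "A \<in> sets borel"
  shows "emeasure (hausdorff_on m C) A = hausdorff_outer m (C \<inter> A)"
proof -
  have C: "C \<in> sets borel" using assms(1) by simp
  have "emeasure (hausdorff_on m C) A = (\<integral>\<^sup>+x. indicator (C \<inter> A) x \<partial>(hausdorff_measure m))"
    unfolding hausdorff_on_def indicator_inter_arith using assms(2) C
    by (intro emeasure_density borel_measurable_indicator) simp_all
  also have "\<dots> = emeasure (hausdorff_measure m) (C \<inter> A)" using assms(2) C by simp
  finally show ?thesis using emeasure_hausdorff_measure[of "C \<inter> A" m] assms(2) C by simp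
qed

lemma sets_hausdorff_on [simp]: "sets (hausdorff_on m C) = sets borel"
  by (simp add: hausdorff_on_def)

lemma hausdorff_outer_finite_Union:
  assumes "finite W"
  shows "hausdorff_outer m (\<Union>w\<in>W. A w) \<le> (\<Sum>w\<in>W. hausdorff_outer m (A w))"
  using assms
proof (induction W)
  case (insert w W)
  have "hausdorff_outer m (\<Union>w\<in>insert w W. A w) \<le> hausdorff_outer m (A w) + hausdorff_outer m (\<Union>w\<in>W. A w)"
    using hausdorff_outer_Un[of m "A w" "\<Union>w\<in>W. A w"] by simp
  also have "\<dots> \<le> hausdorff_outer m (A w) + (\<Sum>w\<in>W. hausdorff_outer m (A w))"
    by (rule add_left_mono[OF insert.IH])
  finally show ?case using insert.hyps by simp
qed (simp add: hausdorff_outer_empty)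

lemma subspace_extend_dim:
  fixes L :: "'a::euclidean_space set"
  assumes "subspace L" "dim L \<le> d" "d \<le> DIM('a)"
  shows "\<exists>L'. subspace L' \<and> L \<subseteq> L' \<and> dim L' = d"
  using assms(2,3)
proof (induction d rule: dec_induct)
  case base
  then show ?case using assms(1) by blast
next
  case (step k)
  then obtain L' where L': "subspace L'" "L \<subseteq> L'" "dim L' = k" by auto
  have "L' \<noteq> UNIV" using L'(3) step.prems by auto
  then obtain v where v: "v \<notin> L'" by blast
  have sL: "span L' = L'" using L'(1) by (simp only: span_eq_iff)
  have "dim (insert v L') = Suc k" using dim_insert[of v L'] v L'(3) unfolding sL by simp
  moreover have "L \<subseteq> span (insert v L')" using L'(2) span_superset by blast
  ultimately show ?case using subspace_span dim_span by metis
qed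

lemma hdil_groups:
  assumes "subspace L" "p \<in> G" "G = vert_group L \<or> G = hor_group L"
  shows "hdil s p \<in> G"
  using assms by (auto simp: vert_group_def hor_group_def subspace_scale)

lemma hmult_groups:
  assumes "subspace L" "p \<in> G" "p' \<in> G"
    "G = vert_group L \<or> G = hor_group L \<and> (\<forall>x\<in>L. \<forall>y\<in>L. hform x y = 0)"
  shows "hinv p \<odot> p' \<in> G"
  using assms by (auto simp: vert_group_def hor_group_def subspace_diff hform_simps)

section \<open>Regularity of the self-similar measure and the containing group\<close>

context heis_ifs
begin

text \<open>A ball of radius \<open>t \<le> 1\<close> meets boundedly many cells of the cut at level
  \<open>t\<close>, each of measure at most \<open>t ^ m\<close> times that of
  \<open>K\<close>.\<close>

lemma ad_regular_upper:
  assumes osc: "open_set_condition I S" and fin: "hausdorff_outer m K < \<infinity>"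
  shows "\<exists>C. \<forall>p t. 0 < t \<longrightarrow> measure (hausdorff_on m K) (cball p t) \<le> C * t ^ m"
proof -
  obtain N :: nat where N: "\<And>p t. 0 < t \<Longrightarrow> t \<le> 1 \<Longrightarrow>
    finite {w \<in> cut t. word_map w ` K \<inter> cball p t \<noteq> {}} \<and>
    card {w \<in> cut t. word_map w ` K \<inter> cball p t \<noteq> {}} \<le> N" using cut_overlap[OF osc] by blast
  define h where "h = enn2real (hausdorff_outer m K)"
  have h: "hausdorff_outer m K = ennreal h" "0 \<le> h" using fin by (auto simp: h_def less_top)
  have clK: "closed K" using K(1) by (rule compact_imp_closed)
  \<comment> \<open>\<open>real N + 1\<close> keeps the factor at least 1, so that radii above 1 are
    covered by the total mass \<open>h\<close>.\<close>
  have "measure (hausdorff_on m K) (cball p t) \<le> (real N + 1) * h * t ^ m" if t: "0 < t" for p t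
  proof -
    have "hausdorff_outer m (K \<inter> cball p t) \<le> ennreal ((real N + 1) * h * t ^ m)"
    proof (cases "t \<le> 1")
      case True
      let ?W = "{w \<in> cut t. word_map w ` K \<inter> cball p t \<noteq> {}}"
      have W: "finite ?W" "card ?W \<le> N" using N[OF t True] by blast+
      have "K \<inter> cball p t \<subseteq> (\<Union>w\<in>?W. word_map w ` K)"
      proof
        fix x assume x: "x \<in> K \<inter> cball p t"
        then obtain w where "w \<in> cut t" "x \<in> word_map w ` K" using cut_covers[OF t] by blast
        then show "x \<in> (\<Union>w\<in>?W. word_map w ` K)" using x by blast
      qed
      then have "hausdorff_outer m (K \<inter> cball p t) \<le> (\<Sum>w\<in>?W. hausdorff_outer m (word_map w ` K))"
        using hausdorff_outer_mono hausdorff_outer_finite_Union[OF W(1)] order.trans by blast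
      also have "\<dots> \<le> (\<Sum>w\<in>?W. ennreal (t ^ m * h))"
      proof (rule sum_mono)
        fix w assume "w \<in> ?W"
        then have w: "w \<in> lists I" "ratio w \<le> t" using cutD by blast+
        have "hausdorff_outer m (word_map w ` K) = ennreal (ratio w ^ m * h)"
          using ratio_pos[OF w(1)] h(2) by (simp add: hausdorff_outer_word_map[OF w(1)] h(1) ennreal_mult[symmetric])
        also have "\<dots> \<le> ennreal (t ^ m * h)"
          using w(2) ratio_pos[OF w(1)] h(2) by (intro ennreal_leI mult_right_mono power_mono) auto
        finally show "hausdorff_outer m (word_map w ` K) \<le> ennreal (t ^ m * h)" .
      qed
      also have "\<dots> = ennreal (real (card ?W) * (t ^ m * h))"
        using t h(2) by (simp add: ennreal_of_nat_eq_real_of_nat ennreal_mult[symmetric])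
      also have "\<dots> \<le> ennreal ((real N + 1) * (t ^ m * h))"
        using W(2) t h(2) by (intro ennreal_leI mult_right_mono) auto
      finally show ?thesis by (simp add: mult_ac)
    next
      case False
      have "h * 1 \<le> h * t ^ m" using False h(2) by (intro mult_left_mono) auto
      also have "\<dots> \<le> (real N + 1) * (h * t ^ m)"
        using mult_right_mono[of 1 "real N + 1" "h * t ^ m"] h(2) t by simp
      finally have "h \<le> (real N + 1) * h * t ^ m" by (simp add: mult.assoc)
      then have "hausdorff_outer m K \<le> ennreal ((real N + 1) * h * t ^ m)" unfolding h(1) by (rule ennreal_leI)
      then show ?thesis using hausdorff_outer_mono[of "K \<inter> cball p t" K m] by (meson Int_lower1 order.trans)
    qed
    then have "emeasure (hausdorff_on m K) (cball p t) \<le> ennreal ((real N + 1) * h * t ^ m)"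
      by (simp add: emeasure_hausdorff_on[OF clK])
    then show ?thesis
      unfolding measure_def using h(2) t by (intro enn2real_leI) auto
  qed
  then show ?thesis by blast
qed

text \<open>The cell of \<open>p\<close> at level \<open>t / D\<close> has diameter at most
  \<open>t\<close>, so the ball contains it, and self-similarity gives its measure.\<close>

lemma ad_regular_lower:
  assumes fin: "hausdorff_outer m K < \<infinity>" and pos: "0 < hausdorff_outer m K"
  shows "\<exists>c>0. \<forall>p t. p \<in> K \<longrightarrow> 0 < t \<longrightarrow> t \<le> 1 \<longrightarrow> c * t ^ m \<le> measure (hausdorff_on m K) (cball p t)"
proof -
  define h where "h = enn2real (hausdorff_outer m K)"
  have h: "hausdorff_outer m K = ennreal h" "0 < h" using fin pos by (auto simp: h_def less_top enn2real_positive_iff)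
  have clK: "closed K" using K(1) by (rule compact_imp_closed)
  define D where "D = max 1 (diameter K)"
  have D: "1 \<le> D" "\<And>x y. x \<in> K \<Longrightarrow> y \<in> K \<Longrightarrow> dist x y \<le> D"
    using diameter_bounded_bound[OF compact_imp_bounded[OF K(1)]] by (auto simp: D_def intro: max.coboundedI2)
  have "(rmin / D) ^ m * h * t ^ m \<le> measure (hausdorff_on m K) (cball p t)" if p: "p \<in> K" and t: "0 < t" "t \<le> 1" for p t
  proof -
    have tD: "0 < t / D" "t / D \<le> 1" using t D(1) by (auto simp: pos_divide_le_eq)
    obtain w where w: "w \<in> cut (t / D)" "p \<in> word_map w ` K" using cut_covers[OF tD(1) p] by blast
    note wl = cutD(1)[OF w(1)]
    have rp: "0 < ratio w" by (rule ratio_pos[OF wl])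
    have sub: "word_map w ` K \<subseteq> K \<inter> cball p t"
    proof
      fix z assume "z \<in> word_map w ` K"
      then obtain y where y: "y \<in> K" "z = word_map w y" by blast
      obtain x where x: "x \<in> K" "p = word_map w x" using w(2) by blast
      have "dist p z = ratio w * dist x y" by (simp add: x y dist_word_map[OF wl])
      also have "\<dots> \<le> t / D * D" using cutD(2)[OF w(1)] D(2)[OF x(1) y(1)] rp tD by (intro mult_mono) auto
      finally show "z \<in> K \<inter> cball p t" using word_map_K[OF wl y(1)] y(2) D(1) by simp
    qed
    have "(rmin / D) ^ m * h * t ^ m = (rmin * (t / D)) ^ m * h" by (simp add: power_divide power_mult_distrib)
    also have "\<dots> \<le> ratio w ^ m * h"
      using cut_ratio_ge[OF w(1) tD(2,1)] mult_nonneg_nonneg[of rmin "t / D"] rmin(1) tD h(2)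
      by (intro mult_right_mono power_mono) linarith+
    finally have "ennreal ((rmin / D) ^ m * h * t ^ m) \<le> ennreal (ratio w ^ m * h)" by (rule ennreal_leI)
    also have "\<dots> = hausdorff_outer m (word_map w ` K)"
      using rp h(2) by (simp add: hausdorff_outer_word_map[OF wl] h(1) ennreal_mult[symmetric])
    also have "\<dots> \<le> hausdorff_outer m (K \<inter> cball p t)" by (rule hausdorff_outer_mono[OF sub])
    finally have le: "ennreal ((rmin / D) ^ m * h * t ^ m) \<le> hausdorff_outer m (K \<inter> cball p t)" .
    have "hausdorff_outer m (K \<inter> cball p t) \<le> hausdorff_outer m K" by (rule hausdorff_outer_mono) blast
    then have "hausdorff_outer m (K \<inter> cball p t) < \<infinity>" using fin by (rule order.strict_trans1)
    then have "enn2real (ennreal ((rmin / D) ^ m * h * t ^ m)) \<le> enn2real (hausdorff_outer m (K \<inter> cball p t))"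
      using le by (intro enn2real_mono) auto
    then show ?thesis
      using rmin(1) D(1) h(2) t by (simp add: measure_def emeasure_hausdorff_on[OF clK])
  qed
  moreover have "0 < (rmin / D) ^ m * h" using rmin(1) D(1) h(2) by simp
  ultimately show ?thesis by blast
qed

text \<open>
  Self-similarity carries an approximation of \<open>K\<close> by the group \<open>G\<close> at one small scale back to scale
  one, where the approximating translates of \<open>G\<close> converge.
\<close>

lemma subset_translate_of_tangent_group:
  fixes G :: "'n heis set"
  assumes clG: "closed G" and dil: "\<And>s p. p \<in> G \<Longrightarrow> hdil s p \<in> G"
    and grp: "\<And>p p'. p \<in> G \<Longrightarrow> p' \<in> G \<Longrightarrow> hinv p \<odot> p' \<in> G"
    and tan: "\<And>e R. 0 < e \<Longrightarrow> 0 < R \<Longrightarrow> \<exists>p\<in>K. \<exists>l\<ge>R. inside (view p l ` K) G e R"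
  shows "\<exists>a. K \<subseteq> (\<lambda>p. a \<odot> p) ` G"
proof -
  define D where "D = max 1 (diameter K)"
  have D: "1 \<le> D" "\<And>x y. x \<in> K \<Longrightarrow> y \<in> K \<Longrightarrow> dist x y \<le> D"
    using diameter_bounded_bound[OF compact_imp_bounded[OF K(1)]] by (auto simp: D_def intro: max.coboundedI2)
  have near: "\<exists>a. \<forall>z\<in>K. \<exists>f\<in>G. dist z (a \<odot> f) \<le> e" if e: "0 < e" for e
  proof -
    \<comment> \<open>The radius \<open>D\<close> makes the window contain a whole cell of level
      \<open>1 / l\<close> around \<open>p\<close>. Undoing the word map after magnification
      multiplies lengths by \<open>1 / s \<le> 1 / rmin\<close>, which turns the tolerance
      \<open>e * rmin\<close> into \<open>e\<close>.\<close>
    have "0 < e * rmin" "0 < D" using e rmin D(1) by auto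
    then obtain p l where pl: "p \<in> K" "D \<le> l" "inside (view p l ` K) G (e * rmin) D" using tan by blast
    have l: "0 < l" "1 \<le> l" using pl(2) D(1) by auto
    have tl: "0 < 1 / l" "1 / l \<le> 1" using l by auto
    obtain w where w: "w \<in> cut (1 / l)" "p \<in> word_map w ` K" using cut_covers[OF tl(1) pl(1)] by blast
    note wl = cutD(1)[OF w(1)]
    obtain x where x: "x \<in> K" "p = word_map w x" using w(2) by blast
    obtain g where g: "\<And>z. word_map w z = g \<odot> hdil (ratio w) z" using word_map_eq[OF wl] by blast
    define s where "s = l * ratio w"
    have "rmin * (1 / l) \<le> ratio w" using cut_ratio_ge[OF w(1) tl(2,1)] .
    then have s: "rmin \<le> s" "0 < s" using l rmin(1) ratio_pos[OF wl] by (auto simp: s_def field_simps)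
    define h where "h = hdil l (hinv p \<odot> g)"
    have "\<exists>f\<in>G. dist z (hdil (1 / s) (hinv h) \<odot> f) \<le> e" if z: "z \<in> K" for z
    proof -
      let ?y = "word_map w z"
      have "dist p ?y = ratio w * dist x z" by (simp add: x dist_word_map[OF wl])
      also have "\<dots> \<le> 1 / l * D" using cutD(2)[OF w(1)] D(2)[OF x(1) z] ratio_pos[OF wl] tl by (intro mult_mono) auto
      finally have "l * dist p ?y \<le> l * (1 / l * D)" using l by (intro mult_left_mono) auto
      then have "hnorm (view p l ?y) \<le> D" using l by (simp add: hnorm_view)
      moreover have "?y \<in> K" by (rule word_map_K[OF wl z])
      ultimately obtain u where u: "u \<in> G" "dist (view p l ?y) u \<le> e * rmin" using insideD[OF pl(3)] by blast
      have "view p l ?y = h \<odot> hdil s z"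
        by (simp add: view_def g h_def s_def hdil_hmult hdil_hdil hmult_assoc)
      then have d: "dist (h \<odot> hdil s z) u \<le> e * rmin" using u(2) by simp
      have "dist (hdil s z) (hinv h \<odot> u) = dist (h \<odot> hdil s z) u"
        by (metis dist_hinv_left dist_commute)
      moreover have "dist (hdil s z) (hinv h \<odot> u) = s * dist z (hdil (1 / s) (hinv h \<odot> u))"
        using s(2) dist_hdil[of s z "hdil (1 / s) (hinv h \<odot> u)"] by (simp add: hdil_hdil)
      ultimately have "s * dist z (hdil (1 / s) (hinv h \<odot> u)) \<le> e * rmin" using d by simp
      also have "\<dots> \<le> s * e" using s(1) e by (simp add: mult.commute mult_left_mono)
      finally have "dist z (hdil (1 / s) (hinv h \<odot> u)) \<le> e" using s(2) by simp
      then have "dist z (hdil (1 / s) (hinv h) \<odot> hdil (1 / s) u) \<le> e" by (simp add: hdil_hmult)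
      then show ?thesis using dil[OF u(1)] by blast
    qed
    then show ?thesis by blast
  qed
  have "\<exists>a. \<forall>z\<in>K. \<exists>f\<in>G. dist z (a \<odot> f) \<le> 1 / real (Suc j)" for j by (rule near) simp
  then obtain a where a: "\<And>j. \<forall>z\<in>K. \<exists>f\<in>G. dist z (a j \<odot> f) \<le> 1 / real (Suc j)" by metis
  have conv: "\<exists>f. (\<forall>j. f j \<in> G) \<and> (\<lambda>j. a j \<odot> f j) \<longlonglongrightarrow> z" if z: "z \<in> K" for z
  proof -
    have "\<forall>j. \<exists>f. f \<in> G \<and> dist z (a j \<odot> f) \<le> 1 / real (Suc j)" using a z by blast
    then obtain f where f: "\<And>j. f j \<in> G" "\<And>j. dist z (a j \<odot> f j) \<le> 1 / real (Suc j)" by metis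
    have "(\<lambda>j. dist (a j \<odot> f j) z) \<longlonglongrightarrow> 0"
    proof (rule tendsto_sandwich[of "\<lambda>_. 0" _ _ "\<lambda>j. 1 / real (Suc j)"])
      show "(\<lambda>j. 1 / real (Suc j)) \<longlonglongrightarrow> 0" using LIMSEQ_inverse_real_of_nat by (simp add: inverse_eq_divide)
    qed (use f(2) in \<open>auto simp: dist_commute intro!: always_eventually\<close>)
    then have "(\<lambda>j. a j \<odot> f j) \<longlonglongrightarrow> z" by (rule tendsto_dist_iff[THEN iffD2])
    with f(1) show ?thesis by blast
  qed
  obtain z0 where z0: "z0 \<in> K" using K(2) by blast
  obtain f0 where f0: "\<And>j. f0 j \<in> G" "(\<lambda>j. a j \<odot> f0 j) \<longlonglongrightarrow> z0" using conv[OF z0] by blast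
  have "K \<subseteq> (\<lambda>p. z0 \<odot> p) ` G"
  proof
    fix z assume "z \<in> K"
    then obtain f where f: "\<And>j. f j \<in> G" "(\<lambda>j. a j \<odot> f j) \<longlonglongrightarrow> z" using conv by blast
    \<comment> \<open>The elements \<open>a j\<close> cancel in the quotient of two approximations,
      which therefore lies in the closed group \<open>G\<close>.\<close>
    have "(\<lambda>j. hinv (a j \<odot> f0 j) \<odot> (a j \<odot> f j)) \<longlonglongrightarrow> hinv z0 \<odot> z" by (intro tendsto_intros f0 f)
    moreover have "hinv (a j \<odot> f0 j) \<odot> (a j \<odot> f j) = hinv (f0 j) \<odot> f j" for j
      by (simp add: hinv_mult hmult_assoc)
    ultimately have "(\<lambda>j. hinv (f0 j) \<odot> f j) \<longlonglongrightarrow> hinv z0 \<odot> z" by simp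
    then have "hinv z0 \<odot> z \<in> G" by (rule closed_sequentially[OF clG grp[OF f0(1) f(1)]])
    then show "z \<in> (\<lambda>p. z0 \<odot> p) ` G" by (metis hinv_cancel(2) image_eqI)
  qed
  then show ?thesis by blast
qed

theorem riesz_unbounded:
  assumes osc: "open_set_condition I S" and m: "m \<le> 2 * CARD('n) + 1"
    and pos: "0 < emeasure (hausdorff_measure m) K" and fin: "emeasure (hausdorff_measure m) K < \<infinity>"
    and bdd: "riesz_bounded_in_L2 (hausdorff_on m K) (real m)"
  shows "\<exists>F \<in> translates (vertical_subgroups (m - 1)) \<union> translates (horizontal_subgroups m). K \<subseteq> F"
proof -
  have clK: "closed K" using K(1) by (rule compact_imp_closed)
  have HK: "emeasure (hausdorff_measure m) K = hausdorff_outer m K"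
    by (rule emeasure_hausdorff_measure) (simp add: clK)
  define \<mu> where "\<mu> = hausdorff_on m K"
  have em: "emeasure \<mu> A = hausdorff_outer m (K \<inter> A)" if "A \<in> sets borel" for A
    unfolding \<mu>_def by (rule emeasure_hausdorff_on[OF clK that])
  have sp: "space \<mu> = UNIV" by (simp add: \<mu>_def hausdorff_on_def)
  have "finite_measure \<mu>" by (rule finite_measureI) (use em[of UNIV] fin HK sp in simp)
  then interpret borel_finite_measure \<mu>
    by (rule borel_finite_measure.intro) (simp add: borel_finite_measure_axioms_def \<mu>_def)
  have nul: "emeasure \<mu> (- K) = 0" using em[of "- K"] clK by (simp add: hausdorff_outer_empty)
  have "AE p in \<mu>. p \<in> K"
    by (rule AE_I'[of "- K"]) (use nul clK in \<open>auto intro!: null_setsI borel_open\<close>)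
  moreover have "emeasure \<mu> UNIV \<noteq> 0" using em[of UNIV] pos HK by simp
  moreover have "riesz_bounded_in_L2 \<mu> (real m)" using bdd by (simp add: \<mu>_def)
  ultimately obtain M :: nat where M: "emeasure \<mu> (closure {p \<in> K. \<forall>k. riesz_maximal \<mu> (real m) k (\<lambda>_. 1) p \<le> of_nat M}) \<noteq> 0"
    using riesz_good_set[of m K] by blast
  define E where "E = {p \<in> K. \<forall>k. riesz_maximal \<mu> (real m) k (\<lambda>_. 1) p \<le> of_nat M}"
  have tr: "\<bar>riesz_truncated \<mu> (real m) k e (\<lambda>_. 1) p\<bar> \<le> real M" if p: "p \<in> E" "0 < e" for p k e
  proof -
    have "ennreal \<bar>riesz_truncated \<mu> (real m) k e (\<lambda>_. 1) p\<bar> \<le> riesz_maximal \<mu> (real m) k (\<lambda>_. 1) p"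
      unfolding riesz_maximal_def by (rule SUP_upper) (use p(2) in simp)
    also have "\<dots> \<le> ennreal (real M)" using p(1) by (simp add: E_def ennreal_of_nat_eq_real_of_nat)
    finally show ?thesis by (simp add: ennreal_le_iff)
  qed
  obtain C where C: "\<And>p t. 0 < t \<Longrightarrow> measure \<mu> (cball p t) \<le> C * t ^ m"
    using ad_regular_upper[OF osc, of m] fin HK unfolding \<mu>_def by auto
  obtain c where c: "0 < c" "\<And>p t. p \<in> K \<Longrightarrow> 0 < t \<Longrightarrow> t \<le> 1 \<Longrightarrow> c * t ^ m \<le> measure \<mu> (cball p t)"
    using ad_regular_lower[of m] fin pos HK unfolding \<mu>_def by auto
  interpret A: ad_riesz \<mu> K E m c C "2 * real M"
  proof
    fix k p and a b :: real
    assume p: "p \<in> E" "0 < a" "a < b"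
    show "\<bar>LINT y:{y. a < dist p y \<and> dist p y \<le> b}|\<mu>. riesz_kernel (real m) k (hinv p \<odot> y)\<bar> \<le> 2 * real M"
      using tr[OF p(1,2), of k] tr[OF p(1) order.strict_trans[OF p(2,3)], of k]
      unfolding riesz_annulus[OF p(2,3)] by linarith
  qed (use K(1) nul C c M in \<open>auto simp: E_def\<close>)
  obtain X L where X: "X \<in> A.tangents" and L: "subspace L"
    and XL: "X = vert_group L \<or> X = hor_group L \<and> (\<forall>x\<in>L. \<forall>y\<in>L. hform x y = 0)"
    using A.tangent_subgroup[OF A.tangents_nonempty] by blast
  have "\<exists>a. K \<subseteq> (\<lambda>p. a \<odot> p) ` X"
  proof (rule subset_translate_of_tangent_group)
    show "closed X" by (rule A.closed_tangents[OF X])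
    show "hdil s p \<in> X" if "p \<in> X" for s p using hdil_groups[OF L that] XL by blast
    show "hinv p \<odot> p' \<in> X" if "p \<in> X" "p' \<in> X" for p p' by (rule hmult_groups[OF L that XL])
    fix e R :: real assume eR: "0 < e" "0 < R"
    show "\<exists>p\<in>K. \<exists>l\<ge>R. inside (view p l ` K) X e R"
      by (rule A.tangentsD[OF X eR]) (use A.E_sub in blast)
  qed
  then obtain a where a: "K \<subseteq> (\<lambda>p. a \<odot> p) ` X" by blast
  have DIM: "DIM(real ^ ('n + 'n)) = 2 * CARD('n)" by (simp add: card_UNIV_sum)
  have dimL: "dim L \<le> 2 * CARD('n)" using dim_subset_UNIV[of L] DIM by simp
  from XL show ?thesis
  proof
    assume V: "X = vert_group L"
    \<comment> \<open>Counting gives only an inequality, but a vertical group may be enlarged;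
      \<open>vertical_subgroups (m - 1)\<close> asks for \<open>dim L' + 1 = m - 1\<close>.\<close>
    have d: "dim L + 2 \<le> m" using A.dim_vert_group X L V by simp
    then have "dim L \<le> m - 2" "m - 2 \<le> DIM(real ^ ('n + 'n))" using m DIM by auto
    from subspace_extend_dim[OF L this]
    obtain L' where L': "subspace L'" "L \<subseteq> L'" "dim L' = m - 2" by blast
    have "{p. hor p \<in> L'} \<in> (vertical_subgroups (m - 1) :: 'n heis set set)"
      unfolding vertical_subgroups_def using L' m d by (intro CollectI exI[of _ L']) auto
    then have "htrans a ` {p. hor p \<in> L'} \<in> translates (vertical_subgroups (m - 1))"
      unfolding translates_def by blast
    moreover have "K \<subseteq> htrans a ` {p. hor p \<in> L'}"
      using a L'(2) unfolding V vert_group_def htrans_def[abs_def] by blast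
    ultimately show ?thesis by blast
  next
    assume W: "X = hor_group L \<and> (\<forall>x\<in>L. \<forall>y\<in>L. hform x y = 0)"
    \<comment> \<open>An isotropic subspace need not extend to a larger isotropic one, so equality
      is required here, and the reverse bound comes from a net of \<open>K\<close> inside the
      translate.\<close>
    have "dim L \<le> m" using A.dim_hor_group X L W by simp
    moreover have "m \<le> dim L" using A.dim_isotropic_ge[OF L _ a[unfolded W[THEN conjunct1]]] W by blast
    ultimately have "dim L = m" by simp
    then have "{p. hor p \<in> L \<and> vert p = 0} \<in> (horizontal_subgroups m :: 'n heis set set)"
      unfolding horizontal_subgroups_def using L W dimL by (intro CollectI exI[of _ L]) auto
    then have "htrans a ` {p. hor p \<in> L \<and> vert p = 0} \<in> translates (horizontal_subgroups m)"
      unfolding translates_def by blast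
    moreover have "K \<subseteq> htrans a ` {p. hor p \<in> L \<and> vert p = 0}"
      using a W unfolding hor_group_def htrans_def[abs_def] by blast
    ultimately show ?thesis by blast
  qed
qed

end

section \<open>Equal contraction ratios and strong separation\<close>

lemma hausdorff_premeasure_finite_Union:
  assumes "finite W" "0 < \<delta>"
  shows "hausdorff_premeasure m \<delta> (\<Union>w\<in>W. A w) \<le> (\<Sum>w\<in>W. hausdorff_premeasure m \<delta> (A w))"
  using assms(1)
proof (induction W)
  case (insert w W)
  let ?B = "\<lambda>n::nat. if n = 0 then A w else if n = 1 then (\<Union>w\<in>W. A w) else {}"
  have "(\<Union>n. ?B n) = (\<Union>w\<in>insert w W. A w)" by (auto split: if_splits)
  then have "hausdorff_premeasure m \<delta> (\<Union>w\<in>insert w W. A w) \<le> (\<Sum>n. hausdorff_premeasure m \<delta> (?B n))"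
    using hausdorff_premeasure_subadditive[of m \<delta> ?B] by simp
  also have "\<dots> = (\<Sum>n\<in>{0, 1}. hausdorff_premeasure m \<delta> (?B n))"
    by (rule suminf_finite) (auto simp: hausdorff_premeasure_empty[OF assms(2)])
  also have "\<dots> = hausdorff_premeasure m \<delta> (A w) + hausdorff_premeasure m \<delta> (\<Union>w\<in>W. A w)" by simp
  also have "\<dots> \<le> hausdorff_premeasure m \<delta> (A w) + (\<Sum>w\<in>W. hausdorff_premeasure m \<delta> (A w))"
    by (rule add_left_mono[OF insert.IH])
  finally show ?case using insert.hyps by simp
qed (simp add: hausdorff_premeasure_empty[OF assms(2)])

lemma hausdorff_premeasure_single:
  assumes "bounded U" "diameter U \<le> \<delta>" "0 < \<delta>"
  shows "hausdorff_premeasure m \<delta> U \<le> ennreal (diameter U ^ m)"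
proof -
  let ?V = "\<lambda>i::nat. if i = 0 then U else {}"
  have "?V \<in> hausdorff_covers \<delta> U" using assms by (auto simp: hausdorff_covers_def)
  then have "hausdorff_premeasure m \<delta> U \<le> (\<Sum>i. hausdorff_weight m (?V i))" by (rule hausdorff_premeasure_le)
  also have "\<dots> = (\<Sum>i\<in>{0}. hausdorff_weight m (?V i))" by (rule suminf_finite) auto
  also have "\<dots> \<le> ennreal (diameter U ^ m)" by (simp add: hausdorff_weight_def)
  finally show ?thesis .
qed

text \<open>Covering sets of diameter 0 also need a positive radius, at a cost of at most
  \<open>e\<close> in the \<open>m\<close>-th power.\<close>

lemma enlarge_power:
  fixes d e :: real
  assumes "0 \<le> d" "d < 1" "0 < e"
  shows "\<exists>\<rho>>d. \<rho> \<le> 1 \<and> \<rho> ^ m \<le> d ^ m + e"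
proof -
  have "isCont (\<lambda>x::real. x ^ m) d" by (intro continuous_intros)
  then obtain s where s: "0 < s" "\<And>x. dist x d < s \<Longrightarrow> dist (x ^ m) (d ^ m) < e"
    using assms(3) unfolding continuous_at_eps_delta by blast
  define \<rho> where "\<rho> = d + min (s / 2) (1 - d)"
  have "d < \<rho>" "\<rho> \<le> 1" "dist \<rho> d < s" using assms s(1) by (auto simp: \<rho>_def dist_real_def)
  moreover from s(2)[OF this(3)] have "\<rho> ^ m \<le> d ^ m + e" unfolding dist_real_def by linarith
  ultimately show ?thesis by blast
qed

lemma power_scale_between:
  fixes r \<rho> :: real
  assumes "0 < r" "r < 1" "0 < \<rho>" "\<rho> \<le> 1"
  shows "\<exists>k. \<rho> \<le> r ^ k \<and> r ^ Suc k < \<rho>"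
proof -
  obtain n where n: "r ^ n < \<rho>" using real_arch_pow_inv[OF assms(3,2)] by blast
  define k where "k = (LEAST n. r ^ n < \<rho>)"
  have k: "r ^ k < \<rho>" unfolding k_def by (rule LeastI[of "\<lambda>n. r ^ n < \<rho>", OF n])
  then have "k \<noteq> 0" using assms(4) by (cases k) auto
  then obtain j where j: "k = Suc j" by (cases k) auto
  then have "\<not> r ^ j < \<rho>" unfolding k_def by (metis lessI not_less_Least)
  then show ?thesis using k j by (intro exI[of _ j]) auto
qed

context heis_ifs
begin

text \<open>Compactness puts the pieces of \<open>K\<close> a positive distance \<open>e\<close>
  apart. The \<open>e / 2\<close>-neighbourhood of \<open>K\<close> then witnesses the condition,
  since each \<open>S i\<close> shrinks distances.\<close>

lemma open_set_condition_of_disjoint: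
  assumes disj: "\<And>i j. i \<in> I \<Longrightarrow> j \<in> I \<Longrightarrow> i \<noteq> j \<Longrightarrow> S i ` K \<inter> S j ` K = {}"
  shows "open_set_condition I S"
proof -
  have cS: "compact (S i ` K)" if "i \<in> I" for i
    by (rule compact_continuous_image[OF continuous_S[OF that] K(1)])
  have "\<exists>d>0. \<forall>x\<in>S (fst p) ` K. \<forall>y\<in>S (snd p) ` K. d \<le> dist x y"
    if p: "p \<in> {p \<in> I \<times> I. fst p \<noteq> snd p}" for p
    by (rule separate_compact_closed[OF cS compact_imp_closed[OF cS] disj]) (use p in auto)
  then have "\<forall>p\<in>{p \<in> I \<times> I. fst p \<noteq> snd p}. \<exists>d. 0 < d \<and> (\<forall>x\<in>S (fst p) ` K. \<forall>y\<in>S (snd p) ` K. d \<le> dist x y)"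
    by (intro ballI)
  from bchoice[OF this] obtain d where d: "\<forall>p\<in>{p \<in> I \<times> I. fst p \<noteq> snd p}. 0 < d p \<and>
      (\<forall>x\<in>S (fst p) ` K. \<forall>y\<in>S (snd p) ` K. d p \<le> dist x y)" ..
  define e where "e = Min (insert 1 (d ` {p \<in> I \<times> I. fst p \<noteq> snd p}))"
  have fin: "finite (insert 1 (d ` {p \<in> I \<times> I. fst p \<noteq> snd p}))" using finite_I by simp
  have e0: "0 < e" unfolding e_def using fin d by (subst Min_gr_iff) auto
  have e: "e \<le> dist (S i x) (S j y)" if "i \<in> I" "j \<in> I" "i \<noteq> j" "x \<in> K" "y \<in> K" for i j x y
  proof -
    have "e \<le> d (i, j)" unfolding e_def using fin that by (intro Min_le) auto
    also have "\<dots> \<le> dist (S i x) (S j y)" using bspec[OF d, of "(i, j)"] that by auto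
    finally show ?thesis .
  qed
  define U where "U = (\<Union>y\<in>K. ball y (e / 2))"
  have "bounded U"
  proof -
    obtain R where R: "\<And>y. y \<in> K \<Longrightarrow> dist hzero y \<le> R"
      using bounded_any_center[of K hzero] compact_imp_bounded[OF K(1)] by blast
    have "dist hzero x \<le> R + e / 2" if x: "x \<in> U" for x
    proof -
      obtain y where "y \<in> K" "dist y x < e / 2" using x by (auto simp: U_def)
      then show ?thesis using R[of y] dist_triangle[of hzero x y] by linarith
    qed
    then show ?thesis unfolding bounded_def by blast
  qed
  moreover have "open U" unfolding U_def by blast
  moreover have "U \<noteq> {}" using K(2) e0 by (auto simp: U_def)
  moreover have "(\<Union>i\<in>I. S i ` U) \<subseteq> U"
  proof clarify
    fix i x assume i: "i \<in> I" and "x \<in> U"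
    then obtain y where y: "y \<in> K" "dist y x < e / 2" by (auto simp: U_def)
    have "dist (S i y) (S i x) \<le> dist y x"
      using r[OF i] by (simp add: dist_S[OF i] mult_left_le_one_le)
    moreover have "S i y \<in> K" using y(1) i K(3) by blast
    ultimately show "S i x \<in> U" using y(2) by (auto simp: U_def intro!: bexI[of _ "S i y"])
  qed
  moreover have disjU: "S i ` U \<inter> S j ` U = {}" if ij: "i \<in> I" "j \<in> I" "i \<noteq> j" for i j
  proof (rule ccontr)
    assume "S i ` U \<inter> S j ` U \<noteq> {}"
    then obtain x x' where x: "x \<in> U" "x' \<in> U" "S i x = S j x'" by blast
    then obtain y y' where y: "y \<in> K" "dist y x < e / 2" "y' \<in> K" "dist y' x' < e / 2" by (auto simp: U_def)
    have "dist (S i y) (S i x) \<le> dist y x" using r[OF ij(1)] by (simp add: dist_S[OF ij(1)] mult_left_le_one_le)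
    moreover have "dist (S j y') (S j x') \<le> dist y' x'" using r[OF ij(2)] by (simp add: dist_S[OF ij(2)] mult_left_le_one_le)
    moreover have "dist (S i y) (S j y') \<le> dist (S i y) (S i x) + dist (S j y') (S j x')"
      using dist_triangle2[of "S i y" "S j y'" "S i x"] x(3) by simp
    ultimately show False using e[OF ij y(1,3)] y(2,4) by linarith
  qed
  ultimately show ?thesis
    unfolding open_set_condition_def by (intro exI[of _ U] conjI ballI impI disjU)
qed

end

text \<open>\<open>dimension\<close> is Moran's equation: \<open>m\<close> is the similarity
  dimension of \<open>card I\<close> maps of common ratio \<open>\<rho>\<close>.\<close>

locale uniform_ifs = heis_ifs I S q "\<lambda>_. \<rho>"
  for I :: "'i set" and S :: "'i \<Rightarrow> 'n::finite heis \<Rightarrow> 'n heis" and q and \<rho> :: real +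
  fixes m :: nat
  assumes dimension: "real (card I) * \<rho> ^ m = 1"
begin

lemma \<rho>: "0 < \<rho>" "\<rho> < 1"
  using r I_nonempty by auto

definition words :: "nat \<Rightarrow> 'i list set" where
  "words n = {w \<in> lists I. length w = n}"

lemma words_alt: "words n = {w. set w \<subseteq> I \<and> length w = n}"
  by (auto simp: words_def)

lemma finite_words [simp]: "finite (words n)"
  unfolding words_alt by (rule finite_lists_length_eq[OF finite_I])

lemma card_words: "card (words n) = card I ^ n"
  unfolding words_alt by (rule card_lists_length_eq[OF finite_I])

lemma ratio_eq: "ratio w = \<rho> ^ length w"
  by (induction w) auto

lemma words_cut: "w \<in> words n \<Longrightarrow> w \<in> cut (\<rho> ^ n)"
  unfolding cut_def words_def using \<rho> by (auto simp: ratio_eq intro!: power_strict_decreasing)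

lemma words_cover: "p \<in> K \<Longrightarrow> \<exists>w\<in>words n. p \<in> word_map w ` K"
proof (induction n arbitrary: p)
  case 0
  then show ?case by (intro bexI[of _ "[]"]) (auto simp: words_def)
next
  case (Suc n)
  obtain i y where iy: "i \<in> I" "y \<in> K" "p = S i y" using Suc.prems K(3) by blast
  obtain w where "w \<in> words n" "y \<in> word_map w ` K" using Suc.IH[OF iy(2)] by blast
  then show ?case using iy by (intro bexI[of _ "i # w"]) (auto simp: words_def)
qed

lemma word_map_append: "word_map (u @ v) p = word_map u (word_map v p)"
  by (induction u) auto

text \<open>The cells of length \<open>n\<close> form a cover of total weight at most
  \<open>(card I * \<rho> ^ m) ^ n * D ^ m = D ^ m\<close>, for every \<open>n\<close>.\<close>

lemma hausdorff_outer_finite: "hausdorff_outer m K < \<infinity>"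
proof -
  define D where "D = max 1 (diameter K)"
  have D: "1 \<le> D" "\<And>x y. x \<in> K \<Longrightarrow> y \<in> K \<Longrightarrow> dist x y \<le> D"
    using diameter_bounded_bound[OF compact_imp_bounded[OF K(1)]] by (auto simp: D_def intro: max.coboundedI2)
  have "hausdorff_premeasure m \<delta> K \<le> ennreal (D ^ m)" if \<delta>: "0 < \<delta>" for \<delta>
  proof -
    have "0 < \<delta> / D" using \<delta> D(1) by simp
    then obtain n where n: "\<rho> ^ n < \<delta> / D" using real_arch_pow_inv[OF _ \<rho>(2)] by blast
    then have nD: "\<rho> ^ n * D \<le> \<delta>" using D(1) by (simp add: pos_less_divide_eq)
    have one: "hausdorff_premeasure m \<delta> (word_map w ` K) \<le> ennreal ((\<rho> ^ n * D) ^ m)" if w: "w \<in> words n" for w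
    proof -
      have wl: "w \<in> lists I" "length w = n" using w by (auto simp: words_def)
      have dist: "dist x y \<le> \<rho> ^ n * D" if xy: "x \<in> word_map w ` K" "y \<in> word_map w ` K" for x y
        using xy D(2) \<rho>(1) by (auto simp: dist_word_map[OF wl(1)] ratio_eq wl(2) intro!: mult_left_mono)
      have ne: "word_map w ` K \<noteq> {}" using K(2) by simp
      have dia: "diameter (word_map w ` K) \<le> \<rho> ^ n * D" by (rule diameter_le_dist[OF ne dist])
      have bd: "bounded (word_map w ` K)" using dist ne unfolding bounded_def by blast
      have "hausdorff_premeasure m \<delta> (word_map w ` K) \<le> ennreal (diameter (word_map w ` K) ^ m)"
        by (rule hausdorff_premeasure_single[OF bd _ \<delta>]) (use dia nD in linarith)
      also have "\<dots> \<le> ennreal ((\<rho> ^ n * D) ^ m)"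
        by (intro ennreal_leI power_mono dia diameter_ge_0 bd)
      finally show ?thesis .
    qed
    have "K \<subseteq> (\<Union>w\<in>words n. word_map w ` K)" using words_cover by blast
    then have "hausdorff_premeasure m \<delta> K \<le> hausdorff_premeasure m \<delta> (\<Union>w\<in>words n. word_map w ` K)"
      by (rule hausdorff_premeasure_mono) simp
    also have "\<dots> \<le> (\<Sum>w\<in>words n. hausdorff_premeasure m \<delta> (word_map w ` K))"
      by (rule hausdorff_premeasure_finite_Union[OF finite_words \<delta>])
    also have "\<dots> \<le> (\<Sum>w\<in>words n. ennreal ((\<rho> ^ n * D) ^ m))" by (rule sum_mono[OF one])
    also have "\<dots> = ennreal (real (card I) ^ n * (\<rho> ^ n * D) ^ m)"
      using \<rho>(1) D(1) by (simp add: card_words ennreal_of_nat_eq_real_of_nat ennreal_mult[symmetric])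
    also have "real (card I) ^ n * (\<rho> ^ n * D) ^ m = (real (card I) * \<rho> ^ m) ^ n * D ^ m"
      by (simp add: power_mult_distrib power_mult[symmetric] mult.commute)
    finally show ?thesis by (simp add: dimension)
  qed
  then have "hausdorff_outer m K \<le> ennreal (D ^ m)" unfolding hausdorff_outer_def by (intro SUP_least) simp
  also have "\<dots> < \<infinity>" by simp
  finally show ?thesis .
qed

text \<open>Mass distribution principle, with the mass of a set replaced by the number of long words hitting it.\<close>

lemma hausdorff_outer_positive:
  assumes osc: "open_set_condition I S"
  shows "0 < hausdorff_outer m K"
proof -
  obtain N :: nat where N: "\<And>p t. 0 < t \<Longrightarrow> t \<le> 1 \<Longrightarrow>
    finite {w \<in> cut t. word_map w ` K \<inter> cball p t \<noteq> {}} \<and>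
    card {w \<in> cut t. word_map w ` K \<inter> cball p t \<noteq> {}} \<le> N" using cut_overlap[OF osc] by blast
  \<comment> \<open>A word hitting the ball has its prefix of length \<open>k\<close> among at most
    \<open>N\<close> words of the cut at \<open>\<rho> ^ k\<close>; the other \<open>n - k\<close>
    letters are free.\<close>
  have hits: "card {w \<in> words n. word_map w ` K \<inter> cball p (\<rho> ^ k) \<noteq> {}} \<le> N * card I ^ (n - k)"
    if k: "k \<le> n" for n k p
  proof -
    let ?C = "{u \<in> cut (\<rho> ^ k). word_map u ` K \<inter> cball p (\<rho> ^ k) \<noteq> {}}"
    have C: "finite ?C" "card ?C \<le> N" using N[of "\<rho> ^ k" p] \<rho> by (auto simp: power_le_one)
    have "{w \<in> words n. word_map w ` K \<inter> cball p (\<rho> ^ k) \<noteq> {}} \<subseteq> (\<lambda>(u, v). u @ v) ` (?C \<times> words (n - k))"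
    proof
      fix w assume "w \<in> {w \<in> words n. word_map w ` K \<inter> cball p (\<rho> ^ k) \<noteq> {}}"
      then obtain x where w: "w \<in> words n" and x: "x \<in> K" "word_map w x \<in> cball p (\<rho> ^ k)" by blast
      have tv: "take k w \<in> words k" "drop k w \<in> words (n - k)"
        using w k by (auto simp: words_alt dest: in_set_takeD in_set_dropD)
      have "word_map w x = word_map (take k w) (word_map (drop k w) x)"
        using word_map_append[of "take k w" "drop k w" x] by simp
      moreover have "word_map (drop k w) x \<in> K" using tv(2) x(1) by (intro word_map_K) (auto simp: words_def)
      ultimately have "take k w \<in> ?C" using words_cut[OF tv(1)] x(2) by auto
      then show "w \<in> (\<lambda>(u, v). u @ v) ` (?C \<times> words (n - k))"
        using tv(2) by (intro image_eqI[of _ _ "(take k w, drop k w)"]) auto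
    qed
    then have "card {w \<in> words n. word_map w ` K \<inter> cball p (\<rho> ^ k) \<noteq> {}}
        \<le> card ((\<lambda>(u, v). u @ v) ` (?C \<times> words (n - k)))"
      by (rule card_mono[rotated]) (use C(1) in simp)
    also have "\<dots> \<le> card (?C \<times> words (n - k))" by (rule card_image_le) (use C(1) in simp)
    also have "\<dots> \<le> N * card I ^ (n - k)" using C(2) by (simp add: card_cartesian_product card_words)
    finally show ?thesis .
  qed
  \<comment> \<open>\<open>\<rho> ^ m\<close> pays for rounding radii up to powers of
    \<open>\<rho>\<close>, the denominator for the cells met by one ball.\<close>
  define c where "c = \<rho> ^ m / (real N + 1)"
  have c0: "0 < c" using \<rho> by (simp add: c_def)
  have main: "ennreal c \<le> (\<Sum>i. hausdorff_weight m (U i)) + ennreal e"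
    if U: "U \<in> hausdorff_covers (1/2) K" and e: "0 < e" for U and e :: real
  proof -
    define d where "d i = diameter (U i)" for i
    have b: "bounded (U i)" "0 \<le> d i" "d i < 1" for i
    proof -
      show "bounded (U i)" using U by (auto simp: hausdorff_covers_def)
      then show "0 \<le> d i" unfolding d_def by (rule diameter_ge_0)
      have "d i \<le> 1/2" using U by (auto simp: hausdorff_covers_def d_def)
      then show "d i < 1" by simp
    qed
    \<comment> \<open>Radii slightly above the diameters give open balls, hence a finite subcover;
      the excess of the \<open>m\<close>-th powers sums to at most \<open>e\<close>.\<close>
    have "\<exists>t>d i. t \<le> 1 \<and> t ^ m \<le> d i ^ m + e * (1/2) ^ Suc i" for i
      by (rule enlarge_power) (use b e in auto)
    then obtain t where t: "\<And>i. d i < t i" "\<And>i. t i \<le> 1" "\<And>i. t i ^ m \<le> d i ^ m + e * (1/2) ^ Suc i" by metis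
    have t0: "0 < t i" for i using t(1)[of i] b(2)[of i] by linarith
    have "\<exists>k. t i \<le> \<rho> ^ k \<and> \<rho> ^ Suc k < t i" for i by (rule power_scale_between[OF \<rho> t0 t(2)])
    then obtain k where k: "\<And>i. t i \<le> \<rho> ^ k i" "\<And>i. \<rho> ^ Suc (k i) < t i" by metis
    define J where "J = {i. U i \<inter> K \<noteq> {}}"
    have "\<exists>x. i \<in> J \<longrightarrow> x \<in> U i" for i by (auto simp: J_def)
    then obtain p where p: "\<And>i. i \<in> J \<Longrightarrow> p i \<in> U i" by metis
    have cov: "K \<subseteq> (\<Union>i\<in>J. ball (p i) (t i))"
    proof
      fix x assume x: "x \<in> K"
      then obtain i where i: "x \<in> U i" using U by (auto simp: hausdorff_covers_def)
      then have iJ: "i \<in> J" using x by (auto simp: J_def)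
      have "dist (p i) x \<le> d i" unfolding d_def by (rule diameter_bounded_bound[OF b(1) p[OF iJ] i])
      then show "x \<in> (\<Union>i\<in>J. ball (p i) (t i))" using t(1)[of i] iJ by force
    qed
    obtain F where F: "F \<subseteq> J" "finite F" "K \<subseteq> (\<Union>i\<in>F. ball (p i) (t i))"
      by (rule compactE_image[OF K(1) _ cov]) auto
    \<comment> \<open>A word length at least every \<open>k i\<close>, so that the words hitting the
      different balls are counted at one level.\<close>
    define n where "n = Max (insert 0 (k ` F))"
    have kn: "k i \<le> n" if "i \<in> F" for i unfolding n_def using F(2) that by (intro Max_ge) auto
    have "words n \<subseteq> (\<Union>i\<in>F. {w \<in> words n. word_map w ` K \<inter> cball (p i) (\<rho> ^ k i) \<noteq> {}})"
    proof
      fix w assume w: "w \<in> words n"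
      obtain x where x: "x \<in> K" using K(2) by blast
      have "word_map w x \<in> K" using w x by (intro word_map_K) (auto simp: words_def)
      then obtain i where i: "i \<in> F" "dist (p i) (word_map w x) < t i" using F(3) by auto
      then have "word_map w x \<in> word_map w ` K \<inter> cball (p i) (\<rho> ^ k i)" using x k(1)[of i] by auto
      then show "w \<in> (\<Union>i\<in>F. {w \<in> words n. word_map w ` K \<inter> cball (p i) (\<rho> ^ k i) \<noteq> {}})"
        using w i(1) by blast
    qed
    then have "card (words n) \<le> card (\<Union>i\<in>F. {w \<in> words n. word_map w ` K \<inter> cball (p i) (\<rho> ^ k i) \<noteq> {}})"
      by (rule card_mono[rotated]) (use F(2) in simp)
    also have "\<dots> \<le> (\<Sum>i\<in>F. card {w \<in> words n. word_map w ` K \<inter> cball (p i) (\<rho> ^ k i) \<noteq> {}})"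
      by (rule card_UN_le[OF F(2)])
    also have "\<dots> \<le> (\<Sum>i\<in>F. N * card I ^ (n - k i))" by (rule sum_mono) (rule hits[OF kn])
    finally have "real (card I ^ n) \<le> real (\<Sum>i\<in>F. N * card I ^ (n - k i))" unfolding card_words by (rule of_nat_mono)
    then have le: "real (card I) ^ n \<le> (\<Sum>i\<in>F. real N * real (card I) ^ (n - k i))" by simp
    have Q: "0 < real (card I)" using finite_I I_nonempty by (simp add: card_gt_0_iff)
    have "(\<Sum>i\<in>F. real N * real (card I) ^ (n - k i)) \<le> (\<Sum>i\<in>F. real (card I) ^ n * (t i ^ m / c))"
    proof (rule sum_mono)
      fix i assume i: "i \<in> F"
      have "(real (card I) * \<rho> ^ m) ^ k i = 1" by (simp add: dimension)
      then have 1: "real (card I) ^ k i * (\<rho> ^ k i) ^ m = 1"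
        by (simp add: power_mult_distrib power_mult[symmetric] mult.commute)
      have "real (card I) ^ (n - k i) = real (card I) ^ (n - k i) * (real (card I) ^ k i * (\<rho> ^ k i) ^ m)"
        unfolding 1 by simp
      also have "\<dots> = real (card I) ^ n * (\<rho> ^ k i) ^ m"
        using kn[OF i] by (simp add: mult.assoc[symmetric] power_add[symmetric])
      finally have 2: "real (card I) ^ (n - k i) = real (card I) ^ n * (\<rho> ^ k i) ^ m" .
      have "(\<rho> * \<rho> ^ k i) ^ m \<le> t i ^ m" using k(2)[of i] \<rho>(1) by (intro power_mono) auto
      then have "(\<rho> ^ k i) ^ m \<le> t i ^ m / \<rho> ^ m" using \<rho>(1) by (simp add: power_mult_distrib pos_le_divide_eq mult.commute)
      then have "real N * (\<rho> ^ k i) ^ m \<le> (real N + 1) * (t i ^ m / \<rho> ^ m)" using t0[of i] \<rho>(1) by (intro mult_mono) auto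
      also have "\<dots> = t i ^ m / c" by (simp add: c_def)
      finally have "real (card I) ^ n * (real N * (\<rho> ^ k i) ^ m) \<le> real (card I) ^ n * (t i ^ m / c)"
        by (intro mult_left_mono) auto
      then show "real N * real (card I) ^ (n - k i) \<le> real (card I) ^ n * (t i ^ m / c)"
        unfolding 2 by (simp add: mult.left_commute)
    qed
    with le have "real (card I) ^ n * 1 \<le> real (card I) ^ n * (\<Sum>i\<in>F. t i ^ m / c)"
      by (simp add: sum_distrib_left)
    then have "1 \<le> (\<Sum>i\<in>F. t i ^ m / c)" by (rule mult_left_le_imp_le) (use Q in simp)
    then have "c \<le> (\<Sum>i\<in>F. t i ^ m)" using c0 by (simp add: sum_divide_distrib[symmetric] pos_le_divide_eq)
    also have "\<dots> \<le> (\<Sum>i\<in>F. d i ^ m + e * (1/2) ^ Suc i)" by (rule sum_mono) (rule t(3))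
    finally have "ennreal c \<le> ennreal (\<Sum>i\<in>F. d i ^ m + e * (1/2) ^ Suc i)" by (rule ennreal_leI)
    also have "\<dots> = (\<Sum>i\<in>F. ennreal (d i ^ m)) + (\<Sum>i\<in>F. ennreal e * ennreal ((1/2) ^ Suc i))"
      using b(2) e by (simp add: sum_ennreal[symmetric] ennreal_plus ennreal_mult[symmetric] sum.distrib[symmetric] del: power_Suc sum_ennreal)
    also have "\<dots> \<le> (\<Sum>i. hausdorff_weight m (U i)) + (\<Sum>i. ennreal e * ennreal ((1/2) ^ Suc i))"
    proof (rule add_mono)
      have "(\<Sum>i\<in>F. ennreal (d i ^ m)) = (\<Sum>i\<in>F. hausdorff_weight m (U i))"
        by (rule sum.cong[OF refl]) (use F(1) in \<open>auto simp: hausdorff_weight_def d_def J_def\<close>)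
      also have "\<dots> \<le> (\<Sum>i. hausdorff_weight m (U i))" by (rule sum_le_suminf) (use F(2) in auto)
      finally show "(\<Sum>i\<in>F. ennreal (d i ^ m)) \<le> (\<Sum>i. hausdorff_weight m (U i))" .
      show "(\<Sum>i\<in>F. ennreal e * ennreal ((1/2) ^ Suc i)) \<le> (\<Sum>i. ennreal e * ennreal ((1/2) ^ Suc i))"
        by (rule sum_le_suminf) (use F(2) in auto)
    qed
    also have "(\<Sum>i. ennreal e * ennreal ((1/2) ^ Suc i)) = ennreal e"
      unfolding ennreal_suminf_cmult by (subst suminf_ennreal_eq[OF zero_le_power power_half_series]) auto
    finally show ?thesis .
  qed
  have "ennreal c \<le> hausdorff_premeasure m (1/2) K"
    unfolding hausdorff_premeasure_def
  proof (rule INF_greatest)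
    fix U assume U: "U \<in> hausdorff_covers (1/2) K"
    show "ennreal c \<le> (\<Sum>i. hausdorff_weight m (U i))"
      by (rule ennreal_le_epsilon) (rule main[OF U])
  qed
  also have "\<dots> \<le> hausdorff_outer m K" unfolding hausdorff_outer_def by (rule SUP_upper) simp
  finally show ?thesis using c0 by (meson ennreal_less_zero_iff order.strict_trans2)
qed

end

section \<open>The Cantor-like sets\<close>

lemma card_cube:
  assumes "(c::real) \<noteq> 0"
  shows "finite {z :: real ^ 'b::finite. \<forall>i. z $ i \<in> {0, c}}" "card {z :: real ^ 'b. \<forall>i. z $ i \<in> {0, c}} = 2 ^ CARD('b)"
proof -
  define f where "f A = (\<chi> i. if i \<in> A then c else 0)" for A :: "'b set"
  have "bij_betw f UNIV {z. \<forall>i. z $ i \<in> {0, c}}"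
  proof (rule bij_betwI[where g = "\<lambda>z. {i. z $ i = c}"])
    show "{i. f A $ i = c} = A" for A using assms by (auto simp: f_def)
    show "f {i. z $ i = c} = z" if "z \<in> {z. \<forall>i. z $ i \<in> {0, c}}" for z
      using that by (auto simp: f_def vec_eq_iff)
  qed (auto simp: f_def)
  from bij_betw_finite[OF this] bij_betw_same_card[OF this]
  show "finite {z :: real ^ 'b. \<forall>i. z $ i \<in> {0, c}}" "card {z :: real ^ 'b. \<forall>i. z $ i \<in> {0, c}} = 2 ^ CARD('b)"
    by (simp_all add: card_UNIV_set flip: Pow_UNIV add: card_Pow)
qed

lemma card_cantor_index:
  assumes "r < 1"
  shows "finite (cantor_index r :: ((real ^ ('n::finite + 'n)) \<times> nat) set)"
    "card (cantor_index r :: ((real ^ ('n + 'n)) \<times> nat) set) = 2 ^ (2 * CARD('n) + 2)"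
proof -
  have r: "1 - r \<noteq> 0" using assms by simp
  show "finite (cantor_index r :: ((real ^ ('n::finite + 'n)) \<times> nat) set)"
    unfolding cantor_index_def by (intro finite_cartesian_product card_cube(1)[OF r]) simp
  have "CARD('n + 'n) = 2 * CARD('n)" by (simp add: card_UNIV_sum)
  note e = this
  show "card (cantor_index r :: ((real ^ ('n + 'n)) \<times> nat) set) = 2 ^ (2 * CARD('n) + 2)"
    unfolding cantor_index_def card_cartesian_product card_cube(2)[OF r] e by simp
qed

text \<open>\<open>dim\<close> is the formula for \<open>r\<close> cleared of the real power; the
  type argument fixes the dimension of the space.\<close>

locale cantor =
  fixes r :: real and n_type :: "'n::finite itself" and m :: nat
  assumes r_bounds: "0 < r" "r < 1 / 2" and dim: "2 ^ (2 * CARD('n) + 2) * r ^ m = 1"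
begin

sublocale uniform_ifs "cantor_index r :: ((real ^ ('n + 'n)) \<times> nat) set" "cantor_map r"
  "\<lambda>(z, k). Heis z (real k / 4)" r m
proof
  have "(0, 0) \<in> (cantor_index r :: ((real ^ ('n + 'n)) \<times> nat) set)" by (simp add: cantor_index_def)
  then show "(cantor_index r :: ((real ^ ('n + 'n)) \<times> nat) set) \<noteq> {}" by blast
qed (use r_bounds dim card_cantor_index[of r, where 'n = 'n] in \<open>auto simp: cantor_map_def\<close>)

lemma hor_map: "hor (cantor_map r (z, k) p) = z + r *\<^sub>R hor p"
  by (simp add: cantor_map_def htrans_def)

lemma vert_map: "vert (cantor_map r (z, k) p) = real k / 4 + r\<^sup>2 * vert p + r * hform z (hor p)"
  by (simp add: cantor_map_def htrans_def hform_scale)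

lemma K_elem:
  assumes "p \<in> K"
  obtains z k y where "(z, k) \<in> cantor_index r" "y \<in> K" "p = cantor_map r (z, k) y"
proof -
  have "p \<in> (\<Union>x\<in>cantor_index r. cantor_map r x ` K)" using assms by (subst K(3)[symmetric])
  then obtain x y where x: "x \<in> cantor_index r" "y \<in> K" "p = cantor_map r x y" by blast
  obtain z k where "x = (z, k)" by (metis surj_pair)
  then show ?thesis using x that by blast
qed

lemma map_K: "(z, k) \<in> cantor_index r \<Longrightarrow> p \<in> K \<Longrightarrow> cantor_map r (z, k) p \<in> K"
  using word_map_K[of "[(z, k)]" p] by simp

text \<open>At a point of \<open>K\<close> minimising a coordinate, that coordinate is at least
  \<open>r\<close> times itself because digits are nonnegative. The maximum is treated in the same
  way.\<close>

lemma K_hor_bounds: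
  assumes "p \<in> K"
  shows "0 \<le> hor p $ i" "hor p $ i \<le> 1"
proof -
  have c: "continuous_on K (\<lambda>p. hor p $ i)"
    by (intro continuous_on_component continuous_on_heis continuous_on_id)
  obtain a where a: "a \<in> K" "\<And>y. y \<in> K \<Longrightarrow> hor a $ i \<le> hor y $ i"
    using continuous_attains_inf[OF K(1,2) c] by blast
  obtain z k y where y: "(z, k) \<in> cantor_index r" "y \<in> K" "a = cantor_map r (z, k) y" using K_elem[OF a(1)] .
  have "0 \<le> z $ i" using y(1) r_bounds unfolding cantor_index_def by (cases "z $ i = 0") auto
  then have "r * (hor a $ i) \<le> hor a $ i"
  proof -
    have "hor a $ i = z $ i + r * (hor y $ i)" unfolding y(3) by (simp add: hor_map)
    moreover have "r * (hor a $ i) \<le> r * (hor y $ i)" using a(2)[OF y(2)] r_bounds by (intro mult_left_mono) auto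
    ultimately show ?thesis using \<open>0 \<le> z $ i\<close> by linarith
  qed
  then have "0 \<le> (1 - r) * (hor a $ i)" by (simp add: algebra_simps)
  then have "0 \<le> hor a $ i" using r_bounds by (simp add: zero_le_mult_iff)
  then show "0 \<le> hor p $ i" using a(2)[OF assms] by linarith
  obtain b where b: "b \<in> K" "\<And>y. y \<in> K \<Longrightarrow> hor y $ i \<le> hor b $ i"
    using continuous_attains_sup[OF K(1,2) c] by blast
  obtain z k y where y: "(z, k) \<in> cantor_index r" "y \<in> K" "b = cantor_map r (z, k) y" using K_elem[OF b(1)] .
  have "z $ i \<le> 1 - r" using y(1) r_bounds unfolding cantor_index_def by (cases "z $ i = 0") auto
  then have "hor b $ i \<le> 1 - r + r * (hor b $ i)"
  proof -
    have "hor b $ i = z $ i + r * (hor y $ i)" unfolding y(3) by (simp add: hor_map)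
    moreover have "r * (hor y $ i) \<le> r * (hor b $ i)" using b(2)[OF y(2)] r_bounds by (intro mult_left_mono) auto
    ultimately show ?thesis using \<open>z $ i \<le> 1 - r\<close> by linarith
  qed
  then have "(1 - r) * (hor b $ i) \<le> (1 - r) * 1" by (simp add: algebra_simps)
  then have "hor b $ i \<le> 1" using r_bounds by (simp add: mult_le_cancel_left_pos)
  then show "hor p $ i \<le> 1" using b(2)[OF assms] by linarith
qed

text \<open>Each coordinate is a digit in \<open>{0, 1 - r}\<close> plus a number in
  \<open>[0, r]\<close>, and the two ranges are disjoint because \<open>r < 1 / 2\<close>.\<close>

lemma same_hor:
  assumes "(z, k) \<in> cantor_index r" "(z', k') \<in> cantor_index r" "p \<in> K" "p' \<in> K"
    and eq: "hor (cantor_map r (z, k) p) = hor (cantor_map r (z', k') p')"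
  shows "z = z'" "hor p = hor p'"
proof -
  have "z $ i = z' $ i" for i
  proof -
    have e: "z $ i + r * (hor p $ i) = z' $ i + r * (hor p' $ i)"
      using arg_cong[OF eq, of "\<lambda>v. v $ i"] by (simp add: hor_map)
    have b: "0 \<le> r * (hor p $ i)" "r * (hor p $ i) \<le> r" "0 \<le> r * (hor p' $ i)" "r * (hor p' $ i) \<le> r"
      using K_hor_bounds[OF assms(3), of i] K_hor_bounds[OF assms(4), of i] r_bounds by (simp_all add: mult_left_le)
    have "z $ i = 0 \<or> z $ i = 1 - r" "z' $ i = 0 \<or> z' $ i = 1 - r"
      using assms(1,2) by (auto simp: cantor_index_def)
    then show ?thesis using e b r_bounds by linarith
  qed
  then show z: "z = z'" by (simp add: vec_eq_iff)
  then show "hor p = hor p'" using eq r_bounds by (simp add: hor_map)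
qed

text \<open>For the largest gap \<open>s\<close> over a common horizontal point the twists cancel,
  the digits differ by at most 3/4, and the rest is a gap scaled by \<open>r\<^sup>2\<close>. So
  \<open>s \<le> 3 / 4 + r\<^sup>2 * s\<close>, and \<open>r\<^sup>2 < 1 / 4\<close> gives
  \<open>s < 1\<close>.\<close>

lemma K_fibre:
  assumes "p \<in> K" "p' \<in> K" "hor p = hor p'"
  shows "\<bar>vert p - vert p'\<bar> < 1"
proof -
  let ?D = "(K \<times> K) \<inter> {x. hor (fst x) = hor (snd x)}"
  have "closed {x :: 'n heis \<times> 'n heis. hor (fst x) = hor (snd x)}"
    by (intro closed_Collect_eq continuous_on_heis continuous_on_fst continuous_on_snd continuous_on_id)
  then have cD: "compact ?D" using compact_Times[OF K(1) K(1)] by (rule compact_Int_closed[rotated])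
  have neD: "?D \<noteq> {}" using assms by auto
  have contD: "continuous_on ?D (\<lambda>x. \<bar>vert (fst x) - vert (snd x)\<bar>)"
    by (intro continuous_on_rabs continuous_on_diff continuous_on_heis continuous_on_fst continuous_on_snd continuous_on_id)
  from continuous_attains_sup[OF cD neD contD]
  obtain x where x: "x \<in> ?D"
    and sup: "\<forall>y\<in>?D. \<bar>vert (fst y) - vert (snd y)\<bar> \<le> \<bar>vert (fst x) - vert (snd x)\<bar>" ..
  define s where "s = \<bar>vert (fst x) - vert (snd x)\<bar>"
  have le: "\<bar>vert y - vert y'\<bar> \<le> s" if "y \<in> K" "y' \<in> K" "hor y = hor y'" for y y'
    using bspec[OF sup, of "(y, y')"] that by (simp add: s_def)
  have xK: "fst x \<in> K" "snd x \<in> K" "hor (fst x) = hor (snd x)" using x by auto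
  obtain z k y where y: "(z, k) \<in> cantor_index r" "y \<in> K" "fst x = cantor_map r (z, k) y" using K_elem[OF xK(1)] .
  obtain z' k' y' where y': "(z', k') \<in> cantor_index r" "y' \<in> K" "snd x = cantor_map r (z', k') y'" using K_elem[OF xK(2)] .
  have zz: "z = z'" "hor y = hor y'"
    using same_hor[OF y(1) y'(1) y(2) y'(2)] xK(3) by (simp_all add: y(3) y'(3))
  have "real k \<in> {0, 1, 2, 3}" "real k' \<in> {0, 1, 2, 3}" using y(1) y'(1) by (auto simp: cantor_index_def)
  then have kk: "\<bar>real k / 4 - real k' / 4\<bar> \<le> 3 / 4" by auto
  have r2: "r\<^sup>2 < 1 / 4" using power_strict_mono[OF r_bounds(2), of 2] r_bounds(1) by (simp add: power_divide)
  have "vert (fst x) - vert (snd x) = (real k / 4 - real k' / 4) + r\<^sup>2 * (vert y - vert y')"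
    by (simp add: y(3) y'(3) vert_map zz algebra_simps)
  then have "s \<le> \<bar>real k / 4 - real k' / 4\<bar> + \<bar>r\<^sup>2 * (vert y - vert y')\<bar>"
    unfolding s_def by linarith
  also have "\<dots> \<le> 3 / 4 + r\<^sup>2 * s"
    using kk le[OF y(2) y'(2) zz(2)] by (simp add: abs_mult add_mono mult_left_mono)
  finally have "s * (1 - r\<^sup>2) \<le> 3 / 4" by (simp add: algebra_simps)
  have "s < 1"
  proof (rule ccontr)
    assume "\<not> s < 1"
    then have "1 * (1 - r\<^sup>2) \<le> s * (1 - r\<^sup>2)" using r2 by (intro mult_right_mono) auto
    then have "1 * (1 - r\<^sup>2) \<le> 3 / 4" using \<open>s * (1 - r\<^sup>2) \<le> 3 / 4\<close> by (rule order.trans)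
    with r2 show False by simp
  qed
  then show ?thesis using le[OF assms] by linarith
qed

text \<open>Two pieces can meet only over the same horizontal digit. Their vertical digits then
  differ by at least 1/4, more than the gaps scaled by \<open>r\<^sup>2\<close> can bridge by
  \<open>K_fibre\<close>.\<close>

lemma osc: "open_set_condition (cantor_index r) (cantor_map r :: _ \<Rightarrow> 'n heis \<Rightarrow> 'n heis)"
proof (rule open_set_condition_of_disjoint)
  fix a b :: "(real ^ ('n + 'n)) \<times> nat"
  assume ab: "a \<in> cantor_index r" "b \<in> cantor_index r" "a \<noteq> b"
  show "cantor_map r a ` K \<inter> cantor_map r b ` K = {}"
  proof (rule ccontr)
    assume "\<not> ?thesis"
    then obtain p p' where p: "p \<in> K" "p' \<in> K" "cantor_map r a p = cantor_map r b p'" by blast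
    obtain z k z' k' where zk: "a = (z, k)" "b = (z', k')" by (metis surj_pair)
    have zz: "z = z'" "hor p = hor p'"
      using same_hor[of z k z' k' p p'] ab p by (simp_all add: zk)
    have v: "real k / 4 + r\<^sup>2 * vert p = real k' / 4 + r\<^sup>2 * vert p'"
      using arg_cong[OF p(3), of vert] by (simp add: zk vert_map zz)
    have "k \<noteq> k'" using ab(3) zk zz by simp
    then have "1 \<le> \<bar>real k - real k'\<bar>" by linarith
    also have "\<dots> = 4 * \<bar>r\<^sup>2 * (vert p - vert p')\<bar>"
      using v by (simp add: right_diff_distrib abs_if split: if_splits)
    also have "\<dots> = 4 * r\<^sup>2 * \<bar>vert p - vert p'\<bar>" by (simp add: abs_mult)
    also have "\<dots> \<le> 4 * r\<^sup>2 * 1" using K_fibre[OF p(1,2) zz(2)] by (intro mult_left_mono) auto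
    also have "\<dots> < 1" using power_strict_mono[OF r_bounds(2), of 2] r_bounds(1) by (simp add: power_divide)
    finally show False by simp
  qed
qed

text \<open>Horizontal differences within \<open>K\<close> include \<open>1 - r\<close> times every
  standard unit vector, so \<open>L\<close> would be the whole space, whereas
  \<open>d \<le> 2 * CARD('n)\<close> keeps \<open>dim L\<close> below that dimension.\<close>

lemma not_in_vertical:
  assumes F: "F \<in> translates (vertical_subgroups d)"
  shows "\<not> K \<subseteq> (F :: 'n heis set)"
proof
  assume KF: "K \<subseteq> F"
  obtain a L where L: "F = htrans a ` {p. hor p \<in> L}" "d \<le> 2 * CARD('n)" "subspace L" "dim L + 1 = d"
    using F unfolding translates_def vertical_subgroups_def by blast
  obtain p where p: "p \<in> K" using K(2) by blast
  have hL: "hor q - hor a \<in> L" if "q \<in> K" for q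
    using KF that unfolding L(1) htrans_def by auto
  have "axis i 1 \<in> L" for i
  proof -
    let ?e = "(1 - r) *\<^sub>R (axis i 1 :: real ^ ('n + 'n))"
    have "cantor_map r (?e, 0) p \<in> K" "cantor_map r (0, 0) p \<in> K"
      by (intro map_K p; simp add: cantor_index_def axis_def)+
    from hL[OF this(1)] hL[OF this(2)] have "(?e + r *\<^sub>R hor p - hor a) - (0 + r *\<^sub>R hor p - hor a) \<in> L"
      unfolding hor_map using L(3) subspace_diff by blast
    moreover have "(?e + r *\<^sub>R hor p - hor a) - (0 + r *\<^sub>R hor p - hor a) = ?e" by simp
    ultimately have "?e \<in> L" by (simp only:)
    then have "(1 / (1 - r)) *\<^sub>R ?e \<in> L" by (rule subspace_scale[OF L(3)])
    then show ?thesis using r_bounds by simp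
  qed
  then have "Basis \<subseteq> L" by (auto simp: Basis_vec_def)
  then have "L = UNIV" using span_minimal[OF _ L(3)] by (metis span_Basis top.extremum_unique)
  then have "dim L = 2 * CARD('n)" by (simp add: card_UNIV_sum)
  then show False using L(2,4) by simp
qed

text \<open>A translate of a horizontal group is a graph over its horizontal part, but the digits
  \<open>k = 0\<close> and \<open>k = 1\<close> put two points of \<open>K\<close> on one vertical
  line.\<close>

lemma not_in_horizontal:
  assumes F: "F \<in> translates (horizontal_subgroups d)"
  shows "\<not> K \<subseteq> (F :: 'n heis set)"
proof
  assume KF: "K \<subseteq> F"
  obtain a L where L: "F = htrans a ` {p. hor p \<in> L \<and> vert p = 0}"
    using F unfolding translates_def horizontal_subgroups_def by blast
  have v: "vert q = vert a + hform (hor a) (hor q)" if "q \<in> K" for q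
    using KF that unfolding L htrans_def by (auto simp: hform_simps)
  obtain p where p: "p \<in> K" using K(2) by blast
  have "cantor_map r (0, 1) p \<in> K" "cantor_map r (0, 0) p \<in> K"
    by (intro map_K p; simp add: cantor_index_def)+
  from v[OF this(1)] v[OF this(2)] show False by (simp add: hor_map vert_map)
qed

theorem cantor_riesz_unbounded:
  assumes m: "m \<le> 2 * CARD('n) + 1"
  shows "\<not> riesz_bounded_in_L2 (hausdorff_on m (cantor_set r :: 'n heis set)) (real m)"
proof
  assume b: "riesz_bounded_in_L2 (hausdorff_on m (cantor_set r :: 'n heis set)) (real m)"
  have HK: "emeasure (hausdorff_measure m) K = hausdorff_outer m K"
    by (rule emeasure_hausdorff_measure) (simp add: compact_imp_closed K(1))
  show False
    using riesz_unbounded[OF osc m] b hausdorff_outer_finite hausdorff_outer_positive[OF osc] HK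
      not_in_vertical not_in_horizontal by (auto simp: cantor_set_def)
qed

end

theorem corollary4p4:
  "(\<forall>(N::nat) (q :: nat \<Rightarrow> 'n::finite heis) (r :: nat \<Rightarrow> real) (S :: nat \<Rightarrow> 'n heis \<Rightarrow> 'n heis)
      (K :: 'n heis set) (m::nat).
      1 \<le> N \<and>
      (\<forall>i\<in>{1..N}. S i = htrans (q i) \<circ> hdil (r i)) \<and>
      (\<forall>i\<in>{1..N}. 0 < r i \<and> r i < 1) \<and> mono_on {1..N} r \<and>
      open_set_condition {1..N} S \<and>
      K = invariant_set {1..N} S \<and>
      1 \<le> m \<and> m \<le> 2 * CARD('n) + 1 \<and>
      0 < emeasure (hausdorff_measure m) K \<and> emeasure (hausdorff_measure m) K < \<infinity> \<and>
      (\<forall>F \<in> translates (vertical_subgroups (m - 1)) \<union> translates (horizontal_subgroups m).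
         \<not> K \<subseteq> F)
      \<longrightarrow> \<not> riesz_bounded_in_L2 (hausdorff_on m K) (real m))
   \<and>
   (\<forall>(m::nat) (r::real).
      1 \<le> m \<and> m \<le> 2 * CARD('n) + 1 \<and>
      r = 2 powr (- (2 * real CARD('n) + 2) / real m) \<and> r \<in> {0<..<1/2}
      \<longrightarrow> \<not> riesz_bounded_in_L2 (hausdorff_on m (cantor_set r :: 'n heis set)) (real m))"
proof (intro conjI allI impI)
  fix N :: nat and q :: "nat \<Rightarrow> 'n heis" and r :: "nat \<Rightarrow> real" and S :: "nat \<Rightarrow> 'n heis \<Rightarrow> 'n heis"
    and K :: "'n heis set" and m :: nat
  assume "1 \<le> N \<and>
      (\<forall>i\<in>{1..N}. S i = htrans (q i) \<circ> hdil (r i)) \<and>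
      (\<forall>i\<in>{1..N}. 0 < r i \<and> r i < 1) \<and> mono_on {1..N} r \<and>
      open_set_condition {1..N} S \<and>
      K = invariant_set {1..N} S \<and>
      1 \<le> m \<and> m \<le> 2 * CARD('n) + 1 \<and>
      0 < emeasure (hausdorff_measure m) K \<and> emeasure (hausdorff_measure m) K < \<infinity> \<and>
      (\<forall>F \<in> translates (vertical_subgroups (m - 1)) \<union> translates (horizontal_subgroups m).
         \<not> K \<subseteq> F)"
  then have h: "1 \<le> N" "\<forall>i\<in>{1..N}. S i = htrans (q i) \<circ> hdil (r i)" "\<forall>i\<in>{1..N}. 0 < r i \<and> r i < 1"
    "open_set_condition {1..N} S" "K = invariant_set {1..N} S" "m \<le> 2 * CARD('n) + 1"
    "0 < emeasure (hausdorff_measure m) K" "emeasure (hausdorff_measure m) K < \<infinity>"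
    "\<forall>F \<in> translates (vertical_subgroups (m - 1)) \<union> translates (horizontal_subgroups m). \<not> K \<subseteq> F"
    by blast+
  interpret heis_ifs "{1..N}" S q r
    by unfold_locales (use h(1-3) in auto)
  show "\<not> riesz_bounded_in_L2 (hausdorff_on m K) (real m)"
    using riesz_unbounded[OF h(4,6)] h(7-9) unfolding h(5) by blast
next
  fix m :: nat and r :: real
  assume h: "1 \<le> m \<and> m \<le> 2 * CARD('n) + 1 \<and>
      r = 2 powr (- (2 * real CARD('n) + 2) / real m) \<and> r \<in> {0<..<1/2}"
  \<comment> \<open>The \<open>m\<close>-th power of the formula for \<open>r\<close> is the
    relation assumed in \<open>cantor\<close>.\<close>
  have "r ^ m = r powr real m" using h by (simp add: powr_realpow)
  also have "\<dots> = 2 powr ((- (2 * real CARD('n) + 2) / real m) * real m)" using h by (simp only: powr_powr)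
  also have "(- (2 * real CARD('n) + 2) / real m) * real m = - real (2 * CARD('n) + 2)" using h by simp
  also have "2 powr \<dots> = 1 / 2 ^ (2 * CARD('n) + 2)"
    by (simp only: powr_minus powr_realpow[OF zero_less_numeral] inverse_eq_divide)
  finally have "2 ^ (2 * CARD('n) + 2) * r ^ m = 1" by simp
  then interpret cantor r "TYPE('n)" m
    by unfold_locales (use h in auto)
  show "\<not> riesz_bounded_in_L2 (hausdorff_on m (cantor_set r :: 'n heis set)) (real m)"
    by (rule cantor_riesz_unbounded) (use h in blast)
qed

end
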